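(* Let $G$ be a residually finite countably infinite group, let $X\subset\Sigma^G$ be any subshift of finite type with the eventual filling property (EFP), and let $\mathcal I$ be any lattice net of $G$. Then: (1) $\hat{\mathfrak L}_{\mathcal I}$ is simple; (2) $\hat{\mathfrak L}_{\mathcal I}$ equals the commutator subgroup of $\mathfrak L_{\mathcal I}$; (3) $\hat{\mathfrak L}_{\mathcal I}$ and $\mathfrak L_{\mathcal I}$ are normal subgroups of $\mathrm{SAut}(X,\mathcal I)$; (4) $\hat{\mathfrak L}_{\mathcal I}$ is the monolith of $\mathfrak L_{\mathcal I}$ and also the monolith of $\mathrm{SAut}(X,\mathcal I)$.
   Context: $\Sigma$ is a finite alphabet, $\Sigma^G$ has the product topology, and $G$ acts by $\sigma_g(x)_h=x_{hg}$. A subshift is a nonempty closed $G$-invariant set $X\subset\Sigma^G$; it is a subshift of finite type (SFT) if $X=\bigcap_{g\in G}\sigma_g(C)$ for some clopen $C\subset\Sigma^G$. For $D\subset G$, $x|D$ is the restriction of $x$ to $D$ and $X|D=\{x|D:x\in X\}$. EFP: for every finite $F\subset G$ there is a finite $N\subset G$ such that for all $x,y\in X$ there is $z\in X$ with $z|F=x|F$ and $z|(G\setminus N)=y|(G\setminus N)$. A lattice net is a set $\mathcal I$ of finite-index subgroups of $G$ that is directed under reverse inclusion (any two members contain a common member), tends to the trivial subgroup (for every finite $F\subset G\setminus\{e_G\}$ there is $H_0\in\mathcal I$ such that $H\cap F=\emptyset$ for all $H\in\mathcal I$ with $H\le H_0$), and such that every $H\in\mathcal I$ contains some $K\in\mathcal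 I$ that is normal in $G$. A gate on $X$ is a homeomorphism $\chi:X\to X$ for which there is a finite $N\subset G$ with $\chi(x)_g=x_g$ for all $x\in X$, $g\notin N$. A finite $N$ is a strong neighborhood of $\chi$ if moreover there is $\hat\chi:X|N\to X|N$ with $\chi(x)|N=\hat\chi(x|N)$ for all $x$; every gate has one, and $\hat\chi$ is then a permutation of $X|N$. The gate $\chi$ is even if it has a strong neighborhood $N$ such that for every $y\in X|(G\setminus N)$ the map $\hat\chi$ restricts to an even permutation of the finite set $\{x|N: x\in X,\ x|(G\setminus N)=y\}$. For $g\in G$ put $\chi^g=\sigma_g^{-1}\circ\chi\circ\sigma_g$. For $S\subset G$ say $\chi^S$ commutes if $\chi^s$ and $\chi^t$ commute for all $s,t\in S$; then $\chi^S$ denotes the pointwise limit, over finite $F\subset S$ ordered by inclusion, of the compositions $\prod_{s\in F}\chi^s$ (this limit always exists). An $\mathcal I$-gate lattice is a map $\chi^{Hg}$ with $\chi$ a gate, $H\in\mathcal I$, $g\in G$, and $\chi^{Hg}$ commuting; it is even if $\chi$ is even. $\mathfrak L_{\mathcal I}$ is the group generated by $\mathcal I$-gate lattices and $\hat{\mathfrak L}_{\mathcal I}$ the group generated by even $\mathcal I$-gate lattices. $\mathrm{Aut}(X,H)$ is the group of homeomorphisms of $X$ commuting with $\sigma_h$ for all $h\in H$, and $\mathrm{SAut}(X,\mathcal I)=\bigcup_{H\in\mathcal I}\mathrm{Aut}(X,H)$. The groups $\mathfrak L_{\mathcal I}$, $\hat{\mathfrak L}_{\mathcal I}$ are contained in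 it. The monolith of a group is its unique minimal non-trivial normal subgroup, i.e. a non-trivial normal subgroup contained in every non-trivial normal subgroup.
   Formalization: Claims (1) and (4) are stated for X with more than one point: if X is a single point (a subshift of finite type with EFP), all the groups are trivial, hence not simple and without a monolith; (2) and (3) are stated for every X. *)

theory Defs
  imports
    "HOL-Analysis.Analysis"
    "HOL-Algebra.Bij"
    "HOL-Algebra.FiniteProduct"
    "HOL-Algebra.Generated_Groups"
    "HOL-Combinatorics.Permutations"
begin

section \<open>Groups\<close>

text \<open>
  The library locale \<open>simple_group\<close> demands \<open>order G > 1\<close>, where \<open>order\<close> is a cardinality in
  \<open>nat\<close>; it is therefore false for every infinite group. The groups considered here are infinite.
\<close>

definition is_simple :: "('a, 'm) monoid_scheme \<Rightarrow> bool" where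
  "is_simple G \<longleftrightarrow>
     group G \<and> carrier G \<noteq> {\<one>\<^bsub>G\<^esub>} \<and> (\<forall>N. N \<lhd> G \<longrightarrow> N = {\<one>\<^bsub>G\<^esub>} \<or> N = carrier G)"

definition is_monolith :: "'a set \<Rightarrow> ('a, 'm) monoid_scheme \<Rightarrow> bool" where
  "is_monolith M G \<longleftrightarrow>
     M \<lhd> G \<and> M \<noteq> {\<one>\<^bsub>G\<^esub>} \<and> (\<forall>N. N \<lhd> G \<and> N \<noteq> {\<one>\<^bsub>G\<^esub>} \<longrightarrow> M \<subseteq> N)"

definition finite_index_subgroup :: "'a set \<Rightarrow> ('a, 'm) monoid_scheme \<Rightarrow> bool" where
  "finite_index_subgroup H G \<longleftrightarrow> subgroup H G \<and> finite (rcosets\<^bsub>G\<^esub> H)"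

definition residually_finite :: "('a, 'm) monoid_scheme \<Rightarrow> bool" where
  "residually_finite G \<longleftrightarrow>
     (\<forall>g \<in> carrier G - {\<one>\<^bsub>G\<^esub>}. \<exists>N. N \<lhd> G \<and> finite_index_subgroup N G \<and> g \<notin> N)"

text \<open>The second condition, for \<open>F = {}\<close>, forces a lattice net to be nonempty.\<close>

definition lattice_net :: "('a, 'm) monoid_scheme \<Rightarrow> 'a set set \<Rightarrow> bool" where
  "lattice_net G \<I> \<longleftrightarrow>
     (\<forall>H\<in>\<I>. finite_index_subgroup H G) \<and>
     (\<forall>H\<in>\<I>. \<forall>K\<in>\<I>. \<exists>L\<in>\<I>. L \<subseteq> H \<inter> K) \<and>
     (\<forall>F. finite F \<and> F \<subseteq> carrier G - {\<one>\<^bsub>G\<^esub>} \<longrightarrow>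
        (\<exists>H0\<in>\<I>. \<forall>H\<in>\<I>. H \<subseteq> H0 \<longrightarrow> H \<inter> F = {})) \<and>
     (\<forall>H\<in>\<I>. \<exists>K\<in>\<I>. K \<subseteq> H \<and> K \<lhd> G)"


section \<open>Subshifts\<close>

text \<open>
  Configurations are extensional functions: \<open>\<Sigma>\<^sup>G\<close> is \<open>carrier G \<rightarrow>\<^sub>E \<Sigma>\<close>, the carrier of
  \<open>config_space G \<Sigma>\<close>. The restriction of \<open>x\<close> to \<open>D\<close> is \<open>restrict x D\<close>.
\<close>

definition config_space :: "('g, 'm) monoid_scheme \<Rightarrow> 'a set \<Rightarrow> ('g \<Rightarrow> 'a) topology" where
  "config_space G \<Sigma> = product_topology (\<lambda>_. discrete_topology \<Sigma>) (carrier G)"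

definition shift :: "('g, 'm) monoid_scheme \<Rightarrow> 'g \<Rightarrow> ('g \<Rightarrow> 'a) \<Rightarrow> ('g \<Rightarrow> 'a)" where
  "shift G g x = (\<lambda>h\<in>carrier G. x (h \<otimes>\<^bsub>G\<^esub> g))"

definition subshift :: "('g, 'm) monoid_scheme \<Rightarrow> 'a set \<Rightarrow> ('g \<Rightarrow> 'a) set \<Rightarrow> bool" where
  "subshift G \<Sigma> X \<longleftrightarrow>
     X \<noteq> {} \<and> closedin (config_space G \<Sigma>) X \<and> (\<forall>g\<in>carrier G. shift G g ` X \<subseteq> X)"

definition SFT :: "('g, 'm) monoid_scheme \<Rightarrow> 'a set \<Rightarrow> ('g \<Rightarrow> 'a) set \<Rightarrow> bool" where
  "SFT G \<Sigma> X \<longleftrightarrow>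
     subshift G \<Sigma> X \<and>
     (\<exists>C. openin (config_space G \<Sigma>) C \<and> closedin (config_space G \<Sigma>) C \<and>
          X = (\<Inter>g\<in>carrier G. shift G g ` C))"

definition EFP :: "('g, 'm) monoid_scheme \<Rightarrow> ('g \<Rightarrow> 'a) set \<Rightarrow> bool" where
  "EFP G X \<longleftrightarrow>
     (\<forall>F. finite F \<and> F \<subseteq> carrier G \<longrightarrow>
        (\<exists>N. finite N \<and> N \<subseteq> carrier G \<and>
           (\<forall>x\<in>X. \<forall>y\<in>X. \<exists>z\<in>X.
              restrict z F = restrict x F \<and>
              restrict z (carrier G - N) = restrict y (carrier G - N))))"


section \<open>Gates\<close>

text \<open>
  Self-maps of \<open>X\<close> are represented as extensional functions on \<open>X\<close>, so that the groups below
  are subgroups of the library group \<open>BijGroup X\<close>, whose product is composition.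
\<close>

definition self_homeo :: "('g, 'm) monoid_scheme \<Rightarrow> 'a set \<Rightarrow> ('g \<Rightarrow> 'a) set \<Rightarrow>
    (('g \<Rightarrow> 'a) \<Rightarrow> ('g \<Rightarrow> 'a)) set" where
  "self_homeo G \<Sigma> X =
     {f \<in> extensional X.
        homeomorphic_map (subtopology (config_space G \<Sigma>) X) (subtopology (config_space G \<Sigma>) X) f}"

definition fixes_outside :: "('g, 'm) monoid_scheme \<Rightarrow> ('g \<Rightarrow> 'a) set \<Rightarrow>
    (('g \<Rightarrow> 'a) \<Rightarrow> ('g \<Rightarrow> 'a)) \<Rightarrow> 'g set \<Rightarrow> bool" where
  "fixes_outside G X \<phi> N \<longleftrightarrow>
     finite N \<and> N \<subseteq> carrier G \<and> (\<forall>x\<in>X. \<forall>g\<in>carrier G - N. \<phi> x g = x g)"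

definition gate :: "('g, 'm) monoid_scheme \<Rightarrow> 'a set \<Rightarrow> ('g \<Rightarrow> 'a) set \<Rightarrow>
    (('g \<Rightarrow> 'a) \<Rightarrow> ('g \<Rightarrow> 'a)) \<Rightarrow> bool" where
  "gate G \<Sigma> X \<phi> \<longleftrightarrow> \<phi> \<in> self_homeo G \<Sigma> X \<and> (\<exists>N. fixes_outside G X \<phi> N)"

text \<open>\<open>N\<close> is a strong neighborhood of \<open>\<phi>\<close>, as witnessed by the map \<open>\<phi>'\<close> on \<open>X|N\<close>.\<close>

definition strong_nbhd :: "('g, 'm) monoid_scheme \<Rightarrow> ('g \<Rightarrow> 'a) set \<Rightarrow>
    (('g \<Rightarrow> 'a) \<Rightarrow> ('g \<Rightarrow> 'a)) \<Rightarrow> 'g set \<Rightarrow> (('g \<Rightarrow> 'a) \<Rightarrow> ('g \<Rightarrow> 'a)) \<Rightarrow> bool" where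
  "strong_nbhd G X \<phi> N \<phi>' \<longleftrightarrow>
     fixes_outside G X \<phi> N \<and>
     \<phi>' ` ((\<lambda>x. restrict x N) ` X) \<subseteq> (\<lambda>x. restrict x N) ` X \<and>
     (\<forall>x\<in>X. restrict (\<phi> x) N = \<phi>' (restrict x N))"

text \<open>
  In the library, a permutation of \<open>P\<close> is a function on the whole type that is the identity
  outside \<open>P\<close>, and \<open>evenperm\<close> is meaningful only for such functions with \<open>P\<close> finite.
\<close>

definition even_perm_on :: "'b set \<Rightarrow> ('b \<Rightarrow> 'b) \<Rightarrow> bool" where
  "even_perm_on P f \<longleftrightarrow>
     (let p = (\<lambda>w. if w \<in> P then f w else w) in p permutes P \<and> evenperm p)"

definition even_gate :: "('g, 'm) monoid_scheme \<Rightarrow> 'a set \<Rightarrow> ('g \<Rightarrow> 'a) set \<Rightarrow>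
    (('g \<Rightarrow> 'a) \<Rightarrow> ('g \<Rightarrow> 'a)) \<Rightarrow> bool" where
  "even_gate G \<Sigma> X \<phi> \<longleftrightarrow>
     gate G \<Sigma> X \<phi> \<and>
     (\<exists>N \<phi>'. strong_nbhd G X \<phi> N \<phi>' \<and>
        (\<forall>y \<in> (\<lambda>x. restrict x (carrier G - N)) ` X.
           even_perm_on {restrict x N | x. x \<in> X \<and> restrict x (carrier G - N) = y} \<phi>'))"


section \<open>Gate lattices\<close>

text \<open>The conjugate \<open>\<phi>\<^sup>g = \<sigma>\<^sub>g\<^sup>-\<^sup>1 \<circ> \<phi> \<circ> \<sigma>\<^sub>g\<close>; here \<open>\<sigma>\<^sub>g\<^sup>-\<^sup>1\<close> is the shift by the inverse of \<open>g\<close>.\<close>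

definition gate_conj :: "('g, 'm) monoid_scheme \<Rightarrow> ('g \<Rightarrow> 'a) set \<Rightarrow>
    (('g \<Rightarrow> 'a) \<Rightarrow> ('g \<Rightarrow> 'a)) \<Rightarrow> 'g \<Rightarrow> (('g \<Rightarrow> 'a) \<Rightarrow> ('g \<Rightarrow> 'a))" where
  "gate_conj G X \<phi> g = (\<lambda>x\<in>X. shift G (inv\<^bsub>G\<^esub> g) (\<phi> (shift G g x)))"

definition conjs_commute :: "('g, 'm) monoid_scheme \<Rightarrow> ('g \<Rightarrow> 'a) set \<Rightarrow>
    (('g \<Rightarrow> 'a) \<Rightarrow> ('g \<Rightarrow> 'a)) \<Rightarrow> 'g set \<Rightarrow> bool" where
  "conjs_commute G X \<phi> S \<longleftrightarrow>
     (\<forall>s\<in>S. \<forall>t\<in>S. compose X (gate_conj G X \<phi> s) (gate_conj G X \<phi> t) =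
                  compose X (gate_conj G X \<phi> t) (gate_conj G X \<phi> s))"

text \<open>
  \<open>f\<close> is the pointwise limit \<open>\<phi>\<^sup>S\<close>. It is unique, the topology being Hausdorff. This is only used
  when the conjugates \<open>\<phi>\<^sup>s\<close>, \<open>s \<in> S\<close>, commute, so that \<open>finprod\<close> in the non-commutative group
  \<open>BijGroup X\<close> is the composition of the \<open>\<phi>\<^sup>s\<close>, \<open>s \<in> F\<close>, in any order.
\<close>

definition is_gate_product :: "('g, 'm) monoid_scheme \<Rightarrow> 'a set \<Rightarrow> ('g \<Rightarrow> 'a) set \<Rightarrow>
    (('g \<Rightarrow> 'a) \<Rightarrow> ('g \<Rightarrow> 'a)) \<Rightarrow> 'g set \<Rightarrow> (('g \<Rightarrow> 'a) \<Rightarrow> ('g \<Rightarrow> 'a)) \<Rightarrow> bool" where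
  "is_gate_product G \<Sigma> X \<phi> S f \<longleftrightarrow>
     f \<in> extensional X \<and>
     (\<forall>x\<in>X. limitin (subtopology (config_space G \<Sigma>) X)
               (\<lambda>F. finprod (BijGroup X) (gate_conj G X \<phi>) F x) (f x)
               (finite_subsets_at_top S))"

definition gate_lattices :: "('g, 'm) monoid_scheme \<Rightarrow> 'a set \<Rightarrow> ('g \<Rightarrow> 'a) set \<Rightarrow> 'g set set \<Rightarrow>
    (('g \<Rightarrow> 'a) \<Rightarrow> ('g \<Rightarrow> 'a)) set" where
  "gate_lattices G \<Sigma> X \<I> =
     {f. \<exists>\<phi> H g. gate G \<Sigma> X \<phi> \<and> H \<in> \<I> \<and> g \<in> carrier G \<and>
           conjs_commute G X \<phi> (H #>\<^bsub>G\<^esub> g) \<and> is_gate_product G \<Sigma> X \<phi> (H #>\<^bsub>G\<^esub> g) f}"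

definition even_gate_lattices :: "('g, 'm) monoid_scheme \<Rightarrow> 'a set \<Rightarrow> ('g \<Rightarrow> 'a) set \<Rightarrow>
    'g set set \<Rightarrow> (('g \<Rightarrow> 'a) \<Rightarrow> ('g \<Rightarrow> 'a)) set" where
  "even_gate_lattices G \<Sigma> X \<I> =
     {f. \<exists>\<phi> H g. even_gate G \<Sigma> X \<phi> \<and> H \<in> \<I> \<and> g \<in> carrier G \<and>
           conjs_commute G X \<phi> (H #>\<^bsub>G\<^esub> g) \<and> is_gate_product G \<Sigma> X \<phi> (H #>\<^bsub>G\<^esub> g) f}"

definition gate_lattice_group :: "('g, 'm) monoid_scheme \<Rightarrow> 'a set \<Rightarrow> ('g \<Rightarrow> 'a) set \<Rightarrow>
    'g set set \<Rightarrow> (('g \<Rightarrow> 'a) \<Rightarrow> ('g \<Rightarrow> 'a)) set" where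
  "gate_lattice_group G \<Sigma> X \<I> = generate (BijGroup X) (gate_lattices G \<Sigma> X \<I>)"

definition even_gate_lattice_group :: "('g, 'm) monoid_scheme \<Rightarrow> 'a set \<Rightarrow> ('g \<Rightarrow> 'a) set \<Rightarrow>
    'g set set \<Rightarrow> (('g \<Rightarrow> 'a) \<Rightarrow> ('g \<Rightarrow> 'a)) set" where
  "even_gate_lattice_group G \<Sigma> X \<I> = generate (BijGroup X) (even_gate_lattices G \<Sigma> X \<I>)"


section \<open>Stabilized automorphism groups\<close>

definition Aut_subshift :: "('g, 'm) monoid_scheme \<Rightarrow> 'a set \<Rightarrow> ('g \<Rightarrow> 'a) set \<Rightarrow> 'g set \<Rightarrow>
    (('g \<Rightarrow> 'a) \<Rightarrow> ('g \<Rightarrow> 'a)) set" where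
  "Aut_subshift G \<Sigma> X H =
     {f \<in> self_homeo G \<Sigma> X. \<forall>h\<in>H. \<forall>x\<in>X. f (shift G h x) = shift G h (f x)}"

definition SAut :: "('g, 'm) monoid_scheme \<Rightarrow> 'a set \<Rightarrow> ('g \<Rightarrow> 'a) set \<Rightarrow> 'g set set \<Rightarrow>
    (('g \<Rightarrow> 'a) \<Rightarrow> ('g \<Rightarrow> 'a)) set" where
  "SAut G \<Sigma> X \<I> = (\<Union>H\<in>\<I>. Aut_subshift G \<Sigma> X H)"

end

theory Submission
  imports Defs
begin

text \<open>
  All maps live in \<open>BijGroup X\<close>. By compactness, a homeomorphism of \<open>X\<close> is a bijection which, like
  its inverse, computes each cell from a finite window (\<open>self_homeo_eq\<close>). A gate lattice is then a
  uniform limit of finite products of conjugates of its gate, because a given cell is affected by only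
  finitely many of them (\<open>is_gate_product_iff\<close>). Three laws govern these limits. A lattice along a coset
  of \<open>H\<close> is a finite product of lattices along cosets of any smaller member of the net
  (\<open>lat_split\<close>). Once \<open>K\<close> is so small that the translates of a finite set of cells by a coset of \<open>K\<close>
  are disjoint, taking lattices along that coset is a homomorphism on the gates acting on that set
  (\<open>lat_mult\<close>). A
  homeomorphism that commutes with the shifts involved conjugates a lattice by conjugating its gate
  (\<open>lat_conj\<close>). So statements about lattices reduce to statements about single gates, each of
  which permutes the finitely many patterns on some finite set of cells.

  Normality in \<open>SAut\<close> follows because a homeomorphism that commutes with a finite-index group of
  shifts turns finite changes into finite changes, hence gates into gates, and conjugation
  preserves parity (\<open>gate_conjugate\<close>, \<open>even_conjugate\<close>).

  For the commutator subgroup, two gate lattices are split along a small \<open>K\<close> and aligned so that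
  corresponding conjugates overlap only with one another; their commutator is then the lattice of
  a commutator of gates, which is even (\<open>commutator_lattices\<close>). Conversely, gluing in a subshift of
  finite type shows that an even gate is a product of 3-cycles of patterns
  (\<open>even_gate_generated\<close>), and a 3-cycle is a commutator of two transpositions.

  For the monolith, let \<open>N\<close> be a nontrivial subgroup of \<open>SAut\<close> normalized by the even lattices, and let
  \<open>f \<in> N\<close> be nontrivial. It displaces some cylinder. For even gates \<open>\<alpha>\<close> and \<open>\<beta>\<close> that move nothing
  outside this cylinder, the double commutator of \<open>f\<close>, \<open>\<alpha>\<close> and \<open>\<beta>\<close> is that of \<open>\<alpha>\<^sup>-\<^sup>1\<close> and \<open>\<beta>\<close>
  (\<open>double_commutator\<close>), so \<open>N\<close> contains the lattices of these commutators. By eventual filling every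
  pattern can be exchanged with many patterns of the cylinder, hence every 3-cycle is conjugate,
  under even gates, to a commutator of 3-cycles supported in the cylinder
  (\<open>even_gates_normally_generated\<close>), and \<open>N\<close> contains all even lattices. Applied to the three
  groups in question, this gives the simplicity of the even group and both monoliths.
\<close>

section \<open>Finite windows\<close>

definition agree :: "'g set \<Rightarrow> ('g \<Rightarrow> 'a) \<Rightarrow> ('g \<Rightarrow> 'a) \<Rightarrow> bool" where
  "agree D x y \<longleftrightarrow> (\<forall>g\<in>D. x g = y g)"

lemma agreeI: "(\<And>g. g \<in> D \<Longrightarrow> x g = y g) \<Longrightarrow> agree D x y"
  by (simp add: agree_def)

lemma agreeD: "agree D x y \<Longrightarrow> g \<in> D \<Longrightarrow> x g = y g"
  by (simp add: agree_def)

lemma agree_refl [simp]: "agree D x x"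
  by (simp add: agree_def)

lemma agree_sym: "agree D x y \<Longrightarrow> agree D y x"
  by (simp add: agree_def)

lemma agree_trans: "agree D x y \<Longrightarrow> agree D y z \<Longrightarrow> agree D x z"
  by (simp add: agree_def)

lemma agree_subset: "agree D x y \<Longrightarrow> E \<subseteq> D \<Longrightarrow> agree E x y"
  by (auto simp: agree_def)

locale subshift_system = group G for G :: "('g, 'm) monoid_scheme" (structure) +
  fixes \<Sigma> :: "'a set" and X :: "('g \<Rightarrow> 'a) set"
  assumes finite_alphabet: "finite \<Sigma>"
    and subshift: "subshift G \<Sigma> X"
begin

abbreviation B :: "(('g \<Rightarrow> 'a) \<Rightarrow> ('g \<Rightarrow> 'a)) monoid" where
  "B \<equiv> BijGroup X"

abbreviation bmult (infixl "\<star>" 70) where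
  "bmult f g \<equiv> f \<otimes>\<^bsub>B\<^esub> g"

abbreviation binv where
  "binv f \<equiv> inv\<^bsub>B\<^esub> f"

sublocale B: group B
  by (rule group_BijGroup)

lemma topspace_config: "topspace (config_space G \<Sigma>) = carrier G \<rightarrow>\<^sub>E \<Sigma>"
  by (simp add: config_space_def)

lemma X_closedin: "closedin (config_space G \<Sigma>) X"
  and X_nonempty: "X \<noteq> {}"
  and shift_in_X: "\<And>g x. g \<in> carrier G \<Longrightarrow> x \<in> X \<Longrightarrow> shift G g x \<in> X"
  using subshift by (auto simp: subshift_def)

lemma X_subset: "X \<subseteq> carrier G \<rightarrow>\<^sub>E \<Sigma>"
  using closedin_subset[OF X_closedin] topspace_config by simp

lemma X_extensional: "x \<in> X \<Longrightarrow> x \<in> extensional (carrier G)"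
  using X_subset by (auto simp: PiE_def)

lemma X_eqI: "x \<in> X \<Longrightarrow> y \<in> X \<Longrightarrow> agree (carrier G) x y \<Longrightarrow> x = y"
  by (erule (1) extensionalityI[OF X_extensional X_extensional], erule (1) agreeD)

lemma X_symbol: "x \<in> X \<Longrightarrow> g \<in> carrier G \<Longrightarrow> x g \<in> \<Sigma>"
  using X_subset by auto

lemma topspace_X: "topspace (subtopology (config_space G \<Sigma>) X) = X"
  using X_subset topspace_config by auto

lemma compact_config: "compact_space (config_space G \<Sigma>)"
  unfolding config_space_def compact_space_product_topology
  using finite_alphabet by (simp add: compact_space_discrete_topology)

lemma openin_cylinder:
  assumes "x \<in> carrier G \<rightarrow>\<^sub>E \<Sigma>" "finite V" "V \<subseteq> carrier G"
  shows "openin (config_space G \<Sigma>) {y \<in> carrier G \<rightarrow>\<^sub>E \<Sigma>. agree V x y}"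
proof -
  let ?U = "\<lambda>i. if i \<in> V then {x i} else \<Sigma>"
  have eq: "{y \<in> carrier G \<rightarrow>\<^sub>E \<Sigma>. agree V x y} = Pi\<^sub>E (carrier G) ?U"
  proof (rule Set.set_eqI, rule iffI)
    fix y assume "y \<in> {y \<in> carrier G \<rightarrow>\<^sub>E \<Sigma>. agree V x y}"
    then show "y \<in> Pi\<^sub>E (carrier G) ?U" by (auto simp: PiE_iff agree_def)
  next
    fix y assume y: "y \<in> Pi\<^sub>E (carrier G) ?U"
    have yi: "y i \<in> ?U i" if "i \<in> carrier G" for i using y that by (rule PiE_mem)
    have "y i \<in> \<Sigma>" if "i \<in> carrier G" for i
      using yi[OF that] assms(1) that by (auto split: if_splits)
    moreover have "agree V x y"
    proof (rule agreeI)
      fix i assume "i \<in> V"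
      then show "x i = y i" using yi[of i] assms(3) by auto
    qed
    ultimately show "y \<in> {y \<in> carrier G \<rightarrow>\<^sub>E \<Sigma>. agree V x y}"
      using y by (auto simp: PiE_iff)
  qed
  have "finite {i \<in> carrier G. ?U i \<noteq> \<Sigma>}"
    by (rule finite_subset[OF _ assms(2)]) auto
  then show ?thesis
    unfolding eq config_space_def openin_PiE_gen
    using assms by (auto simp: PiE_iff)
qed

text \<open>Compactness of \<open>\<Sigma>\<^sup>G\<close> makes membership in a clopen set a finite-window condition.\<close>

lemma clopen_window:
  assumes S: "closedin (config_space G \<Sigma>) S"
    and o1: "openin (subtopology (config_space G \<Sigma>) S) U"
    and o2: "openin (subtopology (config_space G \<Sigma>) S) (S - U)"
  obtains V where "finite V" "V \<subseteq> carrier G"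
    "\<And>x y. x \<in> S \<Longrightarrow> y \<in> S \<Longrightarrow> agree V x y \<Longrightarrow> x \<in> U \<Longrightarrow> y \<in> U"
proof -
  have Ssub: "S \<subseteq> carrier G \<rightarrow>\<^sub>E \<Sigma>" using closedin_subset[OF S] topspace_config by simp
  have open_win: "\<exists>V. finite V \<and> V \<subseteq> carrier G \<and> (\<forall>y\<in>S. agree V x y \<longrightarrow> y \<in> T)"
    if T: "openin (subtopology (config_space G \<Sigma>) S) T" "x \<in> T" for x T
  proof -
    obtain T' where T': "openin (config_space G \<Sigma>) T'" "T = T' \<inter> S"
      using T(1) by (auto simp: openin_subtopology)
    with T(2) obtain U where U: "finite {i \<in> carrier G. U i \<noteq> \<Sigma>}"
      "x \<in> Pi\<^sub>E (carrier G) U" "Pi\<^sub>E (carrier G) U \<subseteq> T'"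
      unfolding config_space_def openin_product_topology_alt by auto
    have "y \<in> T" if y: "y \<in> S" "agree {i \<in> carrier G. U i \<noteq> \<Sigma>} x y" for y
    proof -
      have yP: "y \<in> carrier G \<rightarrow>\<^sub>E \<Sigma>" using y(1) Ssub by auto
      have "y i \<in> U i" if i: "i \<in> carrier G" for i
      proof (cases "U i = \<Sigma>")
        case True then show ?thesis using PiE_mem[OF yP i] by simp
      next
        case False
        then have "y i = x i" using agreeD[OF y(2), of i] i by simp
        then show ?thesis using PiE_mem[OF U(2) i] by simp
      qed
      then have "y \<in> Pi\<^sub>E (carrier G) U" using yP by (auto simp: PiE_iff)
      then show ?thesis using U(3) T'(2) y(1) by auto
    qed
    with U(1) show ?thesis by (intro exI[of _ "{i \<in> carrier G. U i \<noteq> \<Sigma>}"]) auto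
  qed
  have "\<exists>V. finite V \<and> V \<subseteq> carrier G \<and> (\<forall>y\<in>S. agree V x y \<longrightarrow> (y \<in> U \<longleftrightarrow> x \<in> U))"
    if "x \<in> S" for x
  proof (cases "x \<in> U")
    case True
    show ?thesis using open_win[OF o1 True] True by blast
  next
    case False
    show ?thesis using open_win[OF o2, of x] False that by blast
  qed
  then obtain V where V: "\<And>x. x \<in> S \<Longrightarrow> finite (V x)" "\<And>x. x \<in> S \<Longrightarrow> V x \<subseteq> carrier G"
    "\<And>x y. x \<in> S \<Longrightarrow> y \<in> S \<Longrightarrow> agree (V x) x y \<Longrightarrow> (y \<in> U \<longleftrightarrow> x \<in> U)"
    by metis
  let ?cyl = "\<lambda>x. {y \<in> carrier G \<rightarrow>\<^sub>E \<Sigma>. agree (V x) x y}"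
  have "compactin (config_space G \<Sigma>) S"
    by (rule closedin_compact_space[OF compact_config S])
  moreover have "\<forall>T\<in>?cyl ` S. openin (config_space G \<Sigma>) T"
  proof
    fix T assume "T \<in> ?cyl ` S"
    then obtain x where x: "x \<in> S" "T = ?cyl x" by auto
    then show "openin (config_space G \<Sigma>) T" using openin_cylinder[of x "V x"] V Ssub by auto
  qed
  moreover have "S \<subseteq> \<Union>(?cyl ` S)"
  proof
    fix x assume "x \<in> S"
    then have "x \<in> ?cyl x" using Ssub by (simp add: subset_iff)
    then show "x \<in> \<Union>(?cyl ` S)" using \<open>x \<in> S\<close> by blast
  qed
  ultimately obtain \<F> where F: "finite \<F>" "\<F> \<subseteq> ?cyl ` S" "S \<subseteq> \<Union>\<F>"
    unfolding compactin_def by meson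
  obtain S0 where S0: "S0 \<subseteq> S" "finite S0" "\<F> = ?cyl ` S0"
    using finite_subset_image[OF F(1,2)] by auto
  show thesis
  proof (rule that)
    show "finite (\<Union>(V ` S0))" using S0 V(1) by auto
    show "\<Union>(V ` S0) \<subseteq> carrier G" using S0 V(2) by auto
    fix x y assume xy: "x \<in> S" "y \<in> S" "agree (\<Union>(V ` S0)) x y" "x \<in> U"
    obtain z where z: "z \<in> S0" "agree (V z) z x" using xy(1) F(3) S0(3) by auto
    have "agree (V z) z y" using z agree_trans agree_subset[OF xy(3), of "V z"] by blast
    then show "y \<in> U" using V(3)[of z x] V(3)[of z y] z S0(1) xy by auto
  qed
qed

text \<open>Uniform continuity of a self-map of \<open>X\<close>, in combinatorial form.\<close>

definition windowed :: "(('g \<Rightarrow> 'a) \<Rightarrow> ('g \<Rightarrow> 'a)) \<Rightarrow> bool" where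
  "windowed f \<longleftrightarrow> (\<forall>W. finite W \<and> W \<subseteq> carrier G \<longrightarrow>
     (\<exists>V. finite V \<and> V \<subseteq> carrier G \<and> (\<forall>x\<in>X. \<forall>y\<in>X. agree V x y \<longrightarrow> agree W (f x) (f y))))"

lemma windowedE:
  assumes "windowed f" "finite W" "W \<subseteq> carrier G"
  obtains V where "finite V" "V \<subseteq> carrier G"
    "\<And>x y. x \<in> X \<Longrightarrow> y \<in> X \<Longrightarrow> agree V x y \<Longrightarrow> agree W (f x) (f y)"
proof -
  obtain V where "finite V \<and> V \<subseteq> carrier G \<and> (\<forall>x\<in>X. \<forall>y\<in>X. agree V x y \<longrightarrow> agree W (f x) (f y))"
    using assms(1)[unfolded windowed_def, rule_format, OF conjI[OF assms(2,3)]] ..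
  then show thesis by (intro that[of V]) blast+
qed

lemma continuous_iff_windowed:
  assumes fX: "f ` X \<subseteq> X"
  shows "continuous_map (subtopology (config_space G \<Sigma>) X) (subtopology (config_space G \<Sigma>) X) f
    \<longleftrightarrow> windowed f" (is "?c \<longleftrightarrow> _")
proof
  assume c: ?c
  show "windowed f"
    unfolding windowed_def
  proof (intro allI impI)
    fix W :: "'g set" assume W: "finite W \<and> W \<subseteq> carrier G"
    let ?U = "\<lambda>g a. {x \<in> X. f x g = a}"
    have "\<exists>V. finite V \<and> V \<subseteq> carrier G \<and>
       (\<forall>x\<in>X. \<forall>y\<in>X. agree V x y \<longrightarrow> x \<in> ?U g a \<longrightarrow> y \<in> ?U g a)"
      if g: "g \<in> carrier G" and a: "a \<in> \<Sigma>" for g a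
    proof -
      have cg: "continuous_map (subtopology (config_space G \<Sigma>) X) (discrete_topology \<Sigma>) (\<lambda>x. f x g)"
      proof -
        have "continuous_map (subtopology (config_space G \<Sigma>) X) (config_space G \<Sigma>) f"
          using c continuous_map_in_subtopology by blast
        then show ?thesis
          unfolding config_space_def using g by (auto simp: continuous_map_componentwise)
      qed
      have o: "openin (subtopology (config_space G \<Sigma>) X) {x \<in> X. f x g \<in> A}" if "A \<subseteq> \<Sigma>" for A
        using openin_continuous_map_preimage[OF cg, of A] that by (simp add: topspace_X del: topspace_subtopology)
      have fS: "f x g \<in> \<Sigma>" if "x \<in> X" for x
        using fX that g X_symbol by auto
      have 1: "?U g a = {x \<in> X. f x g \<in> {a}}" by auto
      have 2: "X - ?U g a = {x \<in> X. f x g \<in> \<Sigma> - {a}}" using fS by auto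
      have o1: "openin (subtopology (config_space G \<Sigma>) X) (?U g a)"
        unfolding 1 using a by (intro o) auto
      have o2: "openin (subtopology (config_space G \<Sigma>) X) (X - ?U g a)"
        unfolding 2 by (intro o) auto
      show ?thesis
      proof (rule clopen_window[OF X_closedin o1 o2])
        fix V assume V: "finite V" "V \<subseteq> carrier G"
          and *: "\<And>x y. x \<in> X \<Longrightarrow> y \<in> X \<Longrightarrow> agree V x y \<Longrightarrow> x \<in> ?U g a \<Longrightarrow> y \<in> ?U g a"
        show ?thesis
        proof (rule exI[of _ V], intro conjI ballI impI)
          fix x y assume "x \<in> X" "y \<in> X" "agree V x y" "x \<in> ?U g a"
          then show "y \<in> ?U g a" by (rule *)
        qed (rule V)+
      qed
    qed
    then have "\<forall>g a. \<exists>V. g \<in> carrier G \<longrightarrow> a \<in> \<Sigma> \<longrightarrow> finite V \<and> V \<subseteq> carrier G \<and>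
       (\<forall>x\<in>X. \<forall>y\<in>X. agree V x y \<longrightarrow> x \<in> ?U g a \<longrightarrow> y \<in> ?U g a)"
      by meson
    then obtain V where V0: "\<forall>g a. g \<in> carrier G \<longrightarrow> a \<in> \<Sigma> \<longrightarrow> finite (V g a) \<and> V g a \<subseteq> carrier G \<and>
       (\<forall>x\<in>X. \<forall>y\<in>X. agree (V g a) x y \<longrightarrow> x \<in> ?U g a \<longrightarrow> y \<in> ?U g a)"
      unfolding choice_iff by blast
    note V = V0[THEN spec, THEN spec, THEN mp, THEN mp]
    let ?V = "\<Union>g\<in>W. \<Union>a\<in>\<Sigma>. V g a"
    have "f x g = f y g" if xy: "x \<in> X" "y \<in> X" "agree ?V x y" "g \<in> W" for x y g
    proof -
      have g: "g \<in> carrier G" using xy(4) W by auto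
      have a: "f x g \<in> \<Sigma>"
        using fX xy(1) g X_symbol by auto
      have "agree (V g (f x g)) x y" by (rule agree_subset[OF xy(3)]) (use xy(4) a in auto)
      then have "y \<in> ?U g (f x g)" using V[OF g a] xy(1,2) by blast
      then show ?thesis by simp
    qed
    then have "\<forall>x\<in>X. \<forall>y\<in>X. agree ?V x y \<longrightarrow> agree W (f x) (f y)"
      by (auto intro: agreeI)
    moreover have "finite ?V" using W V finite_alphabet by auto
    moreover have "?V \<subseteq> carrier G" using W V by blast
    ultimately show "\<exists>V. finite V \<and> V \<subseteq> carrier G \<and>
        (\<forall>x\<in>X. \<forall>y\<in>X. agree V x y \<longrightarrow> agree W (f x) (f y))"
      by (intro exI[of _ ?V] conjI)
  qed
next
  assume w: "windowed f"
  have "continuous_map (subtopology (config_space G \<Sigma>) X) (discrete_topology \<Sigma>) (\<lambda>x. f x g)"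
    if g: "g \<in> carrier G" for g
  proof -
    obtain V where V: "finite V" "V \<subseteq> carrier G"
      "\<And>x y. x \<in> X \<Longrightarrow> y \<in> X \<Longrightarrow> agree V x y \<Longrightarrow> agree {g} (f x) (f y)"
      using windowedE[OF w, of "{g}"] g by auto
    have "openin (subtopology (config_space G \<Sigma>) X) {x \<in> X. f x g \<in> A}" for A
    proof (subst openin_subopen, intro ballI)
      fix x assume x: "x \<in> {x \<in> X. f x g \<in> A}"
      let ?T = "{y \<in> carrier G \<rightarrow>\<^sub>E \<Sigma>. agree V x y} \<inter> X"
      have "openin (subtopology (config_space G \<Sigma>) X) ?T"
        unfolding openin_subtopology using openin_cylinder[of x V] V(1,2) x X_subset by blast
      moreover have "x \<in> ?T" using x X_subset by auto
      moreover have "?T \<subseteq> {x \<in> X. f x g \<in> A}" using V(3)[of x] x by (auto simp: agree_def)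
      ultimately show "\<exists>T. openin (subtopology (config_space G \<Sigma>) X) T \<and> x \<in> T \<and>
          T \<subseteq> {x \<in> X. f x g \<in> A}" by blast
    qed
    moreover have "f x g \<in> \<Sigma>" if "x \<in> X" for x
      using fX that g X_symbol by auto
    ultimately show ?thesis by (auto simp: continuous_map_def topspace_X simp del: topspace_subtopology)
  qed
  moreover have "f ` X \<subseteq> extensional (carrier G)" using fX X_extensional by auto
  ultimately have "continuous_map (subtopology (config_space G \<Sigma>) X) (config_space G \<Sigma>) f"
    using topspace_X unfolding config_space_def by (auto simp: continuous_map_componentwise)
  then show ?c
    using fX by (auto simp: continuous_map_in_subtopology topspace_X)
qed

lemma limit_in_X:
  assumes x: "x \<in> extensional (carrier G)"
    and app: "\<And>W. finite W \<Longrightarrow> W \<subseteq> carrier G \<Longrightarrow> \<exists>y\<in>X. agree W x y"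
  shows "x \<in> X"
proof -
  have xP: "x \<in> carrier G \<rightarrow>\<^sub>E \<Sigma>"
  proof (rule PiE_I)
    fix g assume g: "g \<in> carrier G"
    obtain y where y: "y \<in> X" "agree {g} x y" using app[of "{g}"] g by auto
    have "y g \<in> \<Sigma>" using X_subset y(1) g by auto
    then show "x g \<in> \<Sigma>" using agreeD[OF y(2)] by simp
  qed (use x in \<open>auto simp: extensional_def\<close>)
  show ?thesis
  proof (rule ccontr)
    assume "x \<notin> X"
    have op: "openin (config_space G \<Sigma>) ((carrier G \<rightarrow>\<^sub>E \<Sigma>) - X)"
      using X_closedin topspace_config by (auto simp: closedin_def)
    obtain U where U: "finite {i \<in> carrier G. U i \<noteq> \<Sigma>}"
      "x \<in> Pi\<^sub>E (carrier G) U" "Pi\<^sub>E (carrier G) U \<subseteq> (carrier G \<rightarrow>\<^sub>E \<Sigma>) - X"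
    proof -
      have "x \<in> (carrier G \<rightarrow>\<^sub>E \<Sigma>) - X" using xP \<open>x \<notin> X\<close> by simp
      moreover have "\<forall>x\<in>(carrier G \<rightarrow>\<^sub>E \<Sigma>) - X. \<exists>U. finite {i \<in> carrier G. U i \<noteq> \<Sigma>} \<and>
          (\<forall>i\<in>carrier G. U i \<subseteq> \<Sigma>) \<and> x \<in> Pi\<^sub>E (carrier G) U \<and>
          Pi\<^sub>E (carrier G) U \<subseteq> (carrier G \<rightarrow>\<^sub>E \<Sigma>) - X"
        using op unfolding config_space_def openin_product_topology_alt by simp
      ultimately have "\<exists>U. finite {i \<in> carrier G. U i \<noteq> \<Sigma>} \<and>
          (\<forall>i\<in>carrier G. U i \<subseteq> \<Sigma>) \<and> x \<in> Pi\<^sub>E (carrier G) U \<and>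
          Pi\<^sub>E (carrier G) U \<subseteq> (carrier G \<rightarrow>\<^sub>E \<Sigma>) - X"
        by (rule bspec[rotated])
      then show thesis using that by (elim exE conjE)
    qed
    obtain y where y: "y \<in> X" "agree {i \<in> carrier G. U i \<noteq> \<Sigma>} x y"
      using app[of "{i \<in> carrier G. U i \<noteq> \<Sigma>}"] U(1) by auto
    have yP: "y \<in> carrier G \<rightarrow>\<^sub>E \<Sigma>" using y(1) X_subset by auto
    have "y i \<in> U i" if i: "i \<in> carrier G" for i
    proof (cases "U i = \<Sigma>")
      case True then show ?thesis using PiE_mem[OF yP i] by simp
    next
      case False
      then have "x i = y i" using agreeD[OF y(2), of i] i by simp
      then show ?thesis using PiE_mem[OF U(2) i] by simp
    qed
    then have "y \<in> Pi\<^sub>E (carrier G) U" using yP by (auto simp: PiE_iff)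
    then show False using U(3) y(1) by auto
  qed
qed

end

context subshift_system
begin

section \<open>The group of self-homeomorphisms and the shift action\<close>

lemma B_iff: "f \<in> carrier B \<longleftrightarrow> f \<in> extensional X \<and> bij_betw f X X"
  by (simp add: BijGroup_def Bij_def)

lemma B_in_X: "f \<in> carrier B \<Longrightarrow> x \<in> X \<Longrightarrow> f x \<in> X"
  by (auto simp: B_iff bij_betw_def)

lemma B_apply: "f \<in> carrier B \<Longrightarrow> g \<in> carrier B \<Longrightarrow> x \<in> X \<Longrightarrow> (f \<star> g) x = f (g x)"
  by (simp add: BijGroup_def compose_def)

lemma B_one_apply: "x \<in> X \<Longrightarrow> \<one>\<^bsub>B\<^esub> x = x"
  by (simp add: BijGroup_def)

lemma B_eqI:
  assumes "f \<in> carrier B" "g \<in> carrier B" "\<And>x. x \<in> X \<Longrightarrow> f x = g x"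
  shows "f = g"
  using assms extensionalityI[of f X g] by (simp add: B_iff)

lemma B_inv_left: "f \<in> carrier B \<Longrightarrow> x \<in> X \<Longrightarrow> binv f (f x) = x"
  using B_apply[of "binv f" f x] B_one_apply[of x] by simp

lemma B_inv_right: "f \<in> carrier B \<Longrightarrow> x \<in> X \<Longrightarrow> f (binv f x) = x"
  using B_apply[of f "binv f" x] B_one_apply[of x] by simp

lemma B_compose: "f \<in> carrier B \<Longrightarrow> g \<in> carrier B \<Longrightarrow> compose X f g = f \<star> g"
  by (simp add: BijGroup_def)

lemma B_I:
  assumes "f \<in> extensional X" "\<And>x. x \<in> X \<Longrightarrow> f x \<in> X" "\<And>x. x \<in> X \<Longrightarrow> g x \<in> X"
    "\<And>x. x \<in> X \<Longrightarrow> g (f x) = x" "\<And>x. x \<in> X \<Longrightarrow> f (g x) = x"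
  shows "f \<in> carrier B" and "x \<in> X \<Longrightarrow> binv f x = g x"
proof -
  have "bij_betw f X X"
    by (rule bij_betw_byWitness[where f' = g]) (use assms in auto)
  then show f: "f \<in> carrier B" using assms(1) by (simp add: B_iff)
  show "binv f x = g x" if "x \<in> X"
    using B_inv_left[OF f assms(3)[OF that]] assms(5)[OF that] by simp
qed

definition homeos :: "(('g \<Rightarrow> 'a) \<Rightarrow> ('g \<Rightarrow> 'a)) set" where
  "homeos = {f \<in> carrier B. windowed f \<and> windowed (binv f)}"

lemma windowed_comp:
  assumes f: "windowed f" and g: "windowed g" and gX: "\<And>x. x \<in> X \<Longrightarrow> g x \<in> X"
    and h: "\<And>x. x \<in> X \<Longrightarrow> h x = f (g x)"
  shows "windowed h"
  unfolding windowed_def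
proof (intro allI impI, elim conjE)
  fix W assume W: "finite (W :: 'g set)" "W \<subseteq> carrier G"
  obtain V where V: "finite V" "V \<subseteq> carrier G"
    "\<And>x y. x \<in> X \<Longrightarrow> y \<in> X \<Longrightarrow> agree V x y \<Longrightarrow> agree W (f x) (f y)"
    using windowedE[OF f W] by metis
  obtain U where U: "finite U" "U \<subseteq> carrier G"
    "\<And>x y. x \<in> X \<Longrightarrow> y \<in> X \<Longrightarrow> agree U x y \<Longrightarrow> agree V (g x) (g y)"
    using windowedE[OF g V(1,2)] by metis
  have "agree W (h x) (h y)" if "x \<in> X" "y \<in> X" "agree U x y" for x y
    using V(3)[OF gX gX U(3)] that h by simp
  with U show "\<exists>V. finite V \<and> V \<subseteq> carrier G \<and> (\<forall>x\<in>X. \<forall>y\<in>X. agree V x y \<longrightarrow> agree W (h x) (h y))"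
    by (intro exI[of _ U]) simp
qed

lemma windowed_id: "(\<And>x. x \<in> X \<Longrightarrow> f x = x) \<Longrightarrow> windowed f"
  unfolding windowed_def by auto

lemma subgroup_homeos: "subgroup homeos B"
proof (rule B.subgroupI)
  show "homeos \<subseteq> carrier B" by (auto simp: homeos_def)
  have "\<one>\<^bsub>B\<^esub> \<in> homeos" using windowed_id B_one_apply by (simp add: homeos_def)
  then show "homeos \<noteq> {}" by blast
  show "binv a \<in> homeos" if "a \<in> homeos" for a using that by (simp add: homeos_def)
  show "a \<star> b \<in> homeos" if "a \<in> homeos" "b \<in> homeos" for a b
  proof -
    have ab: "a \<in> carrier B" "b \<in> carrier B" using that by (auto simp: homeos_def)
    have "windowed (a \<star> b)"
      by (rule windowed_comp[of a b]) (use that ab in \<open>auto simp: homeos_def B_in_X B_apply\<close>)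
    moreover have "windowed (binv (a \<star> b))"
      by (rule windowed_comp[of "binv b" "binv a"])
        (use that ab in \<open>auto simp: homeos_def B_in_X B_apply B.inv_mult_group\<close>)
    ultimately show ?thesis using ab by (simp add: homeos_def)
  qed
qed

lemma self_homeo_eq: "self_homeo G \<Sigma> X = homeos"
proof (intro equalityI subsetI)
  fix f assume "f \<in> self_homeo G \<Sigma> X"
  then have e: "f \<in> extensional X"
    and "homeomorphic_map (subtopology (config_space G \<Sigma>) X) (subtopology (config_space G \<Sigma>) X) f"
    by (auto simp: self_homeo_def)
  then obtain g where g: "continuous_map (subtopology (config_space G \<Sigma>) X) (subtopology (config_space G \<Sigma>) X) f"
    "continuous_map (subtopology (config_space G \<Sigma>) X) (subtopology (config_space G \<Sigma>) X) g"
    "\<forall>x\<in>X. g (f x) = x" "\<forall>x\<in>X. f (g x) = x"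
    unfolding homeomorphic_map_maps homeomorphic_maps_def topspace_X by blast
  have fX: "f ` X \<subseteq> X" and gX: "g ` X \<subseteq> X"
    using continuous_map_image_subset_topspace[OF g(1)] continuous_map_image_subset_topspace[OF g(2)]
    unfolding topspace_X by auto
  have "f \<in> carrier B" and inv: "\<And>x. x \<in> X \<Longrightarrow> binv f x = g x"
    using B_I[of f g] e fX gX g(3,4) by auto
  moreover have "windowed f" "windowed g"
    using continuous_iff_windowed fX gX g(1,2) by auto
  moreover have "windowed (binv f)"
    by (rule windowed_comp[OF \<open>windowed g\<close> windowed_id[of "\<lambda>x. x"]]) (auto simp: inv)
  ultimately show "f \<in> homeos" by (simp add: homeos_def)
next
  fix f assume "f \<in> homeos"
  then have f: "f \<in> carrier B" "windowed f" "windowed (binv f)" by (auto simp: homeos_def)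
  have "homeomorphic_maps (subtopology (config_space G \<Sigma>) X) (subtopology (config_space G \<Sigma>) X) f (binv f)"
    unfolding homeomorphic_maps_def topspace_X
  proof (intro conjI ballI)
    have "f ` X \<subseteq> X" "binv f ` X \<subseteq> X" using f(1) B_in_X by auto
    then show "continuous_map (subtopology (config_space G \<Sigma>) X) (subtopology (config_space G \<Sigma>) X) f"
      "continuous_map (subtopology (config_space G \<Sigma>) X) (subtopology (config_space G \<Sigma>) X) (binv f)"
      using f continuous_iff_windowed by auto
  qed (auto simp: f B_inv_left B_inv_right)
  then show "f \<in> self_homeo G \<Sigma> X"
    using f(1) by (auto simp: self_homeo_def homeomorphic_map_maps B_iff)
qed

lemma shift_apply: "k \<in> carrier G \<Longrightarrow> shift G g x k = x (k \<otimes> g)"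
  by (simp add: shift_def)

lemma shift_shift: "g \<in> carrier G \<Longrightarrow> h \<in> carrier G \<Longrightarrow> shift G g (shift G h x) = shift G (g \<otimes> h) x"
  by (auto simp: shift_def m_assoc)

lemma shift_one: "x \<in> X \<Longrightarrow> shift G \<one> x = x"
  by (rule X_eqI) (auto simp: shift_in_X shift_apply intro: agreeI)

definition sh :: "'g \<Rightarrow> ('g \<Rightarrow> 'a) \<Rightarrow> ('g \<Rightarrow> 'a)" where
  "sh g = restrict (shift G g) X"

lemma sh_apply: "x \<in> X \<Longrightarrow> sh g x = shift G g x"
  by (simp add: sh_def)

lemma windowed_shift:
  assumes g: "g \<in> carrier G" and f: "\<And>x. x \<in> X \<Longrightarrow> f x = shift G g x"
  shows "windowed f"
  unfolding windowed_def
proof (intro allI impI, elim conjE)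
  fix W assume W: "finite (W :: 'g set)" "W \<subseteq> carrier G"
  have "agree W (f x) (f y)" if xy: "x \<in> X" "y \<in> X" "agree ((\<lambda>w. w \<otimes> g) ` W) x y" for x y
  proof (rule agreeI)
    fix w assume w: "w \<in> W"
    show "f x w = f y w"
      using agreeD[OF xy(3), of "w \<otimes> g"] w W(2) f[OF xy(1)] f[OF xy(2)] by (auto simp: shift_apply)
  qed
  moreover have "(\<lambda>w. w \<otimes> g) ` W \<subseteq> carrier G" using W(2) g by auto
  ultimately show "\<exists>V. finite V \<and> V \<subseteq> carrier G \<and> (\<forall>x\<in>X. \<forall>y\<in>X. agree V x y \<longrightarrow> agree W (f x) (f y))"
    using W(1) by (intro exI[of _ "(\<lambda>w. w \<otimes> g) ` W"]) simp
qed

lemma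
  assumes g: "g \<in> carrier G"
  shows sh_B: "sh g \<in> carrier B" and binv_sh: "binv (sh g) = sh (inv g)"
    and sh_homeo: "sh g \<in> homeos"
proof -
  have *: "sh g \<in> carrier B \<and> (\<forall>x\<in>X. binv (sh g) x = sh (inv g) x)" if g: "g \<in> carrier G" for g
  proof -
    have 1: "\<And>x. x \<in> X \<Longrightarrow> sh g x \<in> X" "\<And>x. x \<in> X \<Longrightarrow> sh (inv g) x \<in> X"
      "sh g \<in> extensional X"
      using g by (simp_all add: sh_def shift_in_X)
    have 2: "\<And>x. x \<in> X \<Longrightarrow> sh (inv g) (sh g x) = x" "\<And>x. x \<in> X \<Longrightarrow> sh g (sh (inv g) x) = x"
      using g by (simp_all add: sh_def shift_in_X shift_shift shift_one)
    show ?thesis using B_I[of "sh g" "sh (inv g)"] 1 2 by blast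
  qed
  show 1: "sh g \<in> carrier B" using *[OF g] by simp
  show 2: "binv (sh g) = sh (inv g)"
    using *[OF g] *[of "inv g"] g by (intro B_eqI) auto
  have "windowed (sh g)" "windowed (sh (inv g))"
    using windowed_shift[of g "sh g"] windowed_shift[of "inv g" "sh (inv g)"] g by (auto simp: sh_def)
  then show "sh g \<in> homeos" using 1 2 by (simp add: homeos_def)
qed

lemma sh_mult: "g \<in> carrier G \<Longrightarrow> h \<in> carrier G \<Longrightarrow> sh g \<star> sh h = sh (g \<otimes> h)"
  by (rule B_eqI) (auto simp: sh_B B_apply sh_apply shift_in_X shift_shift)

lemma sh_one: "sh \<one> = \<one>\<^bsub>B\<^esub>"
  by (rule B_eqI) (auto simp: sh_B B_one_apply sh_apply shift_one)

abbreviation cj where "cj \<phi> g \<equiv> gate_conj G X \<phi> g"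

lemma cj_eq:
  assumes "\<phi> \<in> carrier B" "g \<in> carrier G"
  shows "cj \<phi> g = binv (sh g) \<star> \<phi> \<star> sh g"
proof (rule extensionalityI[of _ X])
  show "binv (sh g) \<star> \<phi> \<star> sh g \<in> extensional X" using assms sh_B B_iff by (meson B.inv_closed B.m_closed)
  show "cj \<phi> g \<in> extensional X" by (simp add: gate_conj_def)
  fix x assume "x \<in> X"
  moreover have "shift G g x \<in> X" using assms calculation by (simp add: shift_in_X)
  moreover have "\<phi> (shift G g x) \<in> X" using assms calculation by (simp add: B_in_X)
  ultimately show "cj \<phi> g x = (binv (sh g) \<star> \<phi> \<star> sh g) x"
    using assms by (simp add: gate_conj_def B_apply sh_B B_in_X binv_sh sh_apply)
qed

lemma cj_B [simp]: "\<phi> \<in> carrier B \<Longrightarrow> g \<in> carrier G \<Longrightarrow> cj \<phi> g \<in> carrier B"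
  by (simp add: cj_eq sh_B)

lemma cj_apply:
  assumes "\<phi> \<in> carrier B" "g \<in> carrier G" "x \<in> X" "k \<in> carrier G"
  shows "cj \<phi> g x k = \<phi> (shift G g x) (k \<otimes> inv g)"
  using assms by (simp add: gate_conj_def shift_apply)

lemma cj_mult:
  assumes "\<phi> \<in> carrier B" "\<psi> \<in> carrier B" "g \<in> carrier G"
  shows "cj (\<phi> \<star> \<psi>) g = cj \<phi> g \<star> cj \<psi> g"
proof -
  have "sh g \<star> (binv (sh g) \<star> (\<psi> \<star> sh g)) = \<psi> \<star> sh g"
    using assms sh_B by (simp flip: B.m_assoc)
  then show ?thesis using assms sh_B by (simp add: cj_eq B.m_assoc)
qed

lemma cj_one [simp]: "g \<in> carrier G \<Longrightarrow> cj \<one>\<^bsub>B\<^esub> g = \<one>\<^bsub>B\<^esub>"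
  by (simp add: cj_eq sh_B)

lemma cj_by_one [simp]: "\<phi> \<in> carrier B \<Longrightarrow> cj \<phi> \<one> = \<phi>"
  by (simp add: cj_eq sh_one)

lemma cj_cj: "\<phi> \<in> carrier B \<Longrightarrow> g \<in> carrier G \<Longrightarrow> h \<in> carrier G \<Longrightarrow> cj (cj \<phi> g) h = cj \<phi> (g \<otimes> h)"
  by (simp add: cj_eq sh_B B.m_assoc B.inv_mult_group flip: sh_mult)

lemma cj_inv: "\<phi> \<in> carrier B \<Longrightarrow> g \<in> carrier G \<Longrightarrow> cj (binv \<phi>) g = binv (cj \<phi> g)"
  by (rule B.inv_equality[symmetric]) (simp_all flip: cj_mult)

lemma cj_equivariant:
  assumes f: "f \<in> carrier B" and "\<phi> \<in> carrier B" "g \<in> carrier G" and c: "f \<star> sh g = sh g \<star> f"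
  shows "cj (f \<star> \<phi> \<star> binv f) g = f \<star> cj \<phi> g \<star> binv f"
proof -
  have s: "sh g \<in> carrier B" using assms sh_B by simp
  have "binv f \<star> sh g = binv f \<star> (sh g \<star> f) \<star> binv f"
    using f s by (simp add: B.m_assoc)
  also have "\<dots> = sh g \<star> binv f" using f s by (simp flip: c) (simp flip: B.m_assoc)
  finally have 1: "binv f \<star> sh g = sh g \<star> binv f" .
  have "binv (sh g) \<star> f = binv (sh g) \<star> (f \<star> sh g) \<star> binv (sh g)" using f s by (simp add: B.m_assoc)
  also have "\<dots> = f \<star> binv (sh g)" using f s by (simp add: c) (simp flip: B.m_assoc)
  finally have 2: "binv (sh g) \<star> f = f \<star> binv (sh g)" .
  show ?thesis
    using assms s by (simp add: cj_eq B.m_assoc 1) (simp flip: B.m_assoc add: 2)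
qed

section \<open>Gates\<close>

text \<open>
  The strong-neighborhood condition, imposed on \<open>\<phi>\<close> and on its inverse alike, so that for fixed
  \<open>N\<close> it cuts out a group.
\<close>

definition acts_on :: "'g set \<Rightarrow> (('g \<Rightarrow> 'a) \<Rightarrow> ('g \<Rightarrow> 'a)) \<Rightarrow> bool" where
  "acts_on N \<phi> \<longleftrightarrow> finite N \<and> N \<subseteq> carrier G \<and> \<phi> \<in> carrier B \<and>
     (\<forall>\<psi>\<in>{\<phi>, binv \<phi>}. (\<forall>x\<in>X. agree (carrier G - N) (\<psi> x) x) \<and>
        (\<forall>x\<in>X. \<forall>y\<in>X. agree N x y \<longrightarrow> agree N (\<psi> x) (\<psi> y)))"

lemma acts_onD:
  assumes "acts_on N \<phi>"
  shows "finite N" "N \<subseteq> carrier G" "\<phi> \<in> carrier B"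
    "\<And>x. x \<in> X \<Longrightarrow> agree (carrier G - N) (\<phi> x) x"
    "\<And>x. x \<in> X \<Longrightarrow> agree (carrier G - N) (binv \<phi> x) x"
    "\<And>x y. x \<in> X \<Longrightarrow> y \<in> X \<Longrightarrow> agree N x y \<Longrightarrow> agree N (\<phi> x) (\<phi> y)"
    "\<And>x y. x \<in> X \<Longrightarrow> y \<in> X \<Longrightarrow> agree N x y \<Longrightarrow> agree N (binv \<phi> x) (binv \<phi> y)"
  using assms by (auto simp: acts_on_def)

lemma acts_on_inv: "acts_on N \<phi> \<Longrightarrow> acts_on N (binv \<phi>)"
  by (auto simp: acts_on_def)

lemma acts_on_one: "finite N \<Longrightarrow> N \<subseteq> carrier G \<Longrightarrow> acts_on N \<one>\<^bsub>B\<^esub>"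
  by (auto simp: acts_on_def B_one_apply)

lemma acts_on_mult:
  assumes "acts_on N \<phi>" "acts_on N \<psi>"
  shows "acts_on N (\<phi> \<star> \<psi>)"
proof -
  have *: "(\<forall>x\<in>X. agree (carrier G - N) ((f \<star> g) x) x) \<and>
        (\<forall>x\<in>X. \<forall>y\<in>X. agree N x y \<longrightarrow> agree N ((f \<star> g) x) ((f \<star> g) y))"
    if f: "acts_on N f" and g: "acts_on N g" for f g
  proof (intro conjI ballI impI)
    have B: "f \<in> carrier B" "g \<in> carrier B" using acts_onD f g by auto
    fix x assume x: "x \<in> X"
    then show "agree (carrier G - N) ((f \<star> g) x) x"
      using agree_trans[OF acts_onD(4)[OF f B_in_X[OF B(2) x]] acts_onD(4)[OF g x]] B
      by (simp add: B_apply)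
    fix y assume y: "y \<in> X" "agree N x y"
    then show "agree N ((f \<star> g) x) ((f \<star> g) y)"
      using acts_onD(6)[OF f _ _ acts_onD(6)[OF g x y]] x B by (simp add: B_apply B_in_X)
  qed
  have "\<phi> \<in> carrier B" "\<psi> \<in> carrier B" using assms by (auto simp: acts_on_def)
  then show ?thesis
    using *[OF assms] *[OF acts_on_inv[OF assms(2)] acts_on_inv[OF assms(1)]] assms(1)
    by (simp add: acts_on_def B.inv_mult_group)
qed

lemma acts_on_mono:
  assumes "acts_on N \<phi>" "N \<subseteq> M" "finite M" "M \<subseteq> carrier G"
  shows "acts_on M \<phi>"
proof -
  have "(\<forall>x\<in>X. agree (carrier G - M) (f x) x) \<and>
        (\<forall>x\<in>X. \<forall>y\<in>X. agree M x y \<longrightarrow> agree M (f x) (f y))" if f: "acts_on N f" for f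
  proof (intro conjI ballI impI)
    fix x assume "x \<in> X"
    show "agree (carrier G - M) (f x) x"
      by (rule agree_subset[OF acts_onD(4)[OF f \<open>x \<in> X\<close>]]) (use assms in auto)
  next
    fix x y assume xy: "x \<in> X" "y \<in> X" "agree M x y"
    show "agree M (f x) (f y)"
    proof (rule agreeI)
      fix g assume g: "g \<in> M"
      show "f x g = f y g"
      proof (cases "g \<in> N")
        case True
        then show ?thesis using agreeD[OF acts_onD(6)[OF f xy(1,2) agree_subset[OF xy(3) assms(2)]]] by simp
      next
        case False
        then have "g \<in> carrier G - N" using g assms by auto
        then show ?thesis
          using agreeD[OF acts_onD(4)[OF f xy(1)]] agreeD[OF acts_onD(4)[OF f xy(2)]] agreeD[OF xy(3) g]
          by simp
      qed
    qed
  qed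
  from this[OF assms(1)] this[OF acts_on_inv[OF assms(1)]] show ?thesis
    using assms by (simp add: acts_on_def)
qed

lemma acts_on_commute:
  assumes f: "acts_on N f" and g: "acts_on M g" and disj: "N \<inter> M = {}"
  shows "f \<star> g = g \<star> f"
proof (rule B_eqI)
  have B: "f \<in> carrier B" "g \<in> carrier B" using acts_onD f g by auto
  then show "f \<star> g \<in> carrier B" "g \<star> f \<in> carrier B" by auto
  have *: "agree N (f (g x)) (g (f x))" if f: "acts_on N f" and g: "acts_on M g"
    and disj: "N \<inter> M = {}" and x: "x \<in> X" for f g N M x
  proof -
    have B: "f \<in> carrier B" "g \<in> carrier B" using acts_onD f g by auto
    have NM: "N \<subseteq> carrier G - M" using acts_onD(2)[OF f] disj by auto
    have "agree N (g x) x" by (rule agree_subset[OF acts_onD(4)[OF g x] NM])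
    then have "agree N (f (g x)) (f x)" using acts_onD(6)[OF f] x B B_in_X by auto
    moreover have "agree N (g (f x)) (f x)"
      by (rule agree_subset[OF acts_onD(4)[OF g] NM]) (simp add: B x B_in_X)
    ultimately show ?thesis using agree_trans agree_sym by blast
  qed
  fix x assume x: "x \<in> X"
  have "f (g x) = g (f x)"
  proof (rule X_eqI)
    show "f (g x) \<in> X" "g (f x) \<in> X" using B x B_in_X by auto
    show "agree (carrier G) (f (g x)) (g (f x))"
    proof (rule agreeI)
      fix k assume k: "k \<in> carrier G"
      consider "k \<in> N" | "k \<in> M" | "k \<in> carrier G - N" "k \<in> carrier G - M" using k by blast
      then show "f (g x) k = g (f x) k"
      proof cases
        case 1 then show ?thesis using agreeD[OF *[OF f g disj x]] by simp
      next
        case 2 then show ?thesis using agreeD[OF *[OF g f _ x]] disj by (simp add: Int_commute)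
      next
        case 3
        have "f (g x) k = g x k" "g (f x) k = f x k" "g x k = x k" "f x k = x k"
          using 3 agreeD[OF acts_onD(4)[OF f]] agreeD[OF acts_onD(4)[OF g]] x B B_in_X by auto
        then show ?thesis by simp
      qed
    qed
  qed
  then show "(f \<star> g) x = (g \<star> f) x" using B x by (simp add: B_apply)
qed

lemma acts_on_cj:
  assumes f: "acts_on N f" and g: "g \<in> carrier G"
  shows "acts_on (N #> g) (cj f g)"
proof -
  have fin: "finite (N #> g)" "N #> g \<subseteq> carrier G"
    using acts_onD(1,2)[OF f] g by (auto simp: r_coset_def)
  have mem: "k \<in> N #> g \<longleftrightarrow> k \<otimes> inv g \<in> N" if k: "k \<in> carrier G" for k
  proof
    assume "k \<in> N #> g"
    then obtain n where n: "n \<in> N" "k = n \<otimes> g" by (auto simp: r_coset_def)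
    then show "k \<otimes> inv g \<in> N" using acts_onD(2)[OF f] g by (auto simp: m_assoc)
  next
    assume "k \<otimes> inv g \<in> N"
    moreover have "k = (k \<otimes> inv g) \<otimes> g" using k g by (simp add: m_assoc)
    ultimately show "k \<in> N #> g" by (auto simp: r_coset_def)
  qed
  have main: "(\<forall>x\<in>X. agree (carrier G - (N #> g)) (cj f g x) x) \<and>
        (\<forall>x\<in>X. \<forall>y\<in>X. agree (N #> g) x y \<longrightarrow> agree (N #> g) (cj f g x) (cj f g y))"
    if f: "acts_on N f" for f
  proof (intro conjI ballI impI)
    have B: "f \<in> carrier B" using acts_onD f by auto
    fix x assume x: "x \<in> X"
    show "agree (carrier G - (N #> g)) (cj f g x) x"
    proof (rule agreeI)
      fix k assume k: "k \<in> carrier G - (N #> g)"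
      then have k': "k \<otimes> inv g \<in> carrier G - N" using mem g by auto
      show "cj f g x k = x k"
        using agreeD[OF acts_onD(4)[OF f shift_in_X[OF g x]] k'] k g x B
        by (simp add: cj_apply shift_apply m_assoc)
    qed
    fix y assume y: "y \<in> X" and xy: "agree (N #> g) x y"
    have "agree N (shift G g x) (shift G g y)"
    proof (rule agreeI)
      fix n assume n: "n \<in> N"
      then have "n \<otimes> g \<in> N #> g" by (auto simp: r_coset_def)
      then show "shift G g x n = shift G g y n"
        using agreeD[OF xy] n acts_onD(2)[OF f] by (auto simp: shift_apply)
    qed
    then have "agree N (f (shift G g x)) (f (shift G g y))"
      using acts_onD(6)[OF f] shift_in_X g x y by auto
    then show "agree (N #> g) (cj f g x) (cj f g y)"
      using fin(2) mem B x y g by (auto simp: agree_def cj_apply subset_iff)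
  qed
  have "f \<in> carrier B" using acts_onD f by auto
  then show ?thesis
    using main[OF f] main[OF acts_on_inv[OF f]] fin g by (simp add: acts_on_def flip: cj_inv)
qed

lemma acts_on_homeo:
  assumes "acts_on N \<phi>"
  shows "\<phi> \<in> homeos"
proof -
  have "windowed \<phi>" if f: "acts_on N \<phi>" for \<phi>
    unfolding windowed_def
  proof (intro allI impI, elim conjE)
    fix W assume W: "finite (W :: 'g set)" "W \<subseteq> carrier G"
    have "agree W (\<phi> x) (\<phi> y)" if xy: "x \<in> X" "y \<in> X" "agree (W \<union> N) x y" for x y
    proof -
      have "acts_on (W \<union> N) \<phi>" by (rule acts_on_mono[OF f]) (use W acts_onD[OF f] in auto)
      then show ?thesis using acts_onD(6)[OF _ xy] agree_subset by blast
    qed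
    then show "\<exists>V. finite V \<and> V \<subseteq> carrier G \<and> (\<forall>x\<in>X. \<forall>y\<in>X. agree V x y \<longrightarrow> agree W (\<phi> x) (\<phi> y))"
      using W acts_onD(1,2)[OF f] by (intro exI[of _ "W \<union> N"]) simp
  qed
  then show ?thesis using assms acts_on_inv acts_onD by (auto simp: homeos_def)
qed

text \<open>
  The cells on which the values of \<open>\<phi>\<close> and of its inverse on \<open>N\<close> depend are finite in number;
  adding them to \<open>N\<close> gives a set on which \<open>\<phi>\<close> acts.
\<close>

lemma acts_on_exists:
  assumes f: "\<phi> \<in> homeos" and N: "finite N" "N \<subseteq> carrier G"
    and out: "\<And>x. x \<in> X \<Longrightarrow> agree (carrier G - N) (\<phi> x) x"
  obtains M where "N \<subseteq> M" "acts_on M \<phi>"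
proof -
  have B: "\<phi> \<in> carrier B" and w: "windowed \<phi>" "windowed (binv \<phi>)" using f by (auto simp: homeos_def)
  obtain V where V: "finite V" "V \<subseteq> carrier G"
    "\<And>x y. x \<in> X \<Longrightarrow> y \<in> X \<Longrightarrow> agree V x y \<Longrightarrow> agree N (\<phi> x) (\<phi> y)"
    using windowedE[OF w(1) N] by metis
  obtain U where U: "finite U" "U \<subseteq> carrier G"
    "\<And>x y. x \<in> X \<Longrightarrow> y \<in> X \<Longrightarrow> agree U x y \<Longrightarrow> agree N (binv \<phi> x) (binv \<phi> y)"
    using windowedE[OF w(2) N] by metis
  let ?M = "N \<union> V \<union> U"
  have out': "agree (carrier G - N) (binv \<phi> x) x" if x: "x \<in> X" for x
    using out[of "binv \<phi> x"] B x B_in_X B_inv_right agree_sym by simp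
  have *: "(\<forall>x\<in>X. agree (carrier G - ?M) (h x) x) \<and>
        (\<forall>x\<in>X. \<forall>y\<in>X. agree ?M x y \<longrightarrow> agree ?M (h x) (h y))"
    if h: "\<And>x. x \<in> X \<Longrightarrow> agree (carrier G - N) (h x) x"
      "\<And>x y. x \<in> X \<Longrightarrow> y \<in> X \<Longrightarrow> agree ?M x y \<Longrightarrow> agree N (h x) (h y)" for h
  proof (intro conjI ballI impI)
    fix x assume x: "x \<in> X"
    show "agree (carrier G - ?M) (h x) x" by (rule agree_subset[OF h(1)[OF x]]) auto
    fix y assume y: "y \<in> X" "agree ?M x y"
    show "agree ?M (h x) (h y)"
    proof (rule agreeI)
      fix k assume k: "k \<in> ?M"
      show "h x k = h y k"
      proof (cases "k \<in> N")
        case True then show ?thesis using agreeD[OF h(2)[OF x y]] by simp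
      next
        case False
        then have "k \<in> carrier G - N" using k N V U by auto
        then show ?thesis using agreeD[OF h(1)[OF x]] agreeD[OF h(1)[OF y(1)]] agreeD[OF y(2) k] by simp
      qed
    qed
  qed
  have "acts_on ?M \<phi>"
  proof -
    have "(\<forall>x\<in>X. agree (carrier G - ?M) (\<phi> x) x) \<and>
        (\<forall>x\<in>X. \<forall>y\<in>X. agree ?M x y \<longrightarrow> agree ?M (\<phi> x) (\<phi> y))"
      by (rule *[OF out V(3)]) (auto intro: agree_subset)
    moreover have "(\<forall>x\<in>X. agree (carrier G - ?M) (binv \<phi> x) x) \<and>
        (\<forall>x\<in>X. \<forall>y\<in>X. agree ?M x y \<longrightarrow> agree ?M (binv \<phi> x) (binv \<phi> y))"
      by (rule *[OF out' U(3)]) (auto intro: agree_subset)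
    moreover have "finite ?M" "?M \<subseteq> carrier G" using N V U by auto
    ultimately show ?thesis using B unfolding acts_on_def by blast
  qed
  then show thesis using that[of ?M] by auto
qed

lemma fixes_outside_iff:
  "fixes_outside G X \<phi> N \<longleftrightarrow> finite N \<and> N \<subseteq> carrier G \<and> (\<forall>x\<in>X. agree (carrier G - N) (\<phi> x) x)"
  by (auto simp: fixes_outside_def agree_def)

lemma gate_iff: "gate G \<Sigma> X \<phi> \<longleftrightarrow> (\<exists>N. acts_on N \<phi>)"
proof
  assume "gate G \<Sigma> X \<phi>"
  then obtain N where "\<phi> \<in> homeos" "finite N" "N \<subseteq> carrier G" "\<forall>x\<in>X. agree (carrier G - N) (\<phi> x) x"
    unfolding gate_def self_homeo_eq fixes_outside_iff by blast
  then show "\<exists>N. acts_on N \<phi>" using acts_on_exists by meson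
next
  assume "\<exists>N. acts_on N \<phi>"
  then obtain N where "acts_on N \<phi>" ..
  then show "gate G \<Sigma> X \<phi>"
    unfolding gate_def self_homeo_eq fixes_outside_iff
    using acts_onD(1,2,4)[of N \<phi>] acts_on_homeo[of N \<phi>] by (intro conjI exI[of _ N]) simp_all
qed

end

section \<open>Products of commuting families\<close>

text \<open>
  The library operator \<open>finprod\<close> is developed for commutative monoids. In an arbitrary group it
  keeps its laws along families of pairwise commuting elements.
\<close>

context group
begin

definition commuting :: "('i \<Rightarrow> 'a) \<Rightarrow> 'i set \<Rightarrow> bool" where
  "commuting c S \<longleftrightarrow> (\<forall>s\<in>S. c s \<in> carrier G) \<and> (\<forall>s\<in>S. \<forall>t\<in>S. c s \<otimes> c t = c t \<otimes> c s)"

lemma commuting_subset: "commuting c S \<Longrightarrow> T \<subseteq> S \<Longrightarrow> commuting c T"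
  by (auto simp: commuting_def)

lemma commuting_closed: "commuting c S \<Longrightarrow> s \<in> S \<Longrightarrow> c s \<in> carrier G"
  by (simp add: commuting_def)

lemma commuting_LCD: "commuting c S \<Longrightarrow> LCD S (carrier G) ((\<otimes>) \<circ> c)"
  by unfold_locales (auto simp: commuting_def simp flip: m_assoc)

lemma cfinprod_empty [simp]: "finprod G c {} = \<one>"
  by (simp add: finprod_def)

lemma cfinprod_insert:
  assumes "commuting c S" "finite F" "s \<notin> F" "s \<in> S" "F \<subseteq> S"
  shows "finprod G c (insert s F) = c s \<otimes> finprod G c F"
  using LCD.foldD_insert[OF commuting_LCD[OF assms(1)], of F s "\<one>"] assms
  by (simp add: finprod_def)

lemma cfinprod_in_subgroup:
  assumes "commuting c S" "finite F" "F \<subseteq> S" "subgroup H G" "\<And>s. s \<in> F \<Longrightarrow> c s \<in> H"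
  shows "finprod G c F \<in> H"
  using assms(2,3,5)
proof (induction F rule: finite_induct)
  case empty
  then show ?case using subgroup.one_closed[OF assms(4)] by simp
next
  case (insert s F)
  then show ?case using subgroup.m_closed[OF assms(4)] by (simp add: cfinprod_insert[OF assms(1)])
qed

lemma cfinprod_closed: "commuting c S \<Longrightarrow> finite F \<Longrightarrow> F \<subseteq> S \<Longrightarrow> finprod G c F \<in> carrier G"
  by (rule cfinprod_in_subgroup[OF _ _ _ subgroup_self]) (auto simp: commuting_def)

lemma cfinprod_commute:
  assumes "commuting c S" "finite F" "F \<subseteq> S" "x \<in> carrier G" "\<And>s. s \<in> F \<Longrightarrow> x \<otimes> c s = c s \<otimes> x"
  shows "x \<otimes> finprod G c F = finprod G c F \<otimes> x"
  using assms(2,3,5)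
proof (induction F rule: finite_induct)
  case empty
  then show ?case using assms by simp
next
  case (insert s F)
  have c: "c s \<in> carrier G" "finprod G c F \<in> carrier G"
    using insert assms commuting_closed[OF assms(1)] cfinprod_closed[OF assms(1)] by auto
  have "x \<otimes> (c s \<otimes> finprod G c F) = c s \<otimes> (x \<otimes> finprod G c F)"
    using insert.prems c assms(4) by (simp flip: m_assoc)
  also have "\<dots> = (c s \<otimes> finprod G c F) \<otimes> x" using insert c assms(4) by (simp add: m_assoc)
  finally show ?case using insert by (simp add: cfinprod_insert[OF assms(1)])
qed

lemma cfinprod_Un:
  assumes "commuting c S" "finite F" "finite E" "F \<subseteq> S" "E \<subseteq> S" "F \<inter> E = {}"
  shows "finprod G c (F \<union> E) = finprod G c F \<otimes> finprod G c E"
  using assms(2,4,6)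
proof (induction F rule: finite_induct)
  case empty
  then show ?case using cfinprod_closed[OF assms(1,3,5)] by simp
next
  case (insert s F)
  have c: "c s \<in> carrier G" "finprod G c F \<in> carrier G" "finprod G c E \<in> carrier G"
    using insert assms commuting_closed[OF assms(1)] cfinprod_closed[OF assms(1)] by auto
  have "finprod G c (insert s (F \<union> E)) = c s \<otimes> finprod G c (F \<union> E)"
    using insert assms by (intro cfinprod_insert[OF assms(1)]) auto
  then show ?case using insert c by (simp add: cfinprod_insert[OF assms(1)] m_assoc)
qed

lemma commuting_mult:
  assumes c: "commuting c S" and d: "commuting d S"
    and cd: "\<And>s t. s \<in> S \<Longrightarrow> t \<in> S \<Longrightarrow> s \<noteq> t \<Longrightarrow> c s \<otimes> d t = d t \<otimes> c s"
  shows "commuting (\<lambda>s. c s \<otimes> d s) S"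
  unfolding commuting_def
proof (intro conjI ballI)
  show "c s \<otimes> d s \<in> carrier G" if "s \<in> S" for s
    using commuting_closed[OF c that] commuting_closed[OF d that] by simp
  fix s t assume st: "s \<in> S" "t \<in> S"
  show "c s \<otimes> d s \<otimes> (c t \<otimes> d t) = c t \<otimes> d t \<otimes> (c s \<otimes> d s)"
  proof (cases "s = t")
    case False
    have m: "c s \<in> carrier G" "d s \<in> carrier G" "c t \<in> carrier G" "d t \<in> carrier G"
      using st commuting_closed[OF c] commuting_closed[OF d] by auto
    have "c s \<otimes> d s \<otimes> (c t \<otimes> d t) = c s \<otimes> (d s \<otimes> c t) \<otimes> d t" using m by (simp add: m_assoc)
    also have "\<dots> = c s \<otimes> (c t \<otimes> d s) \<otimes> d t"
      using cd[OF st(2,1)] False by simp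
    also have "\<dots> = (c s \<otimes> c t) \<otimes> (d s \<otimes> d t)"
      using m by (simp add: m_assoc)
    also have "\<dots> = (c t \<otimes> c s) \<otimes> (d t \<otimes> d s)" using c d st by (simp add: commuting_def)
    also have "\<dots> = c t \<otimes> (c s \<otimes> d t) \<otimes> d s" using m by (simp add: m_assoc)
    also have "\<dots> = c t \<otimes> d t \<otimes> (c s \<otimes> d s)" using cd[OF st False] m by (simp add: m_assoc)
    finally show ?thesis .
  qed simp
qed

lemma cfinprod_mult:
  assumes c: "commuting c S" and d: "commuting d S"
    and cd: "\<And>s t. s \<in> S \<Longrightarrow> t \<in> S \<Longrightarrow> s \<noteq> t \<Longrightarrow> c s \<otimes> d t = d t \<otimes> c s"
    and F: "finite F" "F \<subseteq> S"
  shows "finprod G (\<lambda>s. c s \<otimes> d s) F = finprod G c F \<otimes> finprod G d F"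
  using F
proof (induction F rule: finite_induct)
  case (insert s F)
  have m: "c s \<in> carrier G" "d s \<in> carrier G" "finprod G c F \<in> carrier G" "finprod G d F \<in> carrier G"
    using insert commuting_closed[OF c] commuting_closed[OF d] cfinprod_closed[OF c] cfinprod_closed[OF d]
    by auto
  have cd': "d s \<otimes> c t = c t \<otimes> d s" if "t \<in> F" for t
  proof -
    have "t \<noteq> s" "t \<in> S" "s \<in> S" using that insert by auto
    then show ?thesis using cd[of t s] by simp
  qed
  have "d s \<otimes> finprod G c F = finprod G c F \<otimes> d s"
    by (rule cfinprod_commute[OF c]) (use insert m cd' in auto)
  then have "c s \<otimes> d s \<otimes> (finprod G c F \<otimes> finprod G d F)
    = c s \<otimes> finprod G c F \<otimes> (d s \<otimes> finprod G d F)"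
    using m by (simp add: m_assoc) (simp flip: m_assoc)
  then show ?case
    using insert by (simp add: cfinprod_insert[OF c] cfinprod_insert[OF d]
        cfinprod_insert[OF commuting_mult[OF c d cd]])
qed simp

lemma cfinprod_cong:
  assumes c: "commuting c S" and F: "finite F" "F \<subseteq> S" and eq: "\<And>s. s \<in> S \<Longrightarrow> d s = c s"
  shows "finprod G d F = finprod G c F"
proof -
  have d: "commuting d S" using c eq by (simp add: commuting_def)
  show ?thesis
    using F by (induction F rule: finite_induct)
      (auto simp: cfinprod_insert[OF c] cfinprod_insert[OF d] eq)
qed

lemma cfinprod_one: "finite F \<Longrightarrow> finprod G (\<lambda>s. \<one>) F = \<one>"
proof (induction F rule: finite_induct)
  case (insert s F)
  have c: "commuting (\<lambda>s. \<one>) (insert s F)" by (simp add: commuting_def)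
  show ?case using insert by (simp add: cfinprod_insert[OF c] subset_insertI)
qed simp

lemma commuting_inv: "commuting c S \<Longrightarrow> commuting (\<lambda>s. inv (c s)) S"
  by (auto simp: commuting_def simp flip: inv_mult_group)

lemma commuting_conj:
  assumes c: "commuting c S" and f: "f \<in> carrier G"
  shows "commuting (\<lambda>s. f \<otimes> c s \<otimes> inv f) S"
  unfolding commuting_def
proof (intro conjI ballI)
  have *: "(f \<otimes> a \<otimes> inv f) \<otimes> (f \<otimes> b \<otimes> inv f) = f \<otimes> (a \<otimes> b) \<otimes> inv f"
    if "a \<in> carrier G" "b \<in> carrier G" for a b
  proof -
    have "inv f \<otimes> (f \<otimes> (b \<otimes> inv f)) = b \<otimes> inv f" using that f by (simp flip: m_assoc)
    then show ?thesis using that f by (simp add: m_assoc)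
  qed
  fix s t assume "s \<in> S" "t \<in> S"
  then show "f \<otimes> c s \<otimes> inv f \<otimes> (f \<otimes> c t \<otimes> inv f) = f \<otimes> c t \<otimes> inv f \<otimes> (f \<otimes> c s \<otimes> inv f)"
    using c f by (simp add: * commuting_def)
qed (use c f in \<open>simp add: commuting_def\<close>)

lemma cfinprod_conj:
  assumes c: "commuting c S" and f: "f \<in> carrier G" and F: "finite F" "F \<subseteq> S"
  shows "finprod G (\<lambda>s. f \<otimes> c s \<otimes> inv f) F = f \<otimes> finprod G c F \<otimes> inv f"
  using F
proof (induction F rule: finite_induct)
  case (insert s F)
  have m: "c s \<in> carrier G" "finprod G c F \<in> carrier G"
    using insert commuting_closed[OF c] cfinprod_closed[OF c] by auto
  have "inv f \<otimes> (f \<otimes> (finprod G c F \<otimes> inv f)) = finprod G c F \<otimes> inv f"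
    using m f by (simp flip: m_assoc)
  then show ?case
    using insert m f
    by (simp add: cfinprod_insert[OF c] cfinprod_insert[OF commuting_conj[OF c f]] m_assoc)
qed (use f in simp)

lemma cfinprod_reindex:
  assumes c: "commuting c (h ` S)" and h: "inj_on h S" and F: "finite F" "F \<subseteq> S"
  shows "finprod G c (h ` F) = finprod G (\<lambda>s. c (h s)) F"
proof -
  have d: "commuting (\<lambda>s. c (h s)) S" using c by (simp add: commuting_def)
  show ?thesis
    using F
  proof (induction F rule: finite_induct)
    case (insert s F)
    then have "h s \<notin> h ` F" using h by (auto simp: inj_on_def)
    moreover have "h ` F \<subseteq> h ` S" "h s \<in> h ` S" using insert by auto
    ultimately show ?case
      using insert cfinprod_insert[OF c, of "h ` F" "h s"] cfinprod_insert[OF d, of F s] by simp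
  qed simp
qed

end

section \<open>Gate lattices as uniform limits\<close>

context subshift_system
begin

text \<open>
  Uniform convergence on \<open>X\<close> of a net indexed by the finite subsets of \<open>S\<close>. Uniform limits, in
  contrast to pointwise ones, are compatible with composition.
\<close>

definition ulim :: "'i set \<Rightarrow> ('i set \<Rightarrow> ('g \<Rightarrow> 'a) \<Rightarrow> ('g \<Rightarrow> 'a)) \<Rightarrow> (('g \<Rightarrow> 'a) \<Rightarrow> ('g \<Rightarrow> 'a)) \<Rightarrow> bool" where
  "ulim S P f \<longleftrightarrow> (\<forall>W. finite W \<and> W \<subseteq> carrier G \<longrightarrow>
     (\<exists>F0. finite F0 \<and> F0 \<subseteq> S \<and> (\<forall>F. finite F \<and> F0 \<subseteq> F \<and> F \<subseteq> S \<longrightarrow> (\<forall>x\<in>X. agree W (P F x) (f x)))))"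

lemma ulimI:
  assumes "\<And>W. finite W \<Longrightarrow> W \<subseteq> carrier G \<Longrightarrow> \<exists>F0. finite F0 \<and> F0 \<subseteq> S \<and>
     (\<forall>F. finite F \<and> F0 \<subseteq> F \<and> F \<subseteq> S \<longrightarrow> (\<forall>x\<in>X. agree W (P F x) (f x)))"
  shows "ulim S P f"
  unfolding ulim_def by (intro allI impI, elim conjE) (rule assms)

lemma ulimE:
  assumes "ulim S P f" "finite W" "W \<subseteq> carrier G"
  obtains F0 where "finite F0" "F0 \<subseteq> S"
    "\<And>F x. finite F \<Longrightarrow> F0 \<subseteq> F \<Longrightarrow> F \<subseteq> S \<Longrightarrow> x \<in> X \<Longrightarrow> agree W (P F x) (f x)"
proof -
  have "\<exists>F0. finite F0 \<and> F0 \<subseteq> S \<and> (\<forall>F. finite F \<and> F0 \<subseteq> F \<and> F \<subseteq> S \<longrightarrow> (\<forall>x\<in>X. agree W (P F x) (f x)))"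
    using assms(1)[unfolded ulim_def, rule_format, OF conjI[OF assms(2,3)]] .
  then show thesis using that by (elim exE conjE) simp
qed

lemma ulim_unique:
  assumes "ulim S P f" "ulim S P g" and x: "x \<in> X" and fg: "f x \<in> X" "g x \<in> X"
  shows "f x = g x"
proof (rule X_eqI[OF fg])
  show "agree (carrier G) (f x) (g x)"
  proof (rule agreeI)
    fix k assume "k \<in> carrier G"
    then have k: "finite {k}" "{k} \<subseteq> carrier G" by auto
    obtain F0 where F0: "finite F0" "F0 \<subseteq> S"
      "\<And>F x. finite F \<Longrightarrow> F0 \<subseteq> F \<Longrightarrow> F \<subseteq> S \<Longrightarrow> x \<in> X \<Longrightarrow> agree {k} (P F x) (f x)"
      using ulimE[OF assms(1) k] by metis
    obtain F1 where F1: "finite F1" "F1 \<subseteq> S"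
      "\<And>F x. finite F \<Longrightarrow> F1 \<subseteq> F \<Longrightarrow> F \<subseteq> S \<Longrightarrow> x \<in> X \<Longrightarrow> agree {k} (P F x) (g x)"
      using ulimE[OF assms(2) k] by metis
    have "agree {k} (P (F0 \<union> F1) x) (f x)" by (rule F0(3)) (use F0 F1 x in auto)
    moreover have "agree {k} (P (F0 \<union> F1) x) (g x)" by (rule F1(3)) (use F0 F1 x in auto)
    ultimately show "f x k = g x k" by (simp add: agree_def)
  qed
qed

lemma ulim_cong:
  assumes "ulim S P f" "\<And>F x. finite F \<Longrightarrow> F \<subseteq> S \<Longrightarrow> x \<in> X \<Longrightarrow> Q F x = P F x"
    "\<And>x. x \<in> X \<Longrightarrow> g x = f x"
  shows "ulim S Q g"
proof (rule ulimI)
  fix W :: "'g set" assume W: "finite W" "W \<subseteq> carrier G"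
  obtain F0 where F0: "finite F0" "F0 \<subseteq> S"
    "\<And>F x. finite F \<Longrightarrow> F0 \<subseteq> F \<Longrightarrow> F \<subseteq> S \<Longrightarrow> x \<in> X \<Longrightarrow> agree W (P F x) (f x)"
    using ulimE[OF assms(1) W] by metis
  then show "\<exists>F0. finite F0 \<and> F0 \<subseteq> S \<and> (\<forall>F. finite F \<and> F0 \<subseteq> F \<and> F \<subseteq> S \<longrightarrow> (\<forall>x\<in>X. agree W (Q F x) (g x)))"
    using assms(2,3) by (intro exI[of _ F0]) simp
qed

lemma ulim_const: "ulim S (\<lambda>F. f) f"
  by (rule ulimI) auto

lemma ulim_restrict:
  assumes "ulim S P f" "S \<subseteq> T"
  shows "ulim T (\<lambda>F. P (F \<inter> S)) f"
proof (rule ulimI)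
  fix W :: "'g set" assume W: "finite W" "W \<subseteq> carrier G"
  obtain F0 where F0: "finite F0" "F0 \<subseteq> S"
    "\<And>F x. finite F \<Longrightarrow> F0 \<subseteq> F \<Longrightarrow> F \<subseteq> S \<Longrightarrow> x \<in> X \<Longrightarrow> agree W (P F x) (f x)"
    using ulimE[OF assms(1) W] by metis
  have "agree W (P (F \<inter> S) x) (f x)" if "finite F" "F0 \<subseteq> F" "x \<in> X" for F x
    by (rule F0(3)) (use that F0 in auto)
  then show "\<exists>F0. finite F0 \<and> F0 \<subseteq> T \<and> (\<forall>F. finite F \<and> F0 \<subseteq> F \<and> F \<subseteq> T \<longrightarrow> (\<forall>x\<in>X. agree W (P (F \<inter> S) x) (f x)))"
    using F0(1,2) assms(2) by (intro exI[of _ F0]) auto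
qed

lemma ulim_reindex:
  assumes "ulim (h ` S) P f"
  shows "ulim S (\<lambda>F. P (h ` F)) f"
proof (rule ulimI)
  fix W :: "'g set" assume W: "finite W" "W \<subseteq> carrier G"
  obtain F0 where F0: "finite F0" "F0 \<subseteq> h ` S"
    "\<And>F x. finite F \<Longrightarrow> F0 \<subseteq> F \<Longrightarrow> F \<subseteq> h ` S \<Longrightarrow> x \<in> X \<Longrightarrow> agree W (P F x) (f x)"
    using ulimE[OF assms(1) W] by metis
  obtain F1 where F1: "F1 \<subseteq> S" "finite F1" "F0 = h ` F1" using finite_subset_image[OF F0(1,2)] by auto
  have "agree W (P (h ` F) x) (f x)" if "finite F" "F1 \<subseteq> F" "F \<subseteq> S" "x \<in> X" for F x
    by (rule F0(3)) (use that F1 in auto)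
  then show "\<exists>F0. finite F0 \<and> F0 \<subseteq> S \<and> (\<forall>F. finite F \<and> F0 \<subseteq> F \<and> F \<subseteq> S \<longrightarrow> (\<forall>x\<in>X. agree W (P (h ` F) x) (f x)))"
    using F1(1,2) by (intro exI[of _ F1]) simp
qed

lemma ulim_mult:
  assumes f: "ulim S P f" and g: "ulim S Q g"
    and PQ: "\<And>F. finite F \<Longrightarrow> F \<subseteq> S \<Longrightarrow> P F \<in> carrier B" "\<And>F. finite F \<Longrightarrow> F \<subseteq> S \<Longrightarrow> Q F \<in> carrier B"
    and w: "windowed f" and gX: "\<And>x. x \<in> X \<Longrightarrow> g x \<in> X"
  shows "ulim S (\<lambda>F. P F \<star> Q F) (\<lambda>x. f (g x))"
proof (rule ulimI)
  fix W :: "'g set" assume W: "finite W" "W \<subseteq> carrier G"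
  obtain V where V: "finite V" "V \<subseteq> carrier G"
    "\<And>x y. x \<in> X \<Longrightarrow> y \<in> X \<Longrightarrow> agree V x y \<Longrightarrow> agree W (f x) (f y)"
    using windowedE[OF w W] by metis
  obtain F0 where F0: "finite F0" "F0 \<subseteq> S"
    "\<And>F x. finite F \<Longrightarrow> F0 \<subseteq> F \<Longrightarrow> F \<subseteq> S \<Longrightarrow> x \<in> X \<Longrightarrow> agree W (P F x) (f x)"
    using ulimE[OF f W] by metis
  obtain F1 where F1: "finite F1" "F1 \<subseteq> S"
    "\<And>F x. finite F \<Longrightarrow> F1 \<subseteq> F \<Longrightarrow> F \<subseteq> S \<Longrightarrow> x \<in> X \<Longrightarrow> agree V (Q F x) (g x)"
    using ulimE[OF g V(1,2)] by metis
  have "agree W ((P F \<star> Q F) x) (f (g x))" if F: "finite F" "F0 \<union> F1 \<subseteq> F" "F \<subseteq> S" and x: "x \<in> X" for F x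
  proof -
    have Q: "Q F x \<in> X" using B_in_X[OF PQ(2)] F x by auto
    have "agree W (P F (Q F x)) (f (Q F x))" using F0(3) F Q by auto
    moreover have "agree W (f (Q F x)) (f (g x))" using V(3)[OF Q gX[OF x]] F1(3) F x by auto
    ultimately show ?thesis using agree_trans B_apply PQ F x by simp
  qed
  then show "\<exists>F0. finite F0 \<and> F0 \<subseteq> S \<and> (\<forall>F. finite F \<and> F0 \<subseteq> F \<and> F \<subseteq> S \<longrightarrow>
      (\<forall>x\<in>X. agree W ((P F \<star> Q F) x) (f (g x))))"
    using F0(1,2) F1(1,2) by (intro exI[of _ "F0 \<union> F1"]) simp
qed

definition pprod :: "(('g \<Rightarrow> 'a) \<Rightarrow> ('g \<Rightarrow> 'a)) \<Rightarrow> 'g set \<Rightarrow> (('g \<Rightarrow> 'a) \<Rightarrow> ('g \<Rightarrow> 'a))" where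
  "pprod \<phi> F = finprod B (gate_conj G X \<phi>) F"

lemma conjs_commute_iff:
  assumes "\<phi> \<in> carrier B" "S \<subseteq> carrier G"
  shows "conjs_commute G X \<phi> S \<longleftrightarrow> B.commuting (cj \<phi>) S"
  using assms by (simp add: conjs_commute_def B.commuting_def B_compose subset_iff)

lemma pprod_outside:
  assumes N: "acts_on N \<phi>" and S: "S \<subseteq> carrier G" and c: "B.commuting (cj \<phi>) S"
    and F: "finite F" "F \<subseteq> S" and out: "\<And>s. s \<in> F \<Longrightarrow> k \<notin> N #> s"
    and k: "k \<in> carrier G" and x: "x \<in> X"
  shows "pprod \<phi> F x k = x k"
  using F out
proof (induction F rule: finite_induct)
  case empty
  then show ?case using x by (simp add: pprod_def B_one_apply)
next
  case (insert s F)
  have s: "s \<in> carrier G" using insert S by auto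
  have m: "cj \<phi> s \<in> carrier B" "pprod \<phi> F \<in> carrier B"
    using insert B.commuting_closed[OF c] B.cfinprod_closed[OF c] by (auto simp: pprod_def)
  have "pprod \<phi> (insert s F) = cj \<phi> s \<star> pprod \<phi> F"
    using insert by (simp add: pprod_def B.cfinprod_insert[OF c])
  then have "pprod \<phi> (insert s F) x k = cj \<phi> s (pprod \<phi> F x) k" using m x by (simp add: B_apply)
  also have "\<dots> = pprod \<phi> F x k"
    using agreeD[OF acts_onD(4)[OF acts_on_cj[OF N s] B_in_X[OF m(2) x]]] k insert by auto
  finally show ?case using insert by simp
qed

text \<open>
  The conjugates by \<open>s \<in> S\<close> that can change the cell \<open>k\<close> are the finitely many with \<open>k \<in> N #> s\<close>.
  As all factors commute, these may be applied first, and the others then leave the cell alone; so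
  the value at \<open>k\<close> is constant once the finite products include them.
\<close>

lemma ulim_pprod_exists:
  assumes N: "acts_on N \<phi>" and S: "S \<subseteq> carrier G" and c: "B.commuting (cj \<phi>) S"
  obtains f where "\<And>x. x \<in> X \<Longrightarrow> f x \<in> X" "windowed f" "ulim S (pprod \<phi>) f" "f \<in> extensional X"
proof -
  define F0 where "F0 k = {s \<in> S. k \<in> N #> s}" for k
  have finF0: "finite (F0 k)" if k: "k \<in> carrier G" for k
  proof (rule finite_subset)
    show "F0 k \<subseteq> (\<lambda>n. inv n \<otimes> k) ` N"
    proof
      fix s assume "s \<in> F0 k"
      then obtain n where n: "n \<in> N" "k = n \<otimes> s" "s \<in> S" by (auto simp: F0_def r_coset_def)
      then have "s = inv n \<otimes> k" using acts_onD(2)[OF N] S by (auto simp flip: m_assoc simp: subset_iff)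
      then show "s \<in> (\<lambda>n. inv n \<otimes> k) ` N" using n by auto
    qed
  qed (use acts_onD[OF N] in auto)
  have F0S: "F0 k \<subseteq> S" for k by (auto simp: F0_def)
  have PB: "pprod \<phi> F \<in> carrier B" if "finite F" "F \<subseteq> S" for F
    using B.cfinprod_closed[OF c that] by (simp add: pprod_def)
  have Ph: "pprod \<phi> F \<in> homeos" if F: "finite F" "F \<subseteq> S" for F
    unfolding pprod_def
  proof (rule B.cfinprod_in_subgroup[OF c F subgroup_homeos])
    fix s assume "s \<in> F"
    then have "s \<in> carrier G" using F S by auto
    then show "cj \<phi> s \<in> homeos" using acts_on_homeo[OF acts_on_cj[OF N]] by blast
  qed
  have stab: "pprod \<phi> F x k = pprod \<phi> (F0 k) x k"
    if F: "finite F" "F0 k \<subseteq> F" "F \<subseteq> S" and k: "k \<in> carrier G" and x: "x \<in> X" for F k x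
  proof -
    have "F = (F - F0 k) \<union> F0 k" using F by auto
    then have "pprod \<phi> F = pprod \<phi> (F - F0 k) \<star> pprod \<phi> (F0 k)"
      using B.cfinprod_Un[OF c, of "F - F0 k" "F0 k"] F F0S finF0[OF k] unfolding pprod_def
      by (metis Diff_disjoint Diff_subset finite_Diff inf_commute order_trans)
    moreover have "pprod \<phi> (F - F0 k) (pprod \<phi> (F0 k) x) k = pprod \<phi> (F0 k) x k"
      by (rule pprod_outside[OF N S c]) (use F k x finF0 F0S PB B_in_X in \<open>auto simp: F0_def\<close>)
    moreover have "pprod \<phi> (F - F0 k) \<in> carrier B" "pprod \<phi> (F0 k) \<in> carrier B"
      using PB[of "F - F0 k"] PB[of "F0 k"] F F0S finF0[OF k] by auto
    ultimately show ?thesis using x by (simp add: B_apply)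
  qed
  define f where "f = (\<lambda>x\<in>X. \<lambda>k\<in>carrier G. pprod \<phi> (F0 k) x k)"
  have fk: "agree W (pprod \<phi> F x) (f x)"
    if "finite W" "W \<subseteq> carrier G" "finite F" "(\<Union>k\<in>W. F0 k) \<subseteq> F" "F \<subseteq> S" "x \<in> X" for W F x
  proof (rule agreeI)
    fix k assume k: "k \<in> W"
    then show "pprod \<phi> F x k = f x k" using stab[of F k x] that by (auto simp: f_def)
  qed
  have FW: "finite (\<Union>k\<in>W. F0 k)" "(\<Union>k\<in>W. F0 k) \<subseteq> S" if "finite W" "W \<subseteq> carrier G" for W
    using that finF0 F0S by auto
  have fX: "f x \<in> X" if x: "x \<in> X" for x
  proof (rule limit_in_X)
    show "f x \<in> extensional (carrier G)" using x by (simp add: f_def)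
    fix W :: "'g set" assume W: "finite W" "W \<subseteq> carrier G"
    then show "\<exists>y\<in>X. agree W (f x) y"
      using fk[OF W FW(1)[OF W] order_refl FW(2)[OF W] x] PB[OF FW[OF W]] B_in_X x agree_sym by blast
  qed
  show thesis
  proof (rule that[OF fX])
    show "ulim S (pprod \<phi>) f"
    proof (rule ulimI)
      fix W :: "'g set" assume W: "finite W" "W \<subseteq> carrier G"
      show "\<exists>F0. finite F0 \<and> F0 \<subseteq> S \<and> (\<forall>F. finite F \<and> F0 \<subseteq> F \<and> F \<subseteq> S \<longrightarrow>
         (\<forall>x\<in>X. agree W (pprod \<phi> F x) (f x)))"
        using fk[OF W] FW[OF W] by (intro exI[of _ "\<Union>k\<in>W. F0 k"]) blast
    qed
    show "windowed f"
      unfolding windowed_def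
    proof (intro allI impI, elim conjE)
      fix W :: "'g set" assume W: "finite W" "W \<subseteq> carrier G"
      let ?P = "pprod \<phi> (\<Union>k\<in>W. F0 k)"
      have "windowed ?P" using Ph[OF FW[OF W]] by (simp add: homeos_def)
      then obtain V where V: "finite V" "V \<subseteq> carrier G"
        "\<And>x y. x \<in> X \<Longrightarrow> y \<in> X \<Longrightarrow> agree V x y \<Longrightarrow> agree W (?P x) (?P y)"
        using windowedE[OF _ W] by metis
      have "agree W (f x) (f y)" if xy: "x \<in> X" "y \<in> X" "agree V x y" for x y
        using fk[OF W FW(1)[OF W] order_refl FW(2)[OF W]] V(3)[OF xy] xy agree_trans agree_sym by metis
      with V show "\<exists>V. finite V \<and> V \<subseteq> carrier G \<and> (\<forall>x\<in>X. \<forall>y\<in>X. agree V x y \<longrightarrow> agree W (f x) (f y))"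
        by (intro exI[of _ V]) simp
    qed
    show "f \<in> extensional X" by (simp add: f_def)
  qed
qed

text \<open>
  Meaningful when the conjugates of the gate \<open>\<phi>\<close> by the elements of \<open>S\<close> commute; \<open>is_gate_product_iff\<close>
  identifies it with the pointwise limit \<open>\<phi>\<^sup>S\<close>.
\<close>

definition lat :: "'g set \<Rightarrow> (('g \<Rightarrow> 'a) \<Rightarrow> ('g \<Rightarrow> 'a)) \<Rightarrow> ('g \<Rightarrow> 'a) \<Rightarrow> ('g \<Rightarrow> 'a)" where
  "lat S \<phi> = (THE f. f \<in> carrier B \<and> ulim S (pprod \<phi>) f)"

lemma lat_eqI:
  assumes "f \<in> carrier B" "ulim S (pprod \<phi>) f"
  shows "lat S \<phi> = f"
  unfolding lat_def
proof (rule the_equality)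
  fix g assume "g \<in> carrier B \<and> ulim S (pprod \<phi>) g"
  then have g: "g \<in> carrier B" "ulim S (pprod \<phi>) g" by auto
  show "g = f"
    by (rule B_eqI[OF g(1) assms(1)])
      (use ulim_unique[OF g(2) assms(2)] B_in_X g(1) assms(1) in auto)
qed (use assms in simp)

text \<open>
  The limit is invertible because the lattice of \<open>binv \<phi>\<close> is inverse to it.
\<close>

lemma
  assumes N: "acts_on N \<phi>" and S: "S \<subseteq> carrier G" and c: "B.commuting (cj \<phi>) S"
  shows lat_homeo: "lat S \<phi> \<in> homeos" and lat_ulim: "ulim S (pprod \<phi>) (lat S \<phi>)"
proof -
  have inv_eq: "cj (binv \<phi>) s = binv (cj \<phi> s)" if "s \<in> S" for s
    using that S acts_onD(3)[OF N] cj_inv by auto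
  have c': "B.commuting (cj (binv \<phi>)) S"
    using B.commuting_inv[OF c] inv_eq by (simp add: B.commuting_def)
  obtain f where f: "\<And>x. x \<in> X \<Longrightarrow> f x \<in> X" "windowed f" "ulim S (pprod \<phi>) f" "f \<in> extensional X"
    using ulim_pprod_exists[OF N S c] by metis
  obtain g where g: "\<And>x. x \<in> X \<Longrightarrow> g x \<in> X" "windowed g" "ulim S (pprod (binv \<phi>)) g"
    using ulim_pprod_exists[OF acts_on_inv[OF N] S c'] by metis
  have cb: "cj \<phi> s \<in> carrier B" if "s \<in> S" for s using B.commuting_closed[OF c that] .
  have PB: "pprod \<phi> F \<in> carrier B" "pprod (binv \<phi>) F \<in> carrier B" if "finite F" "F \<subseteq> S" for F
    using B.cfinprod_closed[OF c that] B.cfinprod_closed[OF c' that] by (auto simp: pprod_def)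
  have one: "pprod \<phi> F \<star> pprod (binv \<phi>) F = \<one>\<^bsub>B\<^esub>" if F: "finite F" "F \<subseteq> S" for F
  proof -
    have cd: "cj \<phi> s \<star> cj (binv \<phi>) t = cj (binv \<phi>) t \<star> cj \<phi> s" if "s \<in> S" "t \<in> S" "s \<noteq> t" for s t
    proof -
      note m = cb[OF that(1)] cb[OF that(2)]
      have "cj \<phi> s \<star> cj \<phi> t = cj \<phi> t \<star> cj \<phi> s" using c that by (simp add: B.commuting_def)
      then have "binv (cj \<phi> t) \<star> (cj \<phi> s \<star> cj \<phi> t) \<star> binv (cj \<phi> t) = cj \<phi> s \<star> binv (cj \<phi> t)"
        using m by (simp flip: B.m_assoc)
      then show ?thesis unfolding inv_eq[OF that(2)] using m by (simp add: B.m_assoc)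
    qed
    have "pprod \<phi> F \<star> pprod (binv \<phi>) F = finprod B (\<lambda>s. cj \<phi> s \<star> cj (binv \<phi>) s) F"
      unfolding pprod_def by (rule B.cfinprod_mult[OF c c' cd F, symmetric])
    also have "\<dots> = finprod B (\<lambda>s. \<one>\<^bsub>B\<^esub>) F"
      by (rule B.cfinprod_cong[of _ S]) (use F cb inv_eq in \<open>auto simp: B.commuting_def\<close>)
    finally show ?thesis using B.cfinprod_one F by simp
  qed
  then have one': "pprod (binv \<phi>) F \<star> pprod \<phi> F = \<one>\<^bsub>B\<^esub>" if F: "finite F" "F \<subseteq> S" for F
    using F PB[OF F] B.inv_comm by blast
  have "ulim S (\<lambda>F. pprod \<phi> F \<star> pprod (binv \<phi>) F) (\<lambda>x. f (g x))"
    by (rule ulim_mult[OF f(3) g(3)]) (use PB f g in auto)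
  then have "ulim S (\<lambda>F. \<one>\<^bsub>B\<^esub>) (\<lambda>x. f (g x))" by (rule ulim_cong) (use one in auto)
  then have fg: "f (g x) = x" if "x \<in> X" for x
    using ulim_unique[OF _ ulim_const that, of S "\<one>\<^bsub>B\<^esub>" "\<lambda>x. f (g x)"] that f g by (simp add: B_one_apply)
  have "ulim S (\<lambda>F. pprod (binv \<phi>) F \<star> pprod \<phi> F) (\<lambda>x. g (f x))"
    by (rule ulim_mult[OF g(3) f(3)]) (use PB f g in auto)
  then have "ulim S (\<lambda>F. \<one>\<^bsub>B\<^esub>) (\<lambda>x. g (f x))" by (rule ulim_cong) (use one' in auto)
  then have gf: "g (f x) = x" if "x \<in> X" for x
    using ulim_unique[OF _ ulim_const that, of S "\<one>\<^bsub>B\<^esub>" "\<lambda>x. g (f x)"] that f g by (simp add: B_one_apply)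
  have fB: "f \<in> carrier B" and finv: "\<And>x. x \<in> X \<Longrightarrow> binv f x = g x"
    using B_I[of f g] f g fg gf by auto
  have "windowed (binv f)"
    by (rule windowed_comp[OF g(2) windowed_id[of "\<lambda>x. x"]]) (auto simp: finv)
  then have "f \<in> homeos" using fB f(2) by (simp add: homeos_def)
  then show "lat S \<phi> \<in> homeos" "ulim S (pprod \<phi>) (lat S \<phi>)"
    using lat_eqI[OF fB f(3)] f(3) by auto
qed

lemma lat_in_B:
  assumes "acts_on N \<phi>" "S \<subseteq> carrier G" "B.commuting (cj \<phi>) S"
  shows "lat S \<phi> \<in> carrier B" "windowed (lat S \<phi>)"
  using lat_homeo[OF assms] by (auto simp: homeos_def)

lemma pprod_in_B: "B.commuting (cj \<phi>) S \<Longrightarrow> finite F \<Longrightarrow> F \<subseteq> S \<Longrightarrow> pprod \<phi> F \<in> carrier B"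
  unfolding pprod_def by (rule B.cfinprod_closed)

lemma limitin_discrete:
  "limitin (discrete_topology U) h l F \<longleftrightarrow> l \<in> U \<and> eventually (\<lambda>i. h i = l) F"
proof
  assume "limitin (discrete_topology U) h l F"
  then have "l \<in> U" and *: "\<And>V. V \<subseteq> U \<Longrightarrow> l \<in> V \<Longrightarrow> eventually (\<lambda>i. h i \<in> V) F"
    by (simp_all add: limitin_def)
  then show "l \<in> U \<and> eventually (\<lambda>i. h i = l) F" using *[of "{l}"] by simp
next
  assume "l \<in> U \<and> eventually (\<lambda>i. h i = l) F"
  then show "limitin (discrete_topology U) h l F"
    unfolding limitin_def by (auto elim: eventually_mono)
qed

lemma is_gate_product_iff:
  assumes N: "acts_on N \<phi>" and S: "S \<subseteq> carrier G" and c: "B.commuting (cj \<phi>) S"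
  shows "is_gate_product G \<Sigma> X \<phi> S f \<longleftrightarrow> f = lat S \<phi>"
proof -
  let ?T = "subtopology (config_space G \<Sigma>) X"
  note latB = lat_in_B[OF N S c]
  have lim: "limitin ?T (\<lambda>F. pprod \<phi> F x) (lat S \<phi> x) (finite_subsets_at_top S)" if x: "x \<in> X" for x
    unfolding limitin_subtopology
  proof (intro conjI)
    show lX: "lat S \<phi> x \<in> X" using latB x B_in_X by auto
    show ev: "\<forall>\<^sub>F F in finite_subsets_at_top S. pprod \<phi> F x \<in> X"
      unfolding eventually_finite_subsets_at_top
      using pprod_in_B[OF c] B_in_X x by (intro exI[of _ "{}"]) auto
    show "limitin (config_space G \<Sigma>) (\<lambda>F. pprod \<phi> F x) (lat S \<phi> x) (finite_subsets_at_top S)"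
      unfolding config_space_def limitin_componentwise limitin_discrete
    proof (intro conjI ballI)
      show "lat S \<phi> x \<in> extensional (carrier G)" using lX X_extensional by auto
      show "\<forall>\<^sub>F F in finite_subsets_at_top S.
          pprod \<phi> F x \<in> topspace (product_topology (\<lambda>_. discrete_topology \<Sigma>) (carrier G))"
        by (rule eventually_mono[OF ev]) (use X_subset in auto)
      fix k assume k: "k \<in> carrier G"
      show "lat S \<phi> x k \<in> \<Sigma>" using lX k X_symbol by auto
      obtain F0 where F0: "finite F0" "F0 \<subseteq> S"
        "\<And>F x. finite F \<Longrightarrow> F0 \<subseteq> F \<Longrightarrow> F \<subseteq> S \<Longrightarrow> x \<in> X \<Longrightarrow> agree {k} (pprod \<phi> F x) (lat S \<phi> x)"
        using ulimE[OF lat_ulim[OF N S c], of "{k}"] k by auto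
      have "pprod \<phi> F x k = lat S \<phi> x k" if "finite F" "F0 \<subseteq> F" "F \<subseteq> S" for F
        using F0(3)[OF that x] by (simp add: agree_def)
      then show "\<forall>\<^sub>F F in finite_subsets_at_top S. pprod \<phi> F x k = lat S \<phi> x k"
        unfolding eventually_finite_subsets_at_top using F0(1,2) by blast
    qed
  qed
  have haus: "Hausdorff_space ?T"
    unfolding config_space_def
    by (intro Hausdorff_space_subtopology) (simp add: Hausdorff_space_product_topology)
  show ?thesis
  proof
    assume "is_gate_product G \<Sigma> X \<phi> S f"
    then have f: "f \<in> extensional X"
      and l: "\<And>x. x \<in> X \<Longrightarrow> limitin ?T (\<lambda>F. pprod \<phi> F x) (f x) (finite_subsets_at_top S)"
      by (auto simp: is_gate_product_def pprod_def)
    have "f x = lat S \<phi> x" if x: "x \<in> X" for x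
      by (rule limitin_Hausdorff_unique[OF l[OF x] lim[OF x] _ haus]) simp
    then show "f = lat S \<phi>" using f latB by (intro extensionalityI[of f X]) (auto simp: B_iff)
  next
    assume "f = lat S \<phi>"
    then show "is_gate_product G \<Sigma> X \<phi> S f"
      using lim latB by (auto simp: is_gate_product_def pprod_def B_iff)
  qed
qed


section \<open>The laws of gate lattices\<close>

definition spread :: "'g set \<Rightarrow> 'g set \<Rightarrow> bool" where
  "spread S N \<longleftrightarrow> S \<subseteq> carrier G \<and> (\<forall>s\<in>S. \<forall>t\<in>S. s \<noteq> t \<longrightarrow> (N #> s) \<inter> (N #> t) = {})"

lemma spreadD: "spread S N \<Longrightarrow> S \<subseteq> carrier G"
  by (simp add: spread_def)

lemma spread_commute:
  assumes "spread S N" "acts_on N \<phi>" "acts_on N \<psi>" "s \<in> S" "t \<in> S" "s \<noteq> t"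
  shows "cj \<phi> s \<star> cj \<psi> t = cj \<psi> t \<star> cj \<phi> s"
  by (rule acts_on_commute[OF acts_on_cj acts_on_cj]) (use assms in \<open>auto simp: spread_def\<close>)

lemma spread_commuting:
  assumes "spread S N" "acts_on N \<phi>"
  shows "B.commuting (cj \<phi>) S"
  unfolding B.commuting_def
proof (intro conjI ballI)
  show "cj \<phi> s \<in> carrier B" if "s \<in> S" for s
    using that assms acts_onD(3) by (auto simp: spread_def)
  show "cj \<phi> s \<star> cj \<phi> t = cj \<phi> t \<star> cj \<phi> s" if "s \<in> S" "t \<in> S" for s t
    using spread_commute[OF assms(1,2,2) that] by (cases "s = t") auto
qed

lemma lat_spread:
  assumes "spread S N" "acts_on N \<phi>"
  shows "lat S \<phi> \<in> homeos" "lat S \<phi> \<in> carrier B" "windowed (lat S \<phi>)" "ulim S (pprod \<phi>) (lat S \<phi>)"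
  using lat_homeo[OF assms(2) spreadD[OF assms(1)] spread_commuting[OF assms]]
    lat_in_B[OF assms(2) spreadD[OF assms(1)] spread_commuting[OF assms]]
    lat_ulim[OF assms(2) spreadD[OF assms(1)] spread_commuting[OF assms]] by simp_all

text \<open>
  The conjugates of \<open>\<phi>\<close> and \<open>\<psi>\<close> by different elements of \<open>S\<close> act on disjoint sets of cells and
  therefore commute, so that the factors of a product of conjugates of \<open>\<phi> \<star> \<psi>\<close> can be sorted.
\<close>

lemma lat_mult:
  assumes S: "spread S N" and f: "acts_on N \<phi>" and g: "acts_on N \<psi>"
  shows "lat S (\<phi> \<star> \<psi>) = lat S \<phi> \<star> lat S \<psi>"
proof (rule lat_eqI)
  note F = lat_spread[OF S f] and H = lat_spread[OF S g]
  note cf = spread_commuting[OF S f] and cg = spread_commuting[OF S g]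
  show "lat S \<phi> \<star> lat S \<psi> \<in> carrier B" using F H by auto
  have "ulim S (\<lambda>F. pprod \<phi> F \<star> pprod \<psi> F) (\<lambda>x. lat S \<phi> (lat S \<psi> x))"
    by (rule ulim_mult) (use F H cf cg pprod_in_B B_in_X in auto)
  then show "ulim S (pprod (\<phi> \<star> \<psi>)) (lat S \<phi> \<star> lat S \<psi>)"
  proof (rule ulim_cong)
    show "(lat S \<phi> \<star> lat S \<psi>) x = lat S \<phi> (lat S \<psi> x)" if "x \<in> X" for x
      using that F H by (simp add: B_apply)
    fix F x assume FS: "finite F" "F \<subseteq> S"
    have "pprod (\<phi> \<star> \<psi>) F = finprod B (\<lambda>s. cj \<phi> s \<star> cj \<psi> s) F"
      unfolding pprod_def
    proof (rule B.cfinprod_cong[OF _ FS])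
      show "B.commuting (\<lambda>s. cj \<phi> s \<star> cj \<psi> s) S"
        by (rule B.commuting_mult[OF cf cg]) (rule spread_commute[OF S f g])
      show "cj (\<phi> \<star> \<psi>) s = cj \<phi> s \<star> cj \<psi> s" if "s \<in> S" for s
        using cj_mult that spreadD[OF S] acts_onD(3)[OF f] acts_onD(3)[OF g] by auto
    qed
    also have "\<dots> = pprod \<phi> F \<star> pprod \<psi> F"
      unfolding pprod_def by (rule B.cfinprod_mult[OF cf cg _ FS]) (rule spread_commute[OF S f g])
    finally show "pprod (\<phi> \<star> \<psi>) F x = (pprod \<phi> F \<star> pprod \<psi> F) x" by simp
  qed
qed

lemma lat_one:
  assumes "S \<subseteq> carrier G"
  shows "lat S \<one>\<^bsub>B\<^esub> = \<one>\<^bsub>B\<^esub>"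
proof (rule lat_eqI)
  show "ulim S (pprod \<one>\<^bsub>B\<^esub>) \<one>\<^bsub>B\<^esub>"
  proof (rule ulim_cong[OF ulim_const])
    fix F x assume F: "finite F" "F \<subseteq> S"
    have "pprod \<one>\<^bsub>B\<^esub> F = finprod B (\<lambda>s. \<one>\<^bsub>B\<^esub>) F"
      unfolding pprod_def
      by (rule B.cfinprod_cong[OF _ F]) (use assms in \<open>auto simp: B.commuting_def\<close>)
    then show "pprod \<one>\<^bsub>B\<^esub> F x = \<one>\<^bsub>B\<^esub> x" using B.cfinprod_one[OF F(1)] by simp
  qed simp
qed simp

lemma lat_inv:
  assumes "spread S N" "acts_on N \<phi>"
  shows "lat S (binv \<phi>) = binv (lat S \<phi>)"
proof (rule B.inv_equality[symmetric])
  have "lat S (binv \<phi>) \<star> lat S \<phi> = lat S (binv \<phi> \<star> \<phi>)"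
    using lat_mult[OF assms(1) acts_on_inv[OF assms(2)] assms(2)] by simp
  also have "binv \<phi> \<star> \<phi> = \<one>\<^bsub>B\<^esub>" using acts_onD(3)[OF assms(2)] by simp
  finally show "lat S (binv \<phi>) \<star> lat S \<phi> = \<one>\<^bsub>B\<^esub>" using lat_one spreadD assms by simp
qed (use lat_spread[OF assms] lat_spread[OF assms(1) acts_on_inv[OF assms(2)]] in auto)

text \<open>
  Consequently it suffices to check that a subgroup contains the lattices of gates that generate.
\<close>

lemma subgroup_lat_vimage:
  assumes S: "spread S N" and N: "finite N" "N \<subseteq> carrier G" and Q: "subgroup Q B"
  shows "subgroup {\<phi>. acts_on N \<phi> \<and> lat S \<phi> \<in> Q} B"
proof (rule B.subgroupI)
  show "{\<phi>. acts_on N \<phi> \<and> lat S \<phi> \<in> Q} \<subseteq> carrier B" using acts_onD(3) by auto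
  have "\<one>\<^bsub>B\<^esub> \<in> {\<phi>. acts_on N \<phi> \<and> lat S \<phi> \<in> Q}"
    using acts_on_one[OF N] lat_one[OF spreadD[OF S]] subgroup.one_closed[OF Q] by simp
  then show "{\<phi>. acts_on N \<phi> \<and> lat S \<phi> \<in> Q} \<noteq> {}" by blast
  show "binv a \<in> {\<phi>. acts_on N \<phi> \<and> lat S \<phi> \<in> Q}" if "a \<in> {\<phi>. acts_on N \<phi> \<and> lat S \<phi> \<in> Q}" for a
    using that acts_on_inv lat_inv[OF S] subgroup.m_inv_closed[OF Q] by simp
  show "a \<star> b \<in> {\<phi>. acts_on N \<phi> \<and> lat S \<phi> \<in> Q}"
    if "a \<in> {\<phi>. acts_on N \<phi> \<and> lat S \<phi> \<in> Q}" "b \<in> {\<phi>. acts_on N \<phi> \<and> lat S \<phi> \<in> Q}" for a b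
    using that acts_on_mult lat_mult[OF S] subgroup.m_closed[OF Q] by simp
qed

lemma lat_Un:
  assumes N: "acts_on N \<phi>" and ST: "S \<union> T \<subseteq> carrier G" "S \<inter> T = {}"
    and c: "B.commuting (cj \<phi>) (S \<union> T)"
  shows "lat (S \<union> T) \<phi> = lat S \<phi> \<star> lat T \<phi>"
proof (rule lat_eqI)
  have cS: "B.commuting (cj \<phi>) S" and cT: "B.commuting (cj \<phi>) T"
    by (auto intro: B.commuting_subset[OF c])
  have ST': "S \<subseteq> carrier G" "T \<subseteq> carrier G" using ST by auto
  note LS = lat_in_B[OF N ST'(1) cS] and LT = lat_in_B[OF N ST'(2) cT]
  show "lat S \<phi> \<star> lat T \<phi> \<in> carrier B" using LS LT by simp
  have "ulim (S \<union> T) (\<lambda>F. pprod \<phi> (F \<inter> S) \<star> pprod \<phi> (F \<inter> T)) (\<lambda>x. lat S \<phi> (lat T \<phi> x))"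
  proof (rule ulim_mult[where f = "lat S \<phi>" and g = "lat T \<phi>"])
    show "ulim (S \<union> T) (\<lambda>F. pprod \<phi> (F \<inter> S)) (lat S \<phi>)"
      by (rule ulim_restrict[OF lat_ulim[OF N ST'(1) cS]]) simp
    show "ulim (S \<union> T) (\<lambda>F. pprod \<phi> (F \<inter> T)) (lat T \<phi>)"
      by (rule ulim_restrict[OF lat_ulim[OF N ST'(2) cT]]) simp
    show "pprod \<phi> (F \<inter> S) \<in> carrier B" "pprod \<phi> (F \<inter> T) \<in> carrier B"
      if "finite F" "F \<subseteq> S \<union> T" for F
      using pprod_in_B[OF cS, of "F \<inter> S"] pprod_in_B[OF cT, of "F \<inter> T"] that by auto
  qed (use LS LT B_in_X in auto)
  then show "ulim (S \<union> T) (pprod \<phi>) (lat S \<phi> \<star> lat T \<phi>)"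
  proof (rule ulim_cong)
    show "(lat S \<phi> \<star> lat T \<phi>) x = lat S \<phi> (lat T \<phi> x)" if "x \<in> X" for x
      using that LS LT by (simp add: B_apply)
    fix F x assume F: "finite F" "F \<subseteq> S \<union> T"
    have "pprod \<phi> ((F \<inter> S) \<union> (F \<inter> T)) = pprod \<phi> (F \<inter> S) \<star> pprod \<phi> (F \<inter> T)"
      unfolding pprod_def by (rule B.cfinprod_Un[OF c]) (use F ST in auto)
    moreover have "(F \<inter> S) \<union> (F \<inter> T) = F" using F by auto
    ultimately show "pprod \<phi> F x = (pprod \<phi> (F \<inter> S) \<star> pprod \<phi> (F \<inter> T)) x" by simp
  qed
qed

lemma lat_empty: "lat {} \<phi> = \<one>\<^bsub>B\<^esub>"
  by (rule lat_eqI) (auto intro!: ulimI simp: pprod_def)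

lemma lat_singleton:
  assumes "\<phi> \<in> carrier B" "s \<in> carrier G"
  shows "lat {s} \<phi> = cj \<phi> s"
proof (rule lat_eqI)
  have "B.commuting (cj \<phi>) {s}" using assms by (simp add: B.commuting_def)
  then have "pprod \<phi> {s} = cj \<phi> s" using B.cfinprod_insert[of "cj \<phi>" "{s}" "{}" s] assms by (simp add: pprod_def)
  then show "ulim {s} (pprod \<phi>) (cj \<phi> s)"
    by (intro ulimI exI[of _ "{s}"]) (auto simp: dest: subset_antisym)
qed (use assms in simp)

lemma lat_outside:
  assumes N: "acts_on N \<phi>" and S: "S \<subseteq> carrier G" and c: "B.commuting (cj \<phi>) S"
    and out: "\<And>s. s \<in> S \<Longrightarrow> k \<notin> N #> s" and k: "k \<in> carrier G" and x: "x \<in> X"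
  shows "lat S \<phi> x k = x k"
proof -
  obtain F0 where F0: "finite F0" "F0 \<subseteq> S"
    "\<And>F x. finite F \<Longrightarrow> F0 \<subseteq> F \<Longrightarrow> F \<subseteq> S \<Longrightarrow> x \<in> X \<Longrightarrow> agree {k} (pprod \<phi> F x) (lat S \<phi> x)"
    using ulimE[OF lat_ulim[OF N S c], of "{k}"] k by auto
  have "pprod \<phi> F0 x k = x k" by (rule pprod_outside[OF N S c F0(1,2) _ k x]) (use out F0 in auto)
  then show ?thesis using F0(3)[OF F0(1) order_refl F0(2) x] by (simp add: agree_def)
qed

text \<open>A homeomorphism commuting with the shifts by \<open>S\<close> conjugates all the \<open>\<phi>\<^sup>s\<close> at once.\<close>

lemma lat_conj:
  assumes f: "f \<in> homeos" and eq: "\<And>s. s \<in> S \<Longrightarrow> f \<star> sh s = sh s \<star> f"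
    and N: "acts_on N \<phi>" and S: "S \<subseteq> carrier G" and c: "B.commuting (cj \<phi>) S"
  shows "lat S (f \<star> \<phi> \<star> binv f) = f \<star> lat S \<phi> \<star> binv f"
    and "B.commuting (cj (f \<star> \<phi> \<star> binv f)) S"
proof -
  have fB: "f \<in> carrier B" "windowed f" "windowed (binv f)" using f by (auto simp: homeos_def)
  have \<phi>: "\<phi> \<in> carrier B" using acts_onD(3)[OF N] .
  have cje: "cj (f \<star> \<phi> \<star> binv f) s = f \<star> cj \<phi> s \<star> binv f" if "s \<in> S" for s
    using cj_equivariant[OF fB(1) \<phi> _ eq[OF that]] that S by auto
  have cc: "B.commuting (\<lambda>s. f \<star> cj \<phi> s \<star> binv f) S" by (rule B.commuting_conj[OF c fB(1)])
  then show "B.commuting (cj (f \<star> \<phi> \<star> binv f)) S" using cje by (simp add: B.commuting_def)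
  note L = lat_in_B[OF N S c]
  have 1: "ulim S (\<lambda>F. f \<star> pprod \<phi> F) (\<lambda>x. f (lat S \<phi> x))"
    by (rule ulim_mult[OF ulim_const lat_ulim[OF N S c]]) (use L fB pprod_in_B[OF c] B_in_X in auto)
  have "ulim S (\<lambda>F. (f \<star> pprod \<phi> F) \<star> binv f) (\<lambda>x. f (lat S \<phi> (binv f x)))"
  proof (rule ulim_mult[OF 1 ulim_const])
    show "windowed (\<lambda>x. f (lat S \<phi> x))" by (rule windowed_comp[OF fB(2) L(2)]) (use L B_in_X in auto)
  qed (use fB pprod_in_B[OF c] B_in_X in auto)
  then have u: "ulim S (pprod (f \<star> \<phi> \<star> binv f)) (f \<star> lat S \<phi> \<star> binv f)"
  proof (rule ulim_cong)
    show "(f \<star> lat S \<phi> \<star> binv f) x = f (lat S \<phi> (binv f x))" if "x \<in> X" for x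
      using that L fB by (simp add: B_apply B_in_X)
    fix F x assume F: "finite F" "F \<subseteq> S"
    have "pprod (f \<star> \<phi> \<star> binv f) F = finprod B (\<lambda>s. f \<star> cj \<phi> s \<star> binv f) F"
      unfolding pprod_def by (rule B.cfinprod_cong[OF cc F]) (rule cje)
    also have "\<dots> = f \<star> pprod \<phi> F \<star> binv f"
      unfolding pprod_def by (rule B.cfinprod_conj[OF c fB(1) F])
    finally show "pprod (f \<star> \<phi> \<star> binv f) F x = (f \<star> pprod \<phi> F \<star> binv f) x" by simp
  qed
  show "lat S (f \<star> \<phi> \<star> binv f) = f \<star> lat S \<phi> \<star> binv f"
    by (rule lat_eqI[OF _ u]) (use L fB in auto)
qed

lemma lat_translate:
  assumes N: "acts_on N \<phi>" and a: "a \<in> carrier G" and S: "S \<subseteq> carrier G"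
    and c: "B.commuting (cj \<phi>) ((\<lambda>s. a \<otimes> s) ` S)"
  shows "lat ((\<lambda>s. a \<otimes> s) ` S) \<phi> = lat S (cj \<phi> a)" and "B.commuting (cj (cj \<phi> a)) S"
proof -
  let ?h = "\<lambda>s. a \<otimes> s"
  have \<phi>: "\<phi> \<in> carrier B" using acts_onD(3)[OF N] .
  have aS: "?h ` S \<subseteq> carrier G" using a S by auto
  have cje: "cj (cj \<phi> a) s = cj \<phi> (?h s)" if "s \<in> S" for s
    using cj_cj[OF \<phi> a] that S by auto
  have inj: "inj_on ?h S" using a S by (auto simp: inj_on_def subset_iff)
  show c': "B.commuting (cj (cj \<phi> a)) S" using c cje by (simp add: B.commuting_def)
  have "ulim S (\<lambda>F. pprod \<phi> (?h ` F)) (lat (?h ` S) \<phi>)"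
    by (rule ulim_reindex[OF lat_ulim[OF N aS c]])
  then have "ulim S (pprod (cj \<phi> a)) (lat (?h ` S) \<phi>)"
  proof (rule ulim_cong)
    fix F x assume F: "finite F" "F \<subseteq> S"
    have "pprod (cj \<phi> a) F = finprod B (\<lambda>s. cj \<phi> (?h s)) F"
      unfolding pprod_def by (rule B.cfinprod_cong[OF _ F]) (use c cje in \<open>auto simp: B.commuting_def\<close>)
    also have "\<dots> = pprod \<phi> (?h ` F)"
      unfolding pprod_def by (rule B.cfinprod_reindex[OF c inj F, symmetric])
    finally show "pprod (cj \<phi> a) F x = pprod \<phi> (?h ` F) x" by simp
  qed simp
  then show "lat (?h ` S) \<phi> = lat S (cj \<phi> a)"
    using lat_eqI[OF lat_in_B(1)[OF N aS c]] by simp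
qed

end

section \<open>Even permutations of finite sets\<close>

lemma even_perm_on_iff:
  "even_perm_on A f \<longleftrightarrow> (\<lambda>w. if w \<in> A then f w else w) permutes A \<and> evenperm (\<lambda>w. if w \<in> A then f w else w)"
  by (simp add: even_perm_on_def Let_def)

lemma even_perm_on_image: "even_perm_on A f \<Longrightarrow> x \<in> A \<Longrightarrow> f x \<in> A"
  using permutes_in_image[of "\<lambda>w. if w \<in> A then f w else w" A x] by (simp add: even_perm_on_iff)

lemma even_perm_on_comp:
  assumes "finite A" "even_perm_on A f" "even_perm_on A g" "\<And>x. x \<in> A \<Longrightarrow> h x = f (g x)"
  shows "even_perm_on A h"
proof -
  let ?r = "\<lambda>f w. if w \<in> A then f w else w"
  have "?r h = ?r f \<circ> ?r g"
    using even_perm_on_image[OF assms(3)] assms(4) by (auto simp: fun_eq_iff)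
  moreover have "permutation (?r f)" "permutation (?r g)"
    using assms unfolding even_perm_on_iff permutation_permutes by blast+
  ultimately show ?thesis
    using assms(2,3) unfolding even_perm_on_iff
    by (simp add: evenperm_comp permutes_compose)
qed

lemma even_perm_on_bij:
  assumes h: "bij_betw h A C" and fin: "finite A" and p: "even_perm_on A p"
    and q: "\<And>x. x \<in> A \<Longrightarrow> q (h x) = h (p x)"
  shows "even_perm_on C q"
proof -
  let ?p = "\<lambda>w. if w \<in> A then p w else w"
  have inj: "inj_on h A" and im: "h ` A = C" using h by (auto simp: bij_betw_def)
  have pp: "?p permutes A" "evenperm ?p" using p by (auto simp: even_perm_on_iff)
  have eq: "map_permutation A h ?p = (\<lambda>w. if w \<in> C then q w else w)"
  proof
    fix w
    show "map_permutation A h ?p w = (if w \<in> C then q w else w)"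
    proof (cases "w \<in> C")
      case True
      then obtain x where "x \<in> A" "w = h x" using im by auto
      then show ?thesis using map_permutation_apply[OF inj, of x ?p] q True by simp
    next
      case False
      then show ?thesis using im by (simp add: map_permutation_def)
    qed
  qed
  have "map_permutation A h ?p permutes C" by (rule map_permutation_permutes[OF h pp(1)])
  moreover have "evenperm (map_permutation A h ?p)"
    using evenperm_map_permutation[OF inj pp(1) fin] pp(2) by simp
  ultimately show ?thesis unfolding even_perm_on_iff eq by simp
qed

lemma even_perm_on_bij_iff:
  assumes h: "bij_betw h A C" and fin: "finite A" and p: "\<And>x. x \<in> A \<Longrightarrow> p x \<in> A"
    and q: "\<And>x. x \<in> A \<Longrightarrow> q (h x) = h (p x)"
  shows "even_perm_on C q \<longleftrightarrow> even_perm_on A p"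
proof
  assume C: "even_perm_on C q"
  have inj: "inj_on h A" and im: "h ` A = C" using h by (auto simp: bij_betw_def)
  show "even_perm_on A p"
  proof (rule even_perm_on_bij[OF bij_betw_inv_into[OF h] _ C])
    show "finite C" using im fin by auto
    fix w assume "w \<in> C"
    then obtain x where "x \<in> A" "w = h x" using im by auto
    then show "p (inv_into A h w) = inv_into A h (q w)" using p q inj by simp
  qed
next
  assume "even_perm_on A p"
  then show "even_perm_on C q"
    by (rule even_perm_on_bij[where h = h and p = p, OF h fin]) (rule q)
qed

lemma even_perm_on_Un:
  assumes "finite A" "finite C" "A \<inter> C = {}" "even_perm_on A f" "even_perm_on C f"
  shows "even_perm_on (A \<union> C) f"
proof -
  let ?r = "\<lambda>A w. if w \<in> A then f w else w"
  have eq: "?r (A \<union> C) = ?r A \<circ> ?r C"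
    using even_perm_on_image[OF assms(5)] assms(3) by (auto simp: fun_eq_iff)
  have p: "?r A permutes A" "?r C permutes C" "evenperm (?r A)" "evenperm (?r C)"
    using assms by (auto simp: even_perm_on_iff)
  have "?r A permutes (A \<union> C)" "?r C permutes (A \<union> C)"
    using permutes_subset[OF p(1)] permutes_subset[OF p(2)] by auto
  then have "?r A \<circ> ?r C permutes (A \<union> C)" by (simp add: permutes_compose)
  moreover have "permutation (?r A)" "permutation (?r C)"
    using p assms unfolding permutation_permutes by blast+
  then have "evenperm (?r A \<circ> ?r C)" using p by (simp add: evenperm_comp)
  ultimately show ?thesis unfolding even_perm_on_iff eq by simp
qed

lemma even_perm_on_Union:
  assumes "finite P" "\<And>A. A \<in> P \<Longrightarrow> finite A \<and> even_perm_on A f"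
    "\<And>A C. A \<in> P \<Longrightarrow> C \<in> P \<Longrightarrow> A \<noteq> C \<Longrightarrow> A \<inter> C = {}"
  shows "even_perm_on (\<Union>P) f"
  using assms
proof (induction P rule: finite_induct)
  case empty
  then show ?case by (simp add: even_perm_on_iff flip: id_def)
next
  case (insert A P)
  have "even_perm_on (A \<union> \<Union>P) f"
  proof (rule even_perm_on_Un)
    show "even_perm_on (\<Union>P) f" using insert by auto
    show "A \<inter> \<Union>P = {}" using insert.prems(2)[of A] insert.hyps(2) by blast
  qed (use insert in auto)
  then show ?case by simp
qed

lemma even_perm_on_commutator:
  assumes fin: "finite A" and f: "bij_betw f A A" and g: "bij_betw g A A"
    and f': "\<And>x. x \<in> A \<Longrightarrow> f' (f x) = x" and g': "\<And>x. x \<in> A \<Longrightarrow> g' (g x) = x"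
    and h: "\<And>x. x \<in> A \<Longrightarrow> h x = f (g (f' (g' x)))"
  shows "even_perm_on A h"
proof -
  let ?r = "\<lambda>f w. if w \<in> A then f w else w"
  have p: "?r u permutes A" if "bij_betw u A A" for u
  proof (rule bij_imp_permutes)
    show "bij_betw (?r u) A A" using that by (simp cong: bij_betw_cong)
  qed simp
  have pf: "?r f permutes A" and pg: "?r g permutes A" using p f g by auto
  have inv: "inv_into UNIV (?r f) = ?r f'" "inv_into UNIV (?r g) = ?r g'"
  proof -
    have *: "inv_into UNIV (?r u) = ?r u'" if u: "bij_betw u A A" and u': "\<And>x. x \<in> A \<Longrightarrow> u' (u x) = x" for u u'
    proof
      fix y
      show "inv_into UNIV (?r u) y = ?r u' y"
      proof (cases "y \<in> A")
        case True
        then obtain x where "x \<in> A" "y = u x" using u by (auto simp: bij_betw_def)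
        then show ?thesis using permutes_inverses(2)[OF p[OF u], of x] u' True by simp
      next
        case False
        then show ?thesis using permutes_inverses(2)[OF p[OF u], of y] by simp
      qed
    qed
    show "inv_into UNIV (?r f) = ?r f'" "inv_into UNIV (?r g) = ?r g'" using *[OF f f'] *[OF g g'] by auto
  qed
  have pif: "?r f' permutes A" "?r g' permutes A"
    using permutes_inv[OF pf] permutes_inv[OF pg] inv by auto
  have im: "g' x \<in> A" "f' x \<in> A" "f x \<in> A" "g x \<in> A" if "x \<in> A" for x
    using permutes_in_image[OF pif(1), of x] permutes_in_image[OF pif(2), of x]
      permutes_in_image[OF pf, of x] permutes_in_image[OF pg, of x] that by auto
  have eq: "?r h = ?r f \<circ> ?r g \<circ> (?r f' \<circ> ?r g')"
    using im h by (auto simp: fun_eq_iff)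
  have perm: "permutation (?r f)" "permutation (?r g)" "permutation (?r f')" "permutation (?r g')"
    using pf pg pif fin unfolding permutation_permutes by blast+
  have ev: "evenperm (?r f') = evenperm (?r f)" "evenperm (?r g') = evenperm (?r g)"
    using evenperm_inv[OF perm(1)] evenperm_inv[OF perm(2)] inv by auto
  have "evenperm (?r h)"
    unfolding eq using perm by (simp add: evenperm_comp permutation_compose ev)
  moreover have "?r h permutes A"
    unfolding eq by (intro permutes_compose pf pg pif)
  ultimately show ?thesis by (simp add: even_perm_on_iff)
qed

section \<open>Even gates\<close>

context subshift_system
begin

text \<open>
  The sets of variants are the blocks on which evenness is tested; they consist of configurations,
  whereas those of \<open>even_gate\<close> consist of patterns on \<open>N\<close>. This dispenses with the map on
  patterns and makes evenness easy to transport along homeomorphisms.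
\<close>

definition variants :: "'g set \<Rightarrow> ('g \<Rightarrow> 'a) \<Rightarrow> ('g \<Rightarrow> 'a) set" where
  "variants N y = {x \<in> X. agree (carrier G - N) x y}"

lemma restrict_eq_iff: "restrict x N = restrict y N \<longleftrightarrow> agree N x y"
proof
  assume *: "restrict x N = restrict y N"
  show "agree N x y"
  proof (rule agreeI)
    fix k assume "k \<in> N"
    then show "x k = y k" using fun_cong[OF *, of k] by simp
  qed
qed (auto simp: agree_def)

lemma variants_bij_patterns:
  "bij_betw (\<lambda>x. restrict x N) (variants N y)
     {restrict x N | x. x \<in> X \<and> restrict x (carrier G - N) = restrict y (carrier G - N)}"
proof (rule bij_betw_imageI)
  show "inj_on (\<lambda>x. restrict x N) (variants N y)"
  proof (rule inj_onI)
    fix u v assume uv: "u \<in> variants N y" "v \<in> variants N y" "restrict u N = restrict v N"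
    then have a: "agree N u v" by (simp add: restrict_eq_iff)
    show "u = v"
    proof (rule X_eqI)
      show "u \<in> X" "v \<in> X" using uv by (auto simp: variants_def)
      show "agree (carrier G) u v"
      proof (rule agreeI)
        fix k assume "k \<in> carrier G"
        then show "u k = v k"
          using uv agreeD[OF a, of k] by (cases "k \<in> N") (auto simp: variants_def agree_def)
      qed
    qed
  qed
qed (auto simp: variants_def restrict_eq_iff)

lemma finite_variants:
  assumes "finite N" "N \<subseteq> carrier G"
  shows "finite (variants N y)"
proof (rule finite_imageD)
  have "(\<lambda>x. restrict x N) ` variants N y \<subseteq> N \<rightarrow>\<^sub>E \<Sigma>"
  proof (rule image_subsetI)
    fix x assume "x \<in> variants N y"
    then have "x \<in> X" by (simp add: variants_def)
    then show "restrict x N \<in> N \<rightarrow>\<^sub>E \<Sigma>" using X_symbol assms(2) by (simp add: PiE_iff subset_iff)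
  qed
  then show "finite ((\<lambda>x. restrict x N) ` variants N y)"
    by (rule finite_subset[OF _ finite_PiE[OF assms(1)]]) (rule finite_alphabet)
  show "inj_on (\<lambda>x. restrict x N) (variants N y)"
    using variants_bij_patterns by (rule bij_betw_imp_inj_on)
qed

lemma variants_self: "y \<in> X \<Longrightarrow> y \<in> variants N y"
  by (simp add: variants_def)

lemma variants_eq: "x \<in> variants N y \<Longrightarrow> variants N x = variants N y"
  by (auto simp: variants_def agree_def)

definition even_off :: "'g set \<Rightarrow> (('g \<Rightarrow> 'a) \<Rightarrow> ('g \<Rightarrow> 'a)) \<Rightarrow> bool" where
  "even_off N \<phi> \<longleftrightarrow> finite N \<and> N \<subseteq> carrier G \<and> \<phi> \<in> homeos \<and>
     (\<forall>x\<in>X. agree (carrier G - N) (\<phi> x) x) \<and> (\<forall>y\<in>X. even_perm_on (variants N y) \<phi>)"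

text \<open>
  The sets of variants of the elements of \<open>A\<close> partition \<open>A\<close>.
\<close>

lemma even_perm_on_saturated:
  assumes N: "finite N" "N \<subseteq> carrier G" and ev: "\<And>y. y \<in> X \<Longrightarrow> even_perm_on (variants N y) \<phi>"
    and A: "finite A" "A \<subseteq> X" and sat: "\<And>x. x \<in> A \<Longrightarrow> variants N x \<subseteq> A"
  shows "even_perm_on A \<phi>"
proof -
  have "A = \<Union>(variants N ` A)" using sat variants_self A(2) by blast
  moreover have "even_perm_on (\<Union>(variants N ` A)) \<phi>"
  proof (rule even_perm_on_Union)
    show "finite C \<and> even_perm_on C \<phi>" if "C \<in> variants N ` A" for C
      using that ev A(2) finite_variants[OF N] by auto
    show "C \<inter> D = {}" if "C \<in> variants N ` A" "D \<in> variants N ` A" "C \<noteq> D" for C D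
      using that variants_eq by blast
  qed (use A in auto)
  ultimately show ?thesis by simp
qed

lemma even_off_mono:
  assumes "even_off N \<phi>" "N \<subseteq> M" "finite M" "M \<subseteq> carrier G"
  shows "even_off M \<phi>"
proof -
  have "even_perm_on (variants M y) \<phi>" if "y \<in> X" for y
  proof (rule even_perm_on_saturated)
    show "variants N x \<subseteq> variants M y" if "x \<in> variants M y" for x
      using that assms(2) agree_trans[OF agree_subset[of "carrier G - N" _ x "carrier G - M"], of _ y]
      unfolding variants_def by blast
    show "variants M y \<subseteq> X" by (auto simp: variants_def)
  qed (use assms finite_variants in \<open>auto simp: even_off_def\<close>)
  moreover have "agree (carrier G - M) (\<phi> x) x" if "x \<in> X" for x
    by (rule agree_subset[of "carrier G - N"]) (use assms that in \<open>auto simp: even_off_def\<close>)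
  ultimately show ?thesis using assms by (simp add: even_off_def)
qed

lemma bij_variants:
  assumes "\<phi> \<in> carrier B" "\<And>x. x \<in> X \<Longrightarrow> agree (carrier G - N) (\<phi> x) x"
  shows "bij_betw \<phi> (variants N y) (variants N y)"
proof (rule bij_betw_byWitness[where f' = "binv \<phi>"])
  have "agree (carrier G - N) (binv \<phi> x) x" if "x \<in> X" for x
    using assms(2)[of "binv \<phi> x"] that assms(1) B_in_X B_inv_right agree_sym by simp
  then show "binv \<phi> ` variants N y \<subseteq> variants N y"
    using assms(1) B_in_X agree_trans unfolding variants_def by blast
  show "\<phi> ` variants N y \<subseteq> variants N y"
    using assms B_in_X agree_trans unfolding variants_def by blast
qed (use assms B_inv_left B_inv_right in \<open>auto simp: variants_def\<close>)

lemma even_gate_iff: "even_gate G \<Sigma> X \<phi> \<longleftrightarrow> (\<exists>N. even_off N \<phi>)"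
proof
  assume "even_gate G \<Sigma> X \<phi>"
  then obtain N \<phi>' where g: "gate G \<Sigma> X \<phi>" and s: "strong_nbhd G X \<phi> N \<phi>'"
    and e: "\<forall>y \<in> (\<lambda>x. restrict x (carrier G - N)) ` X.
           even_perm_on {restrict x N | x. x \<in> X \<and> restrict x (carrier G - N) = y} \<phi>'"
    unfolding even_gate_def by blast
  have h: "\<phi> \<in> homeos" using g by (simp add: gate_def self_homeo_eq)
  have N: "finite N" "N \<subseteq> carrier G" "\<And>x. x \<in> X \<Longrightarrow> agree (carrier G - N) (\<phi> x) x"
    and \<phi>': "\<And>x. x \<in> X \<Longrightarrow> restrict (\<phi> x) N = \<phi>' (restrict x N)"
    using s by (auto simp: strong_nbhd_def fixes_outside_iff)
  have "even_perm_on (variants N y) \<phi>" if y: "y \<in> X" for y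
  proof -
    have "even_perm_on {restrict x N | x. x \<in> X \<and> restrict x (carrier G - N) = restrict y (carrier G - N)} \<phi>'"
      using e y by blast
    then show ?thesis
      using even_perm_on_bij_iff[OF variants_bij_patterns finite_variants[OF N(1,2)], of y \<phi> \<phi>']
        bij_variants[of \<phi> N y] h N(3) \<phi>'
      by (auto simp: homeos_def bij_betw_def variants_def)
  qed
  then show "\<exists>N. even_off N \<phi>" using N h by (auto simp: even_off_def)
next
  assume "\<exists>N. even_off N \<phi>"
  then obtain N where N: "even_off N \<phi>" ..
  then have h: "\<phi> \<in> homeos" and B: "\<phi> \<in> carrier B" by (auto simp: even_off_def homeos_def)
  obtain M where M: "N \<subseteq> M" "acts_on M \<phi>"
    using acts_on_exists[OF h, of N] N by (auto simp: even_off_def)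
  note MD = acts_onD[OF M(2)]
  have ev: "even_off M \<phi>" by (rule even_off_mono[OF N M(1)]) (use MD in auto)
  define \<phi>' where "\<phi>' w = restrict (\<phi> (SOME x. x \<in> X \<and> restrict x M = w)) M" for w
  have \<phi>': "restrict (\<phi> x) M = \<phi>' (restrict x M)" if x: "x \<in> X" for x
  proof -
    let ?z = "SOME z. z \<in> X \<and> restrict z M = restrict x M"
    have "?z \<in> X \<and> restrict ?z M = restrict x M" by (rule someI[of _ x]) (use x in simp)
    then have "agree M (\<phi> x) (\<phi> ?z)" using MD(6) x by (auto simp: restrict_eq_iff agree_sym)
    then show ?thesis unfolding \<phi>'_def by (simp only: restrict_eq_iff)
  qed
  have "strong_nbhd G X \<phi> M \<phi>'"
    unfolding strong_nbhd_def fixes_outside_iff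
  proof (intro conjI)
    show "\<phi>' ` (\<lambda>x. restrict x M) ` X \<subseteq> (\<lambda>x. restrict x M) ` X"
      using \<phi>' B_in_X[OF B] by (auto simp flip: \<phi>')
    show "\<forall>x\<in>X. restrict (\<phi> x) M = \<phi>' (restrict x M)" using \<phi>' by blast
  qed (use MD in auto)
  moreover have "even_perm_on {restrict x M | x. x \<in> X \<and> restrict x (carrier G - M) = y} \<phi>'"
    if y: "y \<in> (\<lambda>x. restrict x (carrier G - M)) ` X" for y
  proof -
    obtain y' where y': "y' \<in> X" "y = restrict y' (carrier G - M)" using y by auto
    have e: "even_perm_on (variants M y') \<phi>" using ev y' by (simp add: even_off_def)
    show ?thesis unfolding y'(2)
      by (rule even_perm_on_bij[OF variants_bij_patterns finite_variants[OF MD(1,2)] e])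
        (use \<phi>' in \<open>auto simp: variants_def\<close>)
  qed
  moreover have "gate G \<Sigma> X \<phi>" using M gate_iff by auto
  ultimately show "even_gate G \<Sigma> X \<phi>" unfolding even_gate_def by blast
qed

lemma even_off_acts_on:
  assumes "even_off N \<phi>"
  obtains M where "N \<subseteq> M" "acts_on M \<phi>" "even_off M \<phi>"
proof -
  obtain M where M: "N \<subseteq> M" "acts_on M \<phi>"
    using acts_on_exists[of \<phi> N] assms by (auto simp: even_off_def)
  then show thesis using that even_off_mono[OF assms M(1)] acts_onD(1,2)[OF M(2)] by blast
qed

lemma even_off_mult:
  assumes "even_off N \<phi>" "even_off N \<psi>"
  shows "even_off N (\<phi> \<star> \<psi>)"
proof -
  have B: "\<phi> \<in> carrier B" "\<psi> \<in> carrier B" using assms by (auto simp: even_off_def homeos_def)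
  have "even_perm_on (variants N y) (\<phi> \<star> \<psi>)" if "y \<in> X" for y
    by (rule even_perm_on_comp[of _ \<phi> \<psi>])
      (use assms that finite_variants B in \<open>auto simp: even_off_def variants_def B_apply\<close>)
  moreover have "agree (carrier G - N) ((\<phi> \<star> \<psi>) x) x" if "x \<in> X" for x
    using agree_trans[of "carrier G - N" "\<phi> (\<psi> x)" "\<psi> x" x] assms that B
    by (simp add: B_apply even_off_def B_in_X)
  ultimately show ?thesis
    using assms subgroup.m_closed[OF subgroup_homeos] by (simp add: even_off_def)
qed

lemma commutator_even_off:
  assumes N: "finite N" "N \<subseteq> carrier G" and f: "\<phi> \<in> homeos" and g: "\<psi> \<in> homeos"
    and out: "\<And>x. x \<in> X \<Longrightarrow> agree (carrier G - N) (\<phi> x) x" "\<And>x. x \<in> X \<Longrightarrow> agree (carrier G - N) (\<psi> x) x"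
  shows "even_off N (\<phi> \<star> \<psi> \<star> binv \<phi> \<star> binv \<psi>)"
proof -
  let ?c = "\<phi> \<star> \<psi> \<star> binv \<phi> \<star> binv \<psi>"
  have B: "\<phi> \<in> carrier B" "\<psi> \<in> carrier B" using f g by (auto simp: homeos_def)
  have c: "?c \<in> homeos"
    by (intro subgroup.m_closed[OF subgroup_homeos] subgroup.m_inv_closed[OF subgroup_homeos] f g)
  have ev: "even_perm_on (variants N y) ?c" for y
  proof (rule even_perm_on_commutator)
    show "finite (variants N y)" using finite_variants N by auto
    show "bij_betw \<phi> (variants N y) (variants N y)" "bij_betw \<psi> (variants N y) (variants N y)"
      using bij_variants B out by auto
    show "binv \<phi> (\<phi> x) = x" "binv \<psi> (\<psi> x) = x" if "x \<in> variants N y" for x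
      using that B B_inv_left by (auto simp: variants_def)
    show "?c x = \<phi> (\<psi> (binv \<phi> (binv \<psi> x)))" if "x \<in> variants N y" for x
      using that B by (simp add: variants_def B_apply B_in_X)
  qed
  have "agree (carrier G - N) (?c x) x" if x: "x \<in> X" for x
    using even_perm_on_image[OF ev variants_self[OF x]] by (simp add: variants_def)
  then show ?thesis using ev c N by (simp add: even_off_def)
qed

lemma commutator_even: "acts_on N \<phi> \<Longrightarrow> acts_on N \<psi> \<Longrightarrow> even_off N (\<phi> \<star> \<psi> \<star> binv \<phi> \<star> binv \<psi>)"
  by (rule commutator_even_off) (auto simp: acts_onD acts_on_homeo)

section \<open>Homeomorphisms commuting with a finite-index subgroup of shifts\<close>

text \<open>
  A finite change of \<open>x\<close> has a finite effect on \<open>f x\<close>, and one finite set of cells contains that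
  effect for all \<open>x\<close>. A homeomorphism need not have this property; those that have it conjugate
  gates to gates.
\<close>

definition finite_effect :: "(('g \<Rightarrow> 'a) \<Rightarrow> ('g \<Rightarrow> 'a)) \<Rightarrow> bool" where
  "finite_effect f \<longleftrightarrow> (\<forall>N. finite N \<and> N \<subseteq> carrier G \<longrightarrow> (\<exists>M. finite M \<and> M \<subseteq> carrier G \<and>
     (\<forall>x\<in>X. \<forall>y\<in>X. agree (carrier G - N) x y \<longrightarrow> agree (carrier G - M) (f x) (f y))))"

text \<open>
  The elements of \<open>R\<close> are the inverses of representatives of the right cosets.
\<close>

lemma finite_index_representatives:
  assumes "finite_index_subgroup H G"
  obtains R where "finite R" "R \<subseteq> carrier G" "\<And>g. g \<in> carrier G \<Longrightarrow> \<exists>r\<in>R. \<exists>h\<in>H. g = r \<otimes> h"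
proof -
  have H: "subgroup H G" and fin: "finite (rcosets H)"
    using assms by (auto simp: finite_index_subgroup_def)
  have "rcosets H = (\<lambda>a. H #> a) ` carrier G" by (auto simp: RCOSETS_def)
  then obtain C where C: "C \<subseteq> carrier G" "finite C" "rcosets H = (\<lambda>a. H #> a) ` C"
    using fin finite_subset_image[of "rcosets H" "\<lambda>a. H #> a" "carrier G"] by auto
  show thesis
  proof (rule that[of "(\<lambda>c. inv c) ` C"])
    fix g assume g: "g \<in> carrier G"
    then have "H #> inv g \<in> rcosets H" by (auto simp: RCOSETS_def)
    then obtain c where c: "c \<in> C" "H #> inv g = H #> c" using C by auto
    then have "inv g \<in> H #> c" using rcos_self[OF _ H, of "inv g"] g by auto
    then obtain h where h: "h \<in> H" "inv g = h \<otimes> c" by (auto simp: r_coset_def)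
    have hc: "h \<in> carrier G" "c \<in> carrier G" using h c C subgroup.subset[OF H] by auto
    have "g = inv (h \<otimes> c)" using h g by (metis inv_inv)
    then have "g = inv c \<otimes> inv h" using hc by (simp add: inv_mult_group)
    then show "\<exists>r\<in>(\<lambda>c. inv c) ` C. \<exists>h\<in>H. g = r \<otimes> h"
      using c h subgroup.m_inv_closed[OF H] by blast
  qed (use C in auto)
qed

lemma Aut_iff:
  assumes "H \<subseteq> carrier G"
  shows "f \<in> Aut_subshift G \<Sigma> X H \<longleftrightarrow> f \<in> homeos \<and> (\<forall>h\<in>H. f \<star> sh h = sh h \<star> f)"
proof -
  have "(\<forall>x\<in>X. f (shift G h x) = shift G h (f x)) \<longleftrightarrow> f \<star> sh h = sh h \<star> f"
    if f: "f \<in> homeos" and h: "h \<in> H" for h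
  proof -
    have B: "f \<in> carrier B" "sh h \<in> carrier B" "h \<in> carrier G" using f h assms sh_B by (auto simp: homeos_def)
    then have *: "(f \<star> sh h) x = f (shift G h x)" "(sh h \<star> f) x = shift G h (f x)" if "x \<in> X" for x
      using that by (simp_all add: B_apply sh_apply B_in_X)
    show ?thesis
    proof
      assume "\<forall>x\<in>X. f (shift G h x) = shift G h (f x)"
      then show "f \<star> sh h = sh h \<star> f" using B * by (intro B_eqI) auto
    next
      assume e: "f \<star> sh h = sh h \<star> f"
      show "\<forall>x\<in>X. f (shift G h x) = shift G h (f x)" using * e by metis
    qed
  qed
  then show ?thesis by (auto simp: Aut_subshift_def self_homeo_eq)
qed

text \<open>
  The cell \<open>r \<otimes> h\<close> of \<open>f x\<close>, where \<open>h \<in> H\<close>, depends on the cells of \<open>x\<close> in the translate by \<open>h\<close>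
  of a window \<open>V\<close> for the cell \<open>r\<close>, and finitely many \<open>r\<close> reach all cells. So a change of \<open>x\<close> in
  \<open>N\<close> affects \<open>r \<otimes> h\<close> only for the finitely many \<open>h\<close> whose translate of \<open>V\<close> meets \<open>N\<close>.
\<close>

lemma Aut_finite_effect:
  assumes H: "finite_index_subgroup H G" and f: "f \<in> Aut_subshift G \<Sigma> X H"
  shows "finite_effect f"
  unfolding finite_effect_def
proof (intro allI impI, elim conjE)
  fix N :: "'g set" assume N: "finite N" "N \<subseteq> carrier G"
  have HG: "H \<subseteq> carrier G" using H subgroup.subset by (auto simp: finite_index_subgroup_def)
  have fh: "f \<in> homeos" and eq: "\<And>h x. h \<in> H \<Longrightarrow> x \<in> X \<Longrightarrow> f (shift G h x) = shift G h (f x)"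
    using f by (auto simp: Aut_subshift_def self_homeo_eq)
  have w: "windowed f" using fh by (simp add: homeos_def)
  obtain R where R: "finite R" "R \<subseteq> carrier G" "\<And>g. g \<in> carrier G \<Longrightarrow> \<exists>r\<in>R. \<exists>h\<in>H. g = r \<otimes> h"
    using finite_index_representatives[OF H] by metis
  obtain V where V: "finite V" "V \<subseteq> carrier G"
    "\<And>x y. x \<in> X \<Longrightarrow> y \<in> X \<Longrightarrow> agree V x y \<Longrightarrow> agree R (f x) (f y)"
    using windowedE[OF w R(1,2)] by metis
  let ?M = "(\<lambda>(r, v, n). r \<otimes> (inv v \<otimes> n)) ` (R \<times> V \<times> N)"
  show "\<exists>M. finite M \<and> M \<subseteq> carrier G \<and>
     (\<forall>x\<in>X. \<forall>y\<in>X. agree (carrier G - N) x y \<longrightarrow> agree (carrier G - M) (f x) (f y))"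
  proof (intro exI[of _ ?M] conjI ballI impI)
    show "finite ?M" using R V N by auto
    show "?M \<subseteq> carrier G" using R(2) V(2) N(2) by (auto simp: subset_iff)
    fix x y assume xy: "x \<in> X" "y \<in> X" "agree (carrier G - N) x y"
    show "agree (carrier G - ?M) (f x) (f y)"
    proof (rule agreeI)
      fix k assume k: "k \<in> carrier G - ?M"
      obtain r h where rh: "r \<in> R" "h \<in> H" "k = r \<otimes> h" using R(3)[of k] k by auto
      have hG: "h \<in> carrier G" using rh HG by auto
      have "agree V (shift G h x) (shift G h y)"
      proof (rule agreeI)
        fix v assume v: "v \<in> V"
        have "v \<otimes> h \<notin> N"
        proof
          assume n: "v \<otimes> h \<in> N"
          have "h = inv v \<otimes> (v \<otimes> h)" using v V hG by (auto simp flip: m_assoc)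
          then have "k = (\<lambda>(r, v, n). r \<otimes> (inv v \<otimes> n)) (r, v, v \<otimes> h)" using rh by simp
          then have "k \<in> ?M" using n v rh(1) by blast
          then show False using k by simp
        qed
        then show "shift G h x v = shift G h y v"
          using agreeD[OF xy(3), of "v \<otimes> h"] v V(2) hG by (auto simp: shift_apply)
      qed
      then have "agree R (f (shift G h x)) (f (shift G h y))" using V(3) xy hG shift_in_X by simp
      then have "shift G h (f x) r = shift G h (f y) r" using eq rh xy agreeD by fastforce
      then show "f x k = f y k" using rh R(2) by (auto simp: shift_apply)
    qed
  qed
qed

lemma sh_finite_effect:
  assumes g: "g \<in> carrier G"
  shows "finite_effect (sh g)"
  unfolding finite_effect_def
proof (intro allI impI, elim conjE)
  fix N :: "'g set" assume N: "finite N" "N \<subseteq> carrier G"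
  let ?M = "(\<lambda>n. n \<otimes> inv g) ` N"
  show "\<exists>M. finite M \<and> M \<subseteq> carrier G \<and>
     (\<forall>x\<in>X. \<forall>y\<in>X. agree (carrier G - N) x y \<longrightarrow> agree (carrier G - M) (sh g x) (sh g y))"
  proof (intro exI[of _ ?M] conjI ballI impI)
    show "finite ?M" "?M \<subseteq> carrier G" using N g by auto
    fix x y assume xy: "x \<in> X" "y \<in> X" "agree (carrier G - N) x y"
    show "agree (carrier G - ?M) (sh g x) (sh g y)"
    proof (rule agreeI)
      fix k assume k: "k \<in> carrier G - ?M"
      have "k = (k \<otimes> g) \<otimes> inv g" using k g by (simp add: m_assoc)
      then have "k \<otimes> g \<in> carrier G - N" using k g by auto
      then show "sh g x k = sh g y k" using agreeD[OF xy(3)] xy k by (simp add: sh_apply shift_apply)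
    qed
  qed
qed

lemma
  assumes fh: "f \<in> homeos" and fe: "finite_effect f"
  shows gate_conjugate: "acts_on N \<phi> \<Longrightarrow> \<exists>M. acts_on M (f \<star> \<phi> \<star> binv f)"
    and even_conjugate: "even_off N \<phi> \<Longrightarrow> \<exists>M. even_off M (f \<star> \<phi> \<star> binv f)"
proof -
  have fB: "f \<in> carrier B" using fh by (simp add: homeos_def)
  have conj: "\<exists>M. finite M \<and> M \<subseteq> carrier G \<and> f \<star> \<phi> \<star> binv f \<in> homeos \<and>
    (\<forall>x\<in>X. agree (carrier G - M) ((f \<star> \<phi> \<star> binv f) x) x) \<and>
    (\<forall>x\<in>X. \<forall>y\<in>X. agree (carrier G - N) x y \<longrightarrow> agree (carrier G - M) (f x) (f y))"
    if h: "\<phi> \<in> homeos" and N: "finite N" "N \<subseteq> carrier G"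
    and out: "\<And>x. x \<in> X \<Longrightarrow> agree (carrier G - N) (\<phi> x) x" for \<phi> N
  proof -
    obtain M where M: "finite M" "M \<subseteq> carrier G"
      "\<And>x y. x \<in> X \<Longrightarrow> y \<in> X \<Longrightarrow> agree (carrier G - N) x y \<Longrightarrow> agree (carrier G - M) (f x) (f y)"
      using fe[unfolded finite_effect_def, rule_format, OF conjI[OF N]] by metis
    have \<phi>B: "\<phi> \<in> carrier B" using h by (simp add: homeos_def)
    have "agree (carrier G - M) ((f \<star> \<phi> \<star> binv f) x) x" if x: "x \<in> X" for x
    proof -
      have "agree (carrier G - M) (f (\<phi> (binv f x))) (f (binv f x))"
        by (rule M(3)) (use x fB \<phi>B B_in_X out in auto)
      then show ?thesis using x fB \<phi>B by (simp add: B_apply B_in_X B_inv_right)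
    qed
    moreover have "f \<star> \<phi> \<star> binv f \<in> homeos"
      using fh h subgroup_homeos by (intro subgroup.m_closed[OF subgroup_homeos] subgroup.m_inv_closed[OF subgroup_homeos])
    ultimately show ?thesis using M by blast
  qed
  show "\<exists>M. acts_on M (f \<star> \<phi> \<star> binv f)" if a: "acts_on N \<phi>"
  proof -
    obtain M where M: "finite M" "M \<subseteq> carrier G" "f \<star> \<phi> \<star> binv f \<in> homeos"
      "\<forall>x\<in>X. agree (carrier G - M) ((f \<star> \<phi> \<star> binv f) x) x"
      using conj[OF acts_on_homeo[OF a] acts_onD(1,2,4)[OF a]] by blast
    then show ?thesis using acts_on_exists[OF M(3,1,2)] by blast
  qed
  show "\<exists>M. even_off M (f \<star> \<phi> \<star> binv f)" if a: "even_off N \<phi>"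
  proof -
    have N: "finite N" "N \<subseteq> carrier G" "\<phi> \<in> homeos" "\<And>x. x \<in> X \<Longrightarrow> agree (carrier G - N) (\<phi> x) x"
      "\<And>y. y \<in> X \<Longrightarrow> even_perm_on (variants N y) \<phi>"
      using a by (auto simp: even_off_def)
    have \<phi>B: "\<phi> \<in> carrier B" using N by (simp add: homeos_def)
    obtain M where M: "finite M" "M \<subseteq> carrier G" "f \<star> \<phi> \<star> binv f \<in> homeos"
      "\<forall>x\<in>X. agree (carrier G - M) ((f \<star> \<phi> \<star> binv f) x) x"
      "\<forall>x\<in>X. \<forall>y\<in>X. agree (carrier G - N) x y \<longrightarrow> agree (carrier G - M) (f x) (f y)"
      using conj[OF N(3,1,2,4)] by blast
    have "even_perm_on (variants M z) (f \<star> \<phi> \<star> binv f)" if z: "z \<in> X" for z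
    proof -
      let ?A = "binv f ` variants M z"
      have V: "variants M z \<subseteq> X" by (auto simp: variants_def)
      have bij: "bij_betw f ?A (variants M z)"
        by (rule bij_betw_byWitness[where f' = "binv f"])
          (use V fB B_inv_left B_inv_right B_in_X in auto)
      have AX: "?A \<subseteq> X" using V fB B_in_X by auto
      have fin: "finite ?A" using finite_variants[OF M(1,2)] by auto
      have "even_perm_on ?A \<phi>"
      proof (rule even_perm_on_saturated[OF N(1,2,5) fin AX])
        fix x assume x: "x \<in> ?A"
        show "variants N x \<subseteq> ?A"
        proof
          fix u assume u: "u \<in> variants N x"
          then have uX: "u \<in> X" by (simp add: variants_def)
          have "agree (carrier G - M) (f u) (f x)" using M(5) u x AX by (auto simp: variants_def)
          moreover have "f x \<in> variants M z" using x bij by (auto simp: bij_betw_def)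
          ultimately have "f u \<in> variants M z"
            using agree_trans uX B_in_X[OF fB] unfolding variants_def by blast
          then show "u \<in> ?A" using B_inv_left[OF fB uX] by (metis image_eqI)
        qed
      qed
      then show ?thesis
      proof (rule even_perm_on_bij[OF bij fin])
        fix x assume "x \<in> ?A"
        then have "x \<in> X" using AX by auto
        then show "(f \<star> \<phi> \<star> binv f) (f x) = f (\<phi> x)"
          using fB \<phi>B by (simp add: B_apply B_in_X B_inv_left)
      qed
    qed
    then show ?thesis using M by (auto simp: even_off_def)
  qed
qed

lemma even_cj:
  assumes "even_off N \<phi>" "g \<in> carrier G"
  shows "\<exists>M. even_off M (cj \<phi> g)"
proof -
  have B: "\<phi> \<in> carrier B" using assms(1) by (auto simp: even_off_def homeos_def)
  have "cj \<phi> g = sh (inv g) \<star> \<phi> \<star> binv (sh (inv g))"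
    using assms(2) B by (simp add: cj_eq binv_sh)
  then show ?thesis
    using even_conjugate[OF sh_homeo sh_finite_effect assms(1), of "inv g"] assms(2) by simp
qed

end

section \<open>Group-theoretic preliminaries\<close>

context group
begin

lemma subgroup_conj_vimage:
  assumes Q: "subgroup Q G" and f: "f \<in> carrier G"
  shows "subgroup {q \<in> carrier G. f \<otimes> q \<otimes> inv f \<in> Q} G"
proof (rule subgroupI)
  show "{q \<in> carrier G. f \<otimes> q \<otimes> inv f \<in> Q} \<noteq> {}"
    using subgroup.one_closed[OF Q] f by (auto intro!: exI[of _ "\<one>"])
  fix a assume a: "a \<in> {q \<in> carrier G. f \<otimes> q \<otimes> inv f \<in> Q}"
  then have "inv (f \<otimes> a \<otimes> inv f) \<in> Q" using subgroup.m_inv_closed[OF Q] by auto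
  then show "inv a \<in> {q \<in> carrier G. f \<otimes> q \<otimes> inv f \<in> Q}"
    using a f by (simp add: inv_mult_group m_assoc)
  fix b assume b: "b \<in> {q \<in> carrier G. f \<otimes> q \<otimes> inv f \<in> Q}"
  have "(f \<otimes> a \<otimes> inv f) \<otimes> (f \<otimes> b \<otimes> inv f) \<in> Q" using a b subgroup.m_closed[OF Q] by auto
  moreover have "inv f \<otimes> (f \<otimes> (b \<otimes> inv f)) = b \<otimes> inv f" using b f by (simp flip: m_assoc)
  ultimately show "a \<otimes> b \<in> {q \<in> carrier G. f \<otimes> q \<otimes> inv f \<in> Q}"
    using a b f by (simp add: m_assoc)
qed auto

lemma normal_in_subgroupI:
  assumes S: "subgroup S G" and N: "subgroup N G" "N \<subseteq> S"
    and c: "\<And>x h. x \<in> S \<Longrightarrow> h \<in> N \<Longrightarrow> x \<otimes> h \<otimes> inv x \<in> N"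
  shows "N \<lhd> G\<lparr>carrier := S\<rparr>"
proof -
  interpret S: group "G\<lparr>carrier := S\<rparr>" by (rule subgroup_imp_group[OF S])
  show ?thesis
    unfolding S.normal_inv_iff
  proof (intro conjI ballI)
    show "subgroup N (G\<lparr>carrier := S\<rparr>)" using subgroup_incl[OF N(1) S N(2)] .
    fix x h assume "x \<in> carrier (G\<lparr>carrier := S\<rparr>)" "h \<in> N"
    then show "x \<otimes>\<^bsub>G\<lparr>carrier := S\<rparr>\<^esub> h \<otimes>\<^bsub>G\<lparr>carrier := S\<rparr>\<^esub> inv\<^bsub>G\<lparr>carrier := S\<rparr>\<^esub> x \<in> N"
      using c m_inv_consistent[OF S] by simp
  qed
qed

lemma normal_in_subgroupD:
  assumes S: "subgroup S G" and N: "N \<lhd> G\<lparr>carrier := S\<rparr>"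
  shows "subgroup N G" "N \<subseteq> S" "\<And>x h. x \<in> S \<Longrightarrow> h \<in> N \<Longrightarrow> x \<otimes> h \<otimes> inv x \<in> N"
proof -
  interpret S: group "G\<lparr>carrier := S\<rparr>" by (rule subgroup_imp_group[OF S])
  have n: "subgroup N (G\<lparr>carrier := S\<rparr>)"
    "\<And>x h. x \<in> S \<Longrightarrow> h \<in> N \<Longrightarrow> x \<otimes> h \<otimes> inv\<^bsub>G\<lparr>carrier := S\<rparr>\<^esub> x \<in> N"
    using N unfolding S.normal_inv_iff by auto
  show "subgroup N G" by (rule incl_subgroup[OF S n(1)])
  show "N \<subseteq> S" using subgroup.subset[OF n(1)] by simp
  show "x \<otimes> h \<otimes> inv x \<in> N" if "x \<in> S" "h \<in> N" for x h
    using n(2)[OF that] m_inv_consistent[OF S that(1)] by simp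
qed

text \<open>Modulo a subgroup \<open>Q\<close> normalized by \<open>L\<close>, the elements commuting with \<open>h\<close> form a group.\<close>

definition comm_mod :: "'a set \<Rightarrow> 'a set \<Rightarrow> 'a \<Rightarrow> 'a set" where
  "comm_mod L Q h = {x \<in> L. x \<otimes> h \<otimes> inv x \<otimes> inv h \<in> Q}"

lemma subgroup_comm_mod:
  assumes L: "subgroup L G" and Q: "subgroup Q G"
    and n: "\<And>x q. x \<in> L \<Longrightarrow> q \<in> Q \<Longrightarrow> x \<otimes> q \<otimes> inv x \<in> Q" and h: "h \<in> carrier G"
  shows "subgroup (comm_mod L Q h) G"
proof (rule subgroupI)
  note LG = subgroup.mem_carrier[OF L] and QG = subgroup.mem_carrier[OF Q]
  show "comm_mod L Q h \<subseteq> carrier G" using LG by (auto simp: comm_mod_def)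
  have "\<one> \<in> comm_mod L Q h"
    using h subgroup.one_closed[OF L] subgroup.one_closed[OF Q] by (simp add: comm_mod_def)
  then show "comm_mod L Q h \<noteq> {}" by blast
  fix x assume x: "x \<in> comm_mod L Q h"
  then have xL: "x \<in> L" "x \<in> carrier G" "inv x \<in> L"
    using LG subgroup.m_inv_closed[OF L] by (auto simp: comm_mod_def)
  let ?q = "x \<otimes> h \<otimes> inv x \<otimes> inv h"
  have q: "?q \<in> Q" using x by (simp add: comm_mod_def)
  have "inv x \<otimes> inv ?q \<otimes> inv (inv x) \<in> Q"
    using n[OF xL(3)] subgroup.m_inv_closed[OF Q q] by blast
  also have "inv x \<otimes> inv ?q \<otimes> inv (inv x) = inv x \<otimes> h \<otimes> inv (inv x) \<otimes> inv h"
  proof -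
    have "inv x \<otimes> (x \<otimes> (inv h \<otimes> x)) = inv h \<otimes> x" using xL h by (simp flip: m_assoc)
    then show ?thesis using xL h by (simp add: inv_mult_group m_assoc)
  qed
  finally show "inv x \<in> comm_mod L Q h" using xL by (simp add: comm_mod_def)
  fix y assume y: "y \<in> comm_mod L Q h"
  then have yL: "y \<in> L" "y \<in> carrier G" using LG by (auto simp: comm_mod_def)
  let ?r = "y \<otimes> h \<otimes> inv y \<otimes> inv h"
  have r: "?r \<in> Q" using y by (simp add: comm_mod_def)
  have "(x \<otimes> ?r \<otimes> inv x) \<otimes> ?q \<in> Q"
    using n[OF xL(1) r] q subgroup.m_closed[OF Q] by blast
  also have "(x \<otimes> ?r \<otimes> inv x) \<otimes> ?q = (x \<otimes> y) \<otimes> h \<otimes> inv (x \<otimes> y) \<otimes> inv h"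
  proof -
    have "inv x \<otimes> (x \<otimes> (h \<otimes> (inv x \<otimes> inv h))) = h \<otimes> (inv x \<otimes> inv h)" using xL h by (simp flip: m_assoc)
    moreover have "inv h \<otimes> (h \<otimes> (inv x \<otimes> inv h)) = inv x \<otimes> inv h" using xL h by (simp flip: m_assoc)
    ultimately show ?thesis using xL yL h by (simp add: inv_mult_group m_assoc)
  qed
  finally show "x \<otimes> y \<in> comm_mod L Q h"
    using subgroup.m_closed[OF L xL(1) yL(1)] by (simp add: comm_mod_def)
qed

lemma comm_mod_sym:
  assumes L: "subgroup L G" and Q: "subgroup Q G" and x: "x \<in> L" and h: "h \<in> L" "h \<in> comm_mod L Q x"
  shows "x \<in> comm_mod L Q h"
proof -
  have c: "x \<in> carrier G" "h \<in> carrier G" using subgroup.mem_carrier[OF L] x h by auto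
  have "inv (h \<otimes> x \<otimes> inv h \<otimes> inv x) \<in> Q" using h subgroup.m_inv_closed[OF Q] by (simp add: comm_mod_def)
  also have "inv (h \<otimes> x \<otimes> inv h \<otimes> inv x) = x \<otimes> h \<otimes> inv x \<otimes> inv h"
    using c by (simp add: inv_mult_group m_assoc)
  finally show ?thesis using x by (simp add: comm_mod_def)
qed

lemma normal_translate_coset:
  assumes K: "K \<lhd> G" and a: "a \<in> carrier G" and c: "c \<in> carrier G"
  shows "(\<lambda>s. c \<otimes> s) ` (K #> a) = K #> (c \<otimes> a)"
proof (intro equalityI subsetI)
  note KG = subgroup.mem_carrier[OF normal_imp_subgroup[OF K]]
  fix z assume "z \<in> (\<lambda>s. c \<otimes> s) ` (K #> a)"
  then obtain k where k: "k \<in> K" "z = c \<otimes> (k \<otimes> a)" by (auto simp: r_coset_def)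
  have "c \<otimes> k \<otimes> inv c \<in> K" using K k c normal_inv_iff by blast
  moreover have "z = (c \<otimes> k \<otimes> inv c) \<otimes> (c \<otimes> a)"
  proof -
    have "inv c \<otimes> (c \<otimes> a) = a" using a c by (simp flip: m_assoc)
    then show ?thesis using k a c KG by (simp add: m_assoc)
  qed
  ultimately show "z \<in> K #> (c \<otimes> a)" by (auto simp: r_coset_def)
next
  note KG = subgroup.mem_carrier[OF normal_imp_subgroup[OF K]]
  fix z assume "z \<in> K #> (c \<otimes> a)"
  then obtain k where k: "k \<in> K" "z = k \<otimes> (c \<otimes> a)" by (auto simp: r_coset_def)
  have 1: "inv c \<otimes> k \<otimes> c \<in> K"
    using K k c normal_inv_iff[of K] inv_closed[OF c] inv_inv[OF c] by metis
  have 2: "z = c \<otimes> ((inv c \<otimes> k \<otimes> c) \<otimes> a)"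
  proof -
    have "c \<otimes> (inv c \<otimes> (k \<otimes> (c \<otimes> a))) = k \<otimes> (c \<otimes> a)" using k a c KG by (simp flip: m_assoc)
    then show ?thesis using k a c KG by (simp add: m_assoc)
  qed
  have "(inv c \<otimes> k \<otimes> c) \<otimes> a \<in> K #> a" using 1 by (auto simp: r_coset_def)
  then show "z \<in> (\<lambda>s. c \<otimes> s) ` (K #> a)" using 2 by blast
qed

end

section \<open>Lattice nets\<close>

locale lattice_system = subshift_system G \<Sigma> X for G :: "('g, 'm) monoid_scheme" (structure)
    and \<Sigma> :: "'a set" and X :: "('g \<Rightarrow> 'a) set" +
  fixes \<I> :: "'g set set"
  assumes net: "lattice_net G \<I>"
begin

lemma net_index: "H \<in> \<I> \<Longrightarrow> finite_index_subgroup H G"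
  and net_directed: "H \<in> \<I> \<Longrightarrow> K \<in> \<I> \<Longrightarrow> \<exists>L\<in>\<I>. L \<subseteq> H \<inter> K"
  and net_normal: "H \<in> \<I> \<Longrightarrow> \<exists>K\<in>\<I>. K \<subseteq> H \<and> K \<lhd> G"
  and net_trivial: "finite F \<Longrightarrow> F \<subseteq> carrier G - {\<one>} \<Longrightarrow> \<exists>H0\<in>\<I>. \<forall>H\<in>\<I>. H \<subseteq> H0 \<longrightarrow> H \<inter> F = {}"
proof -
  have n: "\<forall>H\<in>\<I>. finite_index_subgroup H G" "\<forall>H\<in>\<I>. \<forall>K\<in>\<I>. \<exists>L\<in>\<I>. L \<subseteq> H \<inter> K"
    "\<forall>F. finite F \<and> F \<subseteq> carrier G - {\<one>} \<longrightarrow> (\<exists>H0\<in>\<I>. \<forall>H\<in>\<I>. H \<subseteq> H0 \<longrightarrow> H \<inter> F = {})"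
    "\<forall>H\<in>\<I>. \<exists>K\<in>\<I>. K \<subseteq> H \<and> K \<lhd> G"
    using net unfolding lattice_net_def by simp_all
  show "finite_index_subgroup H G" if "H \<in> \<I>" using n(1) that by simp
  show "\<exists>L\<in>\<I>. L \<subseteq> H \<inter> K" if "H \<in> \<I>" "K \<in> \<I>" using n(2) that by simp
  show "\<exists>K\<in>\<I>. K \<subseteq> H \<and> K \<lhd> G" if "H \<in> \<I>" using n(4) that by simp
  show "\<exists>H0\<in>\<I>. \<forall>H\<in>\<I>. H \<subseteq> H0 \<longrightarrow> H \<inter> F = {}" if "finite F" "F \<subseteq> carrier G - {\<one>}"
    using n(3)[THEN spec, THEN mp, OF conjI[OF that]] .
qed

lemma net_subgroup: "H \<in> \<I> \<Longrightarrow> subgroup H G"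
  using net_index by (auto simp: finite_index_subgroup_def)

lemma net_subset: "H \<in> \<I> \<Longrightarrow> H \<subseteq> carrier G"
  using net_subgroup subgroup.subset by blast

text \<open>A property of all sufficiently small normal members of the net.\<close>

definition for_small :: "('g set \<Rightarrow> bool) \<Rightarrow> bool" where
  "for_small P \<longleftrightarrow> (\<exists>H0\<in>\<I>. \<forall>K\<in>\<I>. K \<subseteq> H0 \<longrightarrow> K \<lhd> G \<longrightarrow> P K)"

lemma for_small_mono: "for_small P \<Longrightarrow> (\<And>K. K \<in> \<I> \<Longrightarrow> K \<lhd> G \<Longrightarrow> P K \<Longrightarrow> Q K) \<Longrightarrow> for_small Q"
  unfolding for_small_def by blast

lemma for_small_conj:
  assumes "for_small P" "for_small Q"
  shows "for_small (\<lambda>K. P K \<and> Q K)"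
proof -
  obtain H1 where H1: "H1 \<in> \<I>" "\<forall>K\<in>\<I>. K \<subseteq> H1 \<longrightarrow> K \<lhd> G \<longrightarrow> P K" using assms(1) for_small_def by auto
  obtain H2 where H2: "H2 \<in> \<I>" "\<forall>K\<in>\<I>. K \<subseteq> H2 \<longrightarrow> K \<lhd> G \<longrightarrow> Q K" using assms(2) for_small_def by auto
  obtain H3 where "H3 \<in> \<I>" "H3 \<subseteq> H1 \<inter> H2" using net_directed H1 H2 by blast
  then show ?thesis using H1 H2 unfolding for_small_def by (intro bexI[of _ H3]) auto
qed

lemma for_small_below: "H \<in> \<I> \<Longrightarrow> for_small (\<lambda>K. K \<subseteq> H)"
  unfolding for_small_def by blast

lemma for_small_True: "for_small (\<lambda>K. True)"
  using net_trivial[of "{}"] unfolding for_small_def by blast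

lemma for_small_ball:
  assumes "finite R" "\<And>r. r \<in> R \<Longrightarrow> for_small (P r)"
  shows "for_small (\<lambda>K. \<forall>r\<in>R. P r K)"
  using assms
proof (induction R rule: finite_induct)
  case empty
  then show ?case using for_small_True by simp
next
  case (insert r R)
  then have "for_small (\<lambda>K. P r K \<and> (\<forall>r\<in>R. P r K))" by (intro for_small_conj) auto
  then show ?case by simp
qed

lemma for_smallE:
  assumes "for_small P"
  obtains K where "K \<in> \<I>" "K \<lhd> G" "P K"
proof -
  obtain H0 where H0: "H0 \<in> \<I>" "\<forall>K\<in>\<I>. K \<subseteq> H0 \<longrightarrow> K \<lhd> G \<longrightarrow> P K" using assms for_small_def by auto
  obtain K where "K \<in> \<I>" "K \<subseteq> H0" "K \<lhd> G" using net_normal[OF H0(1)] by blast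
  then show thesis using that H0 by blast
qed

lemma spread_mono: "spread S M \<Longrightarrow> N \<subseteq> M \<Longrightarrow> spread S N"
  unfolding spread_def r_coset_def by blast

text \<open>
  Two translates of \<open>N\<close> by elements of one right coset of \<open>K\<close> overlap only if \<open>K\<close> contains one of
  the finitely many nontrivial quotients of elements of \<open>N\<close>; the coset does not matter.
\<close>

lemma spread_small:
  assumes N: "finite N" "N \<subseteq> carrier G"
  shows "for_small (\<lambda>K. \<forall>a\<in>carrier G. spread (K #> a) N)"
proof -
  let ?F = "(\<lambda>(m, n). inv m \<otimes> n) ` (N \<times> N) - {\<one>}"
  have "finite ?F" "?F \<subseteq> carrier G - {\<one>}" using N by (auto simp: subset_iff)
  then obtain H0 where H0: "H0 \<in> \<I>" "\<forall>H\<in>\<I>. H \<subseteq> H0 \<longrightarrow> H \<inter> ?F = {}" using net_trivial by meson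
  have "spread (K #> a) N" if K: "K \<in> \<I>" "K \<subseteq> H0" and a: "a \<in> carrier G" for K a
    unfolding spread_def
  proof (intro conjI ballI impI)
    note KG = net_subset[OF K(1)]
    show "K #> a \<subseteq> carrier G" using r_coset_subset_G[OF KG a] .
    fix s t assume st: "s \<in> K #> a" "t \<in> K #> a" "s \<noteq> t"
    show "(N #> s) \<inter> (N #> t) = {}"
    proof (rule ccontr)
      assume "(N #> s) \<inter> (N #> t) \<noteq> {}"
      then obtain m n where mn: "m \<in> N" "n \<in> N" "m \<otimes> s = n \<otimes> t" by (auto simp: r_coset_def)
      obtain k l where kl: "k \<in> K" "l \<in> K" "s = k \<otimes> a" "t = l \<otimes> a" using st by (auto simp: r_coset_def)
      have c: "m \<in> carrier G" "n \<in> carrier G" "k \<in> carrier G" "l \<in> carrier G"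
        using mn kl N KG by auto
      have "(m \<otimes> k) \<otimes> a = (n \<otimes> l) \<otimes> a" using mn kl a c by (simp add: m_assoc)
      then have e: "m \<otimes> k = n \<otimes> l" using a c by simp
      have "inv n \<otimes> m = inv n \<otimes> (m \<otimes> k) \<otimes> inv k" using c by (simp add: m_assoc)
      also have "\<dots> = l \<otimes> inv k" unfolding e using c by (simp flip: m_assoc)
      finally have eq: "inv n \<otimes> m = l \<otimes> inv k" .
      have "l \<otimes> inv k \<in> K"
        using kl subgroup.m_closed subgroup.m_inv_closed net_subgroup[OF K(1)] by metis
      then have "inv n \<otimes> m \<in> K" by (simp add: eq)
      moreover have "inv n \<otimes> m \<in> (\<lambda>(m, n). inv m \<otimes> n) ` (N \<times> N)" using mn by force
      ultimately have "inv n \<otimes> m = \<one>" using H0(2) K by blast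
      then have "l \<otimes> inv k = \<one>" using eq by simp
      then have "l = k" using c by (metis inv_equality inv_inv inv_closed)
      then show False using kl st by simp
    qed
  qed
  then show ?thesis unfolding for_small_def using H0(1) by blast
qed

lemma coset_subset: "H \<in> \<I> \<Longrightarrow> g \<in> carrier G \<Longrightarrow> H #> g \<subseteq> carrier G"
  using r_coset_subset_G net_subset by blast

lemma subcoset:
  assumes H: "H \<in> \<I>" and K: "K \<in> \<I>" "K \<subseteq> H" and g: "g \<in> carrier G" and a: "a \<in> H #> g"
  shows "K #> a \<subseteq> H #> g"
proof
  fix z assume "z \<in> K #> a"
  then obtain k h where "k \<in> K" "h \<in> H" "z = k \<otimes> (h \<otimes> g)" using a by (auto simp: r_coset_def)
  moreover have "k \<otimes> (h \<otimes> g) = (k \<otimes> h) \<otimes> g"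
    using calculation net_subset[OF K(1)] net_subset[OF H] g by (auto simp: m_assoc subset_iff)
  moreover have "k \<otimes> h \<in> H" using calculation K(2) subgroup.m_closed[OF net_subgroup[OF H]] by auto
  ultimately show "z \<in> H #> g" by (auto simp: r_coset_def)
qed

text \<open>
  A coset of \<open>H\<close> is a finite disjoint union of cosets of \<open>K\<close>, and the lattice splits accordingly.
\<close>

lemma lat_split:
  assumes N: "acts_on N \<phi>" and H: "H \<in> \<I>" and g: "g \<in> carrier G"
    and c: "B.commuting (cj \<phi>) (H #> g)" and K: "K \<in> \<I>" "K \<subseteq> H" and Q: "subgroup Q B"
    and mem: "\<And>a. a \<in> H #> g \<Longrightarrow> lat (K #> a) \<phi> \<in> Q"
  shows "lat (H #> g) \<phi> \<in> Q"
proof -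
  note KG = net_subset[OF K(1)] and Ks = net_subgroup[OF K(1)]
  have HgG: "H #> g \<subseteq> carrier G" using r_coset_subset_G[OF net_subset[OF H] g] .
  let ?C = "(\<lambda>a. K #> a) ` (H #> g)"
  have Crc: "?C \<subseteq> rcosets K" using HgG by (auto simp: RCOSETS_def)
  have finC: "finite ?C"
    using Crc net_index[OF K(1)] finite_subset by (auto simp: finite_index_subgroup_def)
  note sub = subcoset[OF H K g]
  have UC: "\<Union>?C = H #> g"
  proof
    show "\<Union>?C \<subseteq> H #> g" using sub by blast
    show "H #> g \<subseteq> \<Union>?C"
    proof
      fix z assume z: "z \<in> H #> g"
      then have "z \<in> K #> z" using rcos_self[OF _ Ks] HgG by blast
      then show "z \<in> \<Union>?C" using z by blast
    qed
  qed
  have "lat (\<Union>D) \<phi> \<in> Q" if "finite D" "D \<subseteq> ?C" for D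
    using that
  proof (induction D rule: finite_induct)
    case empty
    then show ?case using subgroup.one_closed[OF Q] by (simp add: lat_empty)
  next
    case (insert E D)
    then obtain a where a: "a \<in> H #> g" "E = K #> a" by auto
    have subs: "E \<union> \<Union>D \<subseteq> H #> g" using insert UC by blast
    have disj: "E \<inter> \<Union>D = {}"
    proof -
      have "E \<inter> E' = {}" if "E' \<in> D" for E'
      proof -
        have "E \<in> rcosets K" "E' \<in> rcosets K" using insert.prems that Crc by auto
        moreover have "E \<noteq> E'" using insert.hyps(2) that by auto
        ultimately show ?thesis using rcos_disjoint[OF Ks] by (simp add: pairwise_def disjnt_def)
      qed
      then show ?thesis by blast
    qed
    have "lat (E \<union> \<Union>D) \<phi> = lat E \<phi> \<star> lat (\<Union>D) \<phi>"
      by (rule lat_Un[OF N _ disj B.commuting_subset[OF c subs]]) (use subs HgG in auto)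
    moreover have "lat E \<phi> \<in> Q" using mem a by simp
    ultimately show ?case using insert subgroup.m_closed[OF Q] by auto
  qed
  from this[OF finC order_refl] show ?thesis using UC by simp
qed

abbreviation "lattices \<equiv> gate_lattices G \<Sigma> X \<I>"
abbreviation "elattices \<equiv> even_gate_lattices G \<Sigma> X \<I>"
abbreviation "LL \<equiv> gate_lattice_group G \<Sigma> X \<I>"
abbreviation "LE \<equiv> even_gate_lattice_group G \<Sigma> X \<I>"
abbreviation "SA \<equiv> SAut G \<Sigma> X \<I>"

lemma gate_product_coset:
  assumes "acts_on N \<phi>" "H \<in> \<I>" "g \<in> carrier G"
  shows "conjs_commute G X \<phi> (H #> g) \<and> is_gate_product G \<Sigma> X \<phi> (H #> g) f \<longleftrightarrow>
    B.commuting (cj \<phi>) (H #> g) \<and> f = lat (H #> g) \<phi>"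
  using conjs_commute_iff[OF acts_onD(3)[OF assms(1)] coset_subset[OF assms(2,3)]]
    is_gate_product_iff[OF assms(1) coset_subset[OF assms(2,3)]] by blast

lemma latticesI:
  assumes "acts_on N \<phi>" "H \<in> \<I>" "g \<in> carrier G" "B.commuting (cj \<phi>) (H #> g)"
  shows "lat (H #> g) \<phi> \<in> lattices"
proof -
  have "gate G \<Sigma> X \<phi>" using gate_iff assms(1) by auto
  then show ?thesis using gate_product_coset[OF assms(1-3)] assms unfolding gate_lattices_def by blast
qed

lemma latticesE:
  assumes "f \<in> lattices"
  obtains N \<phi> H g where "acts_on N \<phi>" "H \<in> \<I>" "g \<in> carrier G" "B.commuting (cj \<phi>) (H #> g)"
    "f = lat (H #> g) \<phi>"
proof -
  obtain \<phi> H g where *: "gate G \<Sigma> X \<phi>" "H \<in> \<I>" "g \<in> carrier G"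
    "conjs_commute G X \<phi> (H #> g)" "is_gate_product G \<Sigma> X \<phi> (H #> g) f"
    using assms unfolding gate_lattices_def by blast
  obtain N where N: "acts_on N \<phi>" using *(1) gate_iff by auto
  then show thesis using that[OF N *(2,3)] gate_product_coset[OF N *(2,3)] *(4,5) by blast
qed

lemma elatticesI:
  assumes "even_off N \<phi>" "H \<in> \<I>" "g \<in> carrier G" "B.commuting (cj \<phi>) (H #> g)"
  shows "lat (H #> g) \<phi> \<in> elattices"
proof -
  obtain M where M: "acts_on M \<phi>" using even_off_acts_on[OF assms(1)] by metis
  have "even_gate G \<Sigma> X \<phi>" using even_gate_iff assms(1) by auto
  then show ?thesis using gate_product_coset[OF M assms(2,3)] assms unfolding even_gate_lattices_def by blast
qed

lemma elatticesE:
  assumes "f \<in> elattices"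
  obtains N \<phi> H g where "even_off N \<phi>" "acts_on N \<phi>" "H \<in> \<I>" "g \<in> carrier G"
    "B.commuting (cj \<phi>) (H #> g)" "f = lat (H #> g) \<phi>"
proof -
  obtain \<phi> H g where *: "even_gate G \<Sigma> X \<phi>" "H \<in> \<I>" "g \<in> carrier G"
    "conjs_commute G X \<phi> (H #> g)" "is_gate_product G \<Sigma> X \<phi> (H #> g) f"
    using assms unfolding even_gate_lattices_def by blast
  obtain N0 where N0: "even_off N0 \<phi>" using *(1) even_gate_iff by auto
  obtain N where N: "acts_on N \<phi>" "even_off N \<phi>" using even_off_acts_on[OF N0] by metis
  then show thesis using that[OF N(2,1) *(2,3)] gate_product_coset[OF N(1) *(2,3)] *(4,5) by blast
qed

lemma elattices_subset: "elattices \<subseteq> lattices"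
proof
  fix f assume "f \<in> elattices"
  then obtain N \<phi> H g where "acts_on N \<phi>" "H \<in> \<I>" "g \<in> carrier G"
    "B.commuting (cj \<phi>) (H #> g)" "f = lat (H #> g) \<phi>" by (rule elatticesE)
  then show "f \<in> lattices" using latticesI by simp
qed

lemma lattices_homeos: "lattices \<subseteq> homeos"
proof
  fix f assume "f \<in> lattices"
  then obtain N \<phi> H g where *: "acts_on N \<phi>" "H \<in> \<I>" "g \<in> carrier G"
    "B.commuting (cj \<phi>) (H #> g)" "f = lat (H #> g) \<phi>" by (rule latticesE)
  then show "f \<in> homeos" using lat_homeo[OF *(1) coset_subset[OF *(2,3)] *(4)] by simp
qed

lemma homeos_subset: "homeos \<subseteq> carrier B"
  by (auto simp: homeos_def)

lemma subgroup_LL: "subgroup LL B" and subgroup_LE: "subgroup LE B"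
  unfolding gate_lattice_group_def even_gate_lattice_group_def
  using B.generate_is_subgroup elattices_subset lattices_homeos homeos_subset by blast+

lemma LE_subset_LL: "LE \<subseteq> LL"
  unfolding gate_lattice_group_def even_gate_lattice_group_def
  by (rule B.mono_generate[OF elattices_subset])

section \<open>Normality in the stabilized automorphism group\<close>

lemma subgroup_Aut:
  assumes "H \<subseteq> carrier G"
  shows "subgroup (Aut_subshift G \<Sigma> X H) B"
proof (rule B.subgroupI)
  let ?A = "Aut_subshift G \<Sigma> X H"
  note iff = Aut_iff[OF assms]
  show "?A \<subseteq> carrier B" using iff homeos_subset by auto
  have "\<one>\<^bsub>B\<^esub> \<in> ?A" using iff subgroup.one_closed[OF subgroup_homeos] assms sh_B by auto
  then show "?A \<noteq> {}" by blast
  fix a assume "a \<in> ?A"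
  then have a: "a \<in> homeos" "a \<in> carrier B" "\<And>h. h \<in> H \<Longrightarrow> a \<star> sh h = sh h \<star> a"
    using iff homeos_subset by auto
  have "binv a \<star> sh h = sh h \<star> binv a" if h: "h \<in> H" for h
  proof -
    have s: "sh h \<in> carrier B" using h assms sh_B by auto
    have "binv a \<star> sh h = binv a \<star> (sh h \<star> a) \<star> binv a" using a s by (simp add: B.m_assoc)
    also have "\<dots> = sh h \<star> binv a" using a(2) s by (simp flip: a(3)[OF h]) (simp flip: B.m_assoc)
    finally show ?thesis .
  qed
  then show "binv a \<in> ?A" using iff subgroup.m_inv_closed[OF subgroup_homeos a(1)] by auto
  fix b assume "b \<in> ?A"
  then have b: "b \<in> homeos" "b \<in> carrier B" "\<And>h. h \<in> H \<Longrightarrow> b \<star> sh h = sh h \<star> b"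
    using iff homeos_subset by auto
  have "(a \<star> b) \<star> sh h = sh h \<star> (a \<star> b)" if h: "h \<in> H" for h
  proof -
    have s: "sh h \<in> carrier B" using h assms sh_B by auto
    have "(a \<star> b) \<star> sh h = a \<star> (b \<star> sh h)" using a(2) b(2) s by (simp add: B.m_assoc)
    also have "\<dots> = (a \<star> sh h) \<star> b" unfolding b(3)[OF h] using a(2) b(2) s by (simp add: B.m_assoc)
    also have "\<dots> = sh h \<star> (a \<star> b)" unfolding a(3)[OF h] using a(2) b(2) s by (simp add: B.m_assoc)
    finally show ?thesis .
  qed
  then show "a \<star> b \<in> ?A" using iff subgroup.m_closed[OF subgroup_homeos a(1) b(1)] by auto
qed

lemma Aut_antimono: "K \<subseteq> H \<Longrightarrow> Aut_subshift G \<Sigma> X H \<subseteq> Aut_subshift G \<Sigma> X K"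
  by (auto simp: Aut_subshift_def)

lemma SA_E:
  assumes "f \<in> SA"
  obtains H where "H \<in> \<I>" "H \<lhd> G" "f \<in> Aut_subshift G \<Sigma> X H"
proof -
  obtain H where "H \<in> \<I>" "f \<in> Aut_subshift G \<Sigma> X H" using assms by (auto simp: SAut_def)
  then show thesis using that net_normal Aut_antimono by blast
qed

lemma subgroup_SA: "subgroup SA B"
proof (rule B.subgroupI)
  have A: "subgroup (Aut_subshift G \<Sigma> X H) B" if "H \<in> \<I>" for H using subgroup_Aut net_subset that by blast
  show "SA \<subseteq> carrier B" using A subgroup.subset by (fastforce simp: SAut_def)
  obtain H where "H \<in> \<I>" using for_smallE[OF for_small_True] by metis
  then show "SA \<noteq> {}" using subgroup.one_closed[OF A] by (auto simp: SAut_def)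
  fix a assume "a \<in> SA"
  then obtain H where H: "H \<in> \<I>" "a \<in> Aut_subshift G \<Sigma> X H" by (auto simp: SAut_def)
  then show "binv a \<in> SA" using subgroup.m_inv_closed[OF A] by (auto simp: SAut_def)
  fix b assume "b \<in> SA"
  then obtain K where K: "K \<in> \<I>" "b \<in> Aut_subshift G \<Sigma> X K" by (auto simp: SAut_def)
  obtain M where M: "M \<in> \<I>" "M \<subseteq> H \<inter> K" using net_directed H K by blast
  then have "a \<star> b \<in> Aut_subshift G \<Sigma> X M"
    using subgroup.m_closed[OF A[OF M(1)]] Aut_antimono[of M H] Aut_antimono[of M K] H K by blast
  then show "a \<star> b \<in> SA" using M by (auto simp: SAut_def)
qed

text \<open>
  As a coset of \<open>H\<close> is invariant under right translation by a suitable smaller member of the net,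
  this makes gate lattices commute with the shifts by that member.
\<close>

lemma lat_shift:
  assumes N: "acts_on N \<phi>" and S: "S \<subseteq> carrier G" and c: "B.commuting (cj \<phi>) S" and h: "h \<in> carrier G"
  shows "lat ((\<lambda>s. s \<otimes> h) ` S) \<phi> = cj (lat S \<phi>) h"
proof (rule lat_eqI)
  let ?T = "(\<lambda>s. s \<otimes> h) ` S" and ?i = "\<lambda>t. t \<otimes> inv h"
  have \<phi>: "\<phi> \<in> carrier B" using acts_onD(3)[OF N] .
  note L = lat_in_B[OF N S c]
  have s: "sh h \<in> carrier B" "windowed (binv (sh h))" "windowed (sh h)"
    using sh_homeo[OF h] by (auto simp: homeos_def)
  show "cj (lat S \<phi>) h \<in> carrier B" using L h by simp
  have iT: "?i ` ?T = S" using S h by (force simp: m_assoc subset_iff image_iff)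
  have 1: "ulim S (\<lambda>F. binv (sh h) \<star> pprod \<phi> F) (\<lambda>x. binv (sh h) (lat S \<phi> x))"
    by (rule ulim_mult[OF ulim_const lat_ulim[OF N S c]]) (use L s pprod_in_B[OF c] B_in_X in auto)
  have "ulim S (\<lambda>F. (binv (sh h) \<star> pprod \<phi> F) \<star> sh h) (\<lambda>x. binv (sh h) (lat S \<phi> (sh h x)))"
  proof (rule ulim_mult[OF 1 ulim_const])
    show "windowed (\<lambda>x. binv (sh h) (lat S \<phi> x))"
      by (rule windowed_comp[OF s(2) L(2)]) (use L B_in_X in auto)
  qed (use s pprod_in_B[OF c] B_in_X in auto)
  then have "ulim (?i ` ?T) (\<lambda>F. cj (pprod \<phi> F) h) (cj (lat S \<phi>) h)"
    unfolding iT
    by (rule ulim_cong) (use L s h pprod_in_B[OF c] B_in_X in \<open>auto simp: cj_eq B_apply\<close>)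
  then have "ulim ?T (\<lambda>F. cj (pprod \<phi> (?i ` F)) h) (cj (lat S \<phi>) h)"
    by (rule ulim_reindex)
  then show "ulim ?T (pprod \<phi>) (cj (lat S \<phi>) h)"
  proof (rule ulim_cong)
    fix F x assume F: "finite F" "F \<subseteq> ?T"
    have iF: "?i ` F \<subseteq> S" "finite (?i ` F)" using F iT by auto
    have inj: "inj_on ?i ?T" using S h by (auto simp: inj_on_def subset_iff m_assoc)
    have cc: "B.commuting (\<lambda>s. binv (sh h) \<star> cj \<phi> s \<star> binv (binv (sh h))) S"
      by (rule B.commuting_conj[OF c]) (use s in simp)
    have cje: "binv (sh h) \<star> cj \<phi> s \<star> binv (binv (sh h)) = cj \<phi> (s \<otimes> h)" if "s \<in> S" for s
      using that S s h \<phi> by (auto simp: cj_cj[symmetric] cj_eq[of "cj \<phi> s" h])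
    have "cj (pprod \<phi> (?i ` F)) h = binv (sh h) \<star> finprod B (cj \<phi>) (?i ` F) \<star> binv (binv (sh h))"
      using s h pprod_in_B[OF c iF(2,1)] by (simp add: cj_eq pprod_def)
    also have "\<dots> = finprod B (\<lambda>s. binv (sh h) \<star> cj \<phi> s \<star> binv (binv (sh h))) (?i ` F)"
      by (rule B.cfinprod_conj[OF c _ iF(2,1), symmetric]) (use s in simp)
    also have "\<dots> = finprod B (\<lambda>t. binv (sh h) \<star> cj \<phi> (?i t) \<star> binv (binv (sh h))) F"
      by (rule B.cfinprod_reindex[of _ ?i ?T]) (use cc iT inj F in auto)
    also have "\<dots> = pprod \<phi> F"
      unfolding pprod_def
    proof (rule B.cfinprod_cong[of _ ?T, OF _ F])
      have "B.commuting (\<lambda>s. cj \<phi> (s \<otimes> h)) S" using cc cje by (simp add: B.commuting_def)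
      then show "B.commuting (cj \<phi>) ?T" by (simp add: B.commuting_def)
      show "binv (sh h) \<star> cj \<phi> (?i t) \<star> binv (binv (sh h)) = cj \<phi> t" if "t \<in> ?T" for t
      proof -
        have "?i t \<in> S" "?i t \<otimes> h = t" using that iT S h by (auto simp: m_assoc subset_iff)
        then show ?thesis using cje by metis
      qed
    qed
    finally show "pprod \<phi> F x = cj (pprod \<phi> (?i ` F)) h x" by simp
  qed simp
qed

lemma lattices_SA: "lattices \<subseteq> SA"
proof
  fix f assume "f \<in> lattices"
  then obtain N \<phi> H g where *: "acts_on N \<phi>" "H \<in> \<I>" "g \<in> carrier G"
    "B.commuting (cj \<phi>) (H #> g)" "f = lat (H #> g) \<phi>" by (rule latticesE)
  note S = coset_subset[OF *(2,3)]
  note L = lat_in_B[OF *(1) S *(4)]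
  obtain K where K: "K \<in> \<I>" "K \<subseteq> H" "K \<lhd> G" using net_normal *(2) by blast
  note KG = net_subset[OF K(1)] and HG = net_subset[OF *(2)]
  have "f \<star> sh k = sh k \<star> f" if k: "k \<in> K" for k
  proof -
    have kG: "k \<in> carrier G" using k KG by auto
    have into: "(\<lambda>s. s \<otimes> k) ` (H #> g) \<subseteq> H #> g" if k: "k \<in> K" for k
    proof (rule image_subsetI)
      fix s assume "s \<in> H #> g"
      then obtain h where h: "h \<in> H" "s = h \<otimes> g" by (auto simp: r_coset_def)
      have kG: "k \<in> carrier G" "h \<in> carrier G" using k h KG HG by auto
      have "g \<otimes> k \<otimes> inv g \<in> K" using K(3) k *(3) normal_inv_iff by blast
      then have "h \<otimes> (g \<otimes> k \<otimes> inv g) \<in> H"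
        using h K(2) subgroup.m_closed[OF net_subgroup[OF *(2)]] by blast
      moreover have "s \<otimes> k = (h \<otimes> (g \<otimes> k \<otimes> inv g)) \<otimes> g" using h kG *(3) by (simp add: m_assoc)
      ultimately show "s \<otimes> k \<in> H #> g" unfolding r_coset_def by blast
    qed
    have "H #> g \<subseteq> (\<lambda>s. s \<otimes> k) ` (H #> g)"
    proof
      fix s assume s: "s \<in> H #> g"
      have "s \<otimes> inv k \<in> H #> g"
        using into[of "inv k"] s k subgroup.m_inv_closed[OF net_subgroup[OF K(1)]] by auto
      moreover have "s = (s \<otimes> inv k) \<otimes> k" using s S kG by (auto simp: m_assoc subset_iff)
      ultimately show "s \<in> (\<lambda>s. s \<otimes> k) ` (H #> g)" by blast
    qed
    then have "(\<lambda>s. s \<otimes> k) ` (H #> g) = H #> g" using into[OF k] by auto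
    then have "cj f k = f" using lat_shift[OF *(1) S *(4) kG] *(5) by simp
    then have "sh k \<star> (binv (sh k) \<star> f \<star> sh k) = sh k \<star> f" using L *(5) kG by (simp add: cj_eq)
    then show ?thesis using L *(5) kG sh_B by (simp flip: B.m_assoc)
  qed
  moreover have "f \<in> homeos" using lat_homeo[OF *(1) S *(4)] *(5) by simp
  ultimately have "f \<in> Aut_subshift G \<Sigma> X K" using Aut_iff[OF KG] by blast
  then show "f \<in> SA" using K(1) by (auto simp: SAut_def)
qed

lemma LL_subset_SA: "LL \<subseteq> SA"
  unfolding gate_lattice_group_def by (rule B.generate_subgroup_incl[OF lattices_SA subgroup_SA])

text \<open>
  As \<open>K\<close> is normal, \<open>K #> a\<close> is also a left coset, so that the lattice of \<open>\<phi>\<close> along it is the lattice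
  of \<open>cj \<phi> a\<close> along \<open>K\<close> itself, to which \<open>lat_conj\<close> applies.
\<close>

lemma conj_lattice:
  assumes f: "f \<in> Aut_subshift G \<Sigma> X K" and K: "K \<in> \<I>" "K \<lhd> G"
    and N: "acts_on N \<phi>" and a: "a \<in> carrier G" and c: "B.commuting (cj \<phi>) (K #> a)"
  shows "f \<star> lat (K #> a) \<phi> \<star> binv f = lat (K #> \<one>) (f \<star> cj \<phi> a \<star> binv f)"
    and "B.commuting (cj (f \<star> cj \<phi> a \<star> binv f)) (K #> \<one>)"
proof -
  note KG = net_subset[OF K(1)]
  have K1: "K #> \<one> = K" using KG by simp
  have fh: "f \<in> homeos" "\<And>s. s \<in> K \<Longrightarrow> f \<star> sh s = sh s \<star> f" using f Aut_iff[OF KG] by auto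
  have im: "(\<lambda>s. a \<otimes> s) ` K = K #> a"
    using normal_translate_coset[OF K(2) one_closed a] a K1 by simp
  have c': "B.commuting (cj \<phi>) ((\<lambda>s. a \<otimes> s) ` K)" using c im by simp
  note t = lat_translate[OF N a KG c', unfolded im]
  note lc = lat_conj[OF fh acts_on_cj[OF N a] KG t(2)]
  show "f \<star> lat (K #> a) \<phi> \<star> binv f = lat (K #> \<one>) (f \<star> cj \<phi> a \<star> binv f)"
    using lc(1) t(1) K1 by simp
  show "B.commuting (cj (f \<star> cj \<phi> a \<star> binv f)) (K #> \<one>)" using lc(2) K1 by simp
qed

text \<open>
  To conjugate a lattice along a coset of \<open>H\<close>, it is split into lattices along cosets of a normal \<open>K\<close>
  for which \<open>f\<close> commutes with the shifts by \<open>K\<close>.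
\<close>

lemma conj_generate:
  assumes f: "f \<in> SA"
    and T: "\<And>l. l \<in> T \<Longrightarrow> \<exists>N \<phi> H g. acts_on N \<phi> \<and> H \<in> \<I> \<and> g \<in> carrier G \<and>
      B.commuting (cj \<phi>) (H #> g) \<and> l = lat (H #> g) \<phi> \<and> R \<phi>"
    and step: "\<And>\<phi> K a. R \<phi> \<Longrightarrow> K \<in> \<I> \<Longrightarrow> a \<in> carrier G \<Longrightarrow>
      B.commuting (cj (f \<star> cj \<phi> a \<star> binv f)) (K #> \<one>) \<Longrightarrow> lat (K #> \<one>) (f \<star> cj \<phi> a \<star> binv f) \<in> T"
    and s: "s \<in> generate B T"
  shows "f \<star> s \<star> binv f \<in> generate B T"
proof -
  obtain H' where H': "H' \<in> \<I>" "f \<in> Aut_subshift G \<Sigma> X H'" using f by (auto simp: SAut_def)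
  have fB: "f \<in> carrier B" using subgroup.mem_carrier[OF subgroup_SA f] .
  have TB: "T \<subseteq> carrier B"
  proof
    fix l assume "l \<in> T"
    then obtain N \<phi> H g where "acts_on N \<phi>" "H \<in> \<I>" "g \<in> carrier G" "B.commuting (cj \<phi>) (H #> g)"
      "l = lat (H #> g) \<phi>" using T by blast
    then show "l \<in> carrier B" using lat_in_B(1) coset_subset by blast
  qed
  let ?Q = "{q \<in> carrier B. f \<star> q \<star> binv f \<in> generate B T}"
  have Q: "subgroup ?Q B" by (rule B.subgroup_conj_vimage[OF B.generate_is_subgroup[OF TB] fB])
  have "T \<subseteq> ?Q"
  proof
    fix l assume "l \<in> T"
    then obtain N \<phi> H g where *: "acts_on N \<phi>" "H \<in> \<I>" "g \<in> carrier G"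
      "B.commuting (cj \<phi>) (H #> g)" and l: "l = lat (H #> g) \<phi>" "R \<phi>" using T by blast
    obtain K where K: "K \<in> \<I>" "K \<lhd> G" "K \<subseteq> H" "K \<subseteq> H'"
      using for_smallE[OF for_small_conj[OF for_small_below[OF *(2)] for_small_below[OF H'(1)]]] by metis
    have fK: "f \<in> Aut_subshift G \<Sigma> X K" using Aut_antimono[OF K(4)] H'(2) by blast
    have "lat (H #> g) \<phi> \<in> ?Q"
    proof (rule lat_split[OF * K(1,3) Q])
      fix a assume a: "a \<in> H #> g"
      then have aG: "a \<in> carrier G" using coset_subset[OF *(2,3)] by auto
      have c: "B.commuting (cj \<phi>) (K #> a)"
        by (rule B.commuting_subset[OF *(4) subcoset[OF *(2) K(1,3) *(3) a]])
      note cl = conj_lattice[OF fK K(1,2) *(1) aG c]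
      have "lat (K #> a) \<phi> \<in> carrier B" using lat_in_B[OF *(1) coset_subset[OF K(1) aG] c] by simp
      moreover have "f \<star> lat (K #> a) \<phi> \<star> binv f \<in> generate B T"
        unfolding cl(1) by (rule generate.incl[OF step[OF l(2) K(1) aG cl(2)]])
      ultimately show "lat (K #> a) \<phi> \<in> ?Q" by simp
    qed
    then show "l \<in> ?Q" using l by simp
  qed
  then show ?thesis using B.generate_subgroup_incl[OF _ Q] s by blast
qed

lemma
  assumes f: "f \<in> SA"
  shows conj_LL: "s \<in> LL \<Longrightarrow> f \<star> s \<star> binv f \<in> LL"
    and conj_LE: "s \<in> LE \<Longrightarrow> f \<star> s \<star> binv f \<in> LE"
proof -
  obtain H where H: "H \<in> \<I>" "f \<in> Aut_subshift G \<Sigma> X H" using f by (auto simp: SAut_def)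
  have fh: "f \<in> homeos" using H(2) by (auto simp: Aut_subshift_def self_homeo_eq)
  have fe: "finite_effect f" using Aut_finite_effect[OF net_index[OF H(1)] H(2)] .
  show "f \<star> s \<star> binv f \<in> LL" if "s \<in> LL"
    unfolding gate_lattice_group_def
  proof (rule conj_generate[OF f, where R = "\<lambda>\<phi>. \<exists>N. acts_on N \<phi>"])
    show "s \<in> generate B lattices" using that by (simp add: gate_lattice_group_def)
    show "\<exists>N \<phi> H g. acts_on N \<phi> \<and> H \<in> \<I> \<and> g \<in> carrier G \<and> B.commuting (cj \<phi>) (H #> g) \<and>
      l = lat (H #> g) \<phi> \<and> (\<exists>N. acts_on N \<phi>)" if "l \<in> lattices" for l
      using latticesE[OF that] by metis
    show "lat (K #> \<one>) (f \<star> cj \<phi> a \<star> binv f) \<in> lattices"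
      if "\<exists>N. acts_on N \<phi>" "K \<in> \<I>" "a \<in> carrier G" "B.commuting (cj (f \<star> cj \<phi> a \<star> binv f)) (K #> \<one>)" for \<phi> K a
      using gate_conjugate[OF fh fe acts_on_cj] latticesI[OF _ that(2) one_closed that(4)] that(1,3) by blast
  qed
  show "f \<star> s \<star> binv f \<in> LE" if "s \<in> LE"
    unfolding even_gate_lattice_group_def
  proof (rule conj_generate[OF f, where R = "\<lambda>\<phi>. \<exists>N. even_off N \<phi>"])
    show "s \<in> generate B elattices" using that by (simp add: even_gate_lattice_group_def)
    show "\<exists>N \<phi> H g. acts_on N \<phi> \<and> H \<in> \<I> \<and> g \<in> carrier G \<and> B.commuting (cj \<phi>) (H #> g) \<and>
      l = lat (H #> g) \<phi> \<and> (\<exists>N. even_off N \<phi>)" if "l \<in> elattices" for l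
      using elatticesE[OF that] by metis
    show "lat (K #> \<one>) (f \<star> cj \<phi> a \<star> binv f) \<in> elattices"
      if "\<exists>N. even_off N \<phi>" "K \<in> \<I>" "a \<in> carrier G" "B.commuting (cj (f \<star> cj \<phi> a \<star> binv f)) (K #> \<one>)" for \<phi> K a
      using even_conjugate[OF fh fe] even_cj[OF _ that(3)] elatticesI[OF _ that(2) one_closed that(4)] that(1)
      by blast
  qed
qed

section \<open>Commutators of gate lattices are even\<close>

text \<open>
  For the gates \<open>\<phi>\<close> along \<open>K #> a\<close> and \<open>\<psi>\<close> along \<open>K #> b\<close>, both acting on \<open>U\<close>, a translate
  \<open>\<psi>\<^sup>c\<close> can be found whose lattice along \<open>K #> a\<close> is that of \<open>\<psi>\<close> along \<open>K #> b\<close>, and such that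
  each of its conjugates meets at most the corresponding conjugate of \<open>\<phi>\<close>: if some conjugates meet
  at all, \<open>c\<close> is chosen to make those two correspond, and then \<open>c\<close> ranges over a finite set that
  does not depend on \<open>a\<close> and \<open>b\<close>, so that one subgroup \<open>K\<close> serves for all \<open>a\<close> and \<open>b\<close>.
\<close>

lemma common_spread:
  assumes U: "finite U" "U \<subseteq> carrier G" and K: "K \<in> \<I>" "K \<lhd> G"
    and a: "a \<in> carrier G" and b: "b \<in> carrier G"
    and sp: "\<And>a. a \<in> carrier G \<Longrightarrow> spread (K #> a) (U \<union> (\<lambda>(u, v, w). u \<otimes> (inv v \<otimes> w)) ` (U \<times> U \<times> U))"
  obtains c where "c \<in> carrier G" "K #> b = K #> (c \<otimes> a)" "spread (K #> a) (U \<union> (U #> c))"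
proof -
  let ?V = "U \<union> (\<lambda>(u, v, w). u \<otimes> (inv v \<otimes> w)) ` (U \<times> U \<times> U)"
  note KG = net_subset[OF K(1)] and Ks = net_subgroup[OF K(1)]
  show thesis
  proof (cases "\<exists>k\<in>K. \<exists>u\<in>U. \<exists>v\<in>U. u \<otimes> a = v \<otimes> (k \<otimes> b)")
    case True
    then obtain k u v where k: "k \<in> K" "u \<in> U" "v \<in> U" "u \<otimes> a = v \<otimes> (k \<otimes> b)" by blast
    have kG: "k \<in> carrier G" "u \<in> carrier G" "v \<in> carrier G" using k KG U by auto
    let ?c = "inv v \<otimes> u"
    have "?c \<otimes> a = inv v \<otimes> (u \<otimes> a)" using kG a by (simp add: m_assoc)
    also have "\<dots> = k \<otimes> b" unfolding k(4) using kG b by (simp flip: m_assoc)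
    finally have ca: "?c \<otimes> a = k \<otimes> b" .
    show thesis
    proof (rule that[of ?c])
      show "?c \<in> carrier G" using kG by simp
      have "K #> (k \<otimes> b) = K #> b"
        using coset_mult_assoc[OF KG kG(1) b] coset_join2[OF kG(1) Ks k(1)] by simp
      then show "K #> b = K #> (?c \<otimes> a)" using ca by simp
      have "U #> ?c \<subseteq> ?V"
      proof
        fix z assume "z \<in> U #> ?c"
        then obtain w where "w \<in> U" "z = (\<lambda>(u, v, w). u \<otimes> (inv v \<otimes> w)) (w, v, u)" by (auto simp: r_coset_def)
        then show "z \<in> ?V" using k by blast
      qed
      then have "U \<union> (U #> ?c) \<subseteq> ?V" by (rule Un_least[OF Un_upper1])
      then show "spread (K #> a) (U \<union> (U #> ?c))" by (rule spread_mono[OF sp[OF a]])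
    qed
  next
    case False
    let ?c = "b \<otimes> inv a"
    have cG: "?c \<in> carrier G" and ca: "?c \<otimes> a = b" using a b by (auto simp: m_assoc)
    have im: "(\<lambda>s. ?c \<otimes> s) ` (K #> a) = K #> b" using normal_translate_coset[OF K(2) a cG] ca by simp
    have spU: "spread (K #> a) U" "spread (K #> b) U" using spread_mono[OF sp] a b by auto
    have Uc: "(U #> ?c) #> s = U #> (?c \<otimes> s)" if "s \<in> carrier G" for s
      using coset_mult_assoc[OF U(2) cG that] .
    have aG: "K #> a \<subseteq> carrier G" using coset_subset[OF K(1) a] .
    have cross: "(U #> s) \<inter> (U #> (?c \<otimes> t)) = {}" if st: "s \<in> K #> a" "t \<in> K #> a" for s t
    proof (rule ccontr)
      assume "(U #> s) \<inter> (U #> (?c \<otimes> t)) \<noteq> {}"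
      then obtain u v where uv: "u \<in> U" "v \<in> U" "u \<otimes> s = v \<otimes> (?c \<otimes> t)" by (auto simp: r_coset_def)
      have "?c \<otimes> t \<in> K #> b" using st im by blast
      moreover have "s \<in> (\<lambda>s. a \<otimes> s) ` K"
        using st normal_translate_coset[OF K(2) one_closed a] a KG by simp
      moreover have "K #> b = (\<lambda>s. b \<otimes> s) ` K"
        using normal_translate_coset[OF K(2) one_closed b] b KG by simp
      ultimately obtain k l where kl: "k \<in> K" "l \<in> K" "s = a \<otimes> k" "?c \<otimes> t = b \<otimes> l" by auto
      have G: "u \<in> carrier G" "v \<in> carrier G" "k \<in> carrier G" "l \<in> carrier G" using uv kl U KG by auto
      have "u \<otimes> a = (u \<otimes> s) \<otimes> inv k" using kl G a by (simp add: m_assoc)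
      also have "\<dots> = v \<otimes> (b \<otimes> (l \<otimes> inv k))" using uv kl G b by (simp add: m_assoc)
      finally have e: "u \<otimes> a = v \<otimes> (b \<otimes> (l \<otimes> inv k))" .
      have "l \<otimes> inv k \<in> K" using kl subgroup.m_closed[OF Ks] subgroup.m_inv_closed[OF Ks] by blast
      then have "b \<otimes> (l \<otimes> inv k) \<in> K #> b" using \<open>K #> b = (\<lambda>s. b \<otimes> s) ` K\<close> by blast
      then obtain m where "m \<in> K" "b \<otimes> (l \<otimes> inv k) = m \<otimes> b" by (auto simp: r_coset_def)
      then show False using False e uv by auto
    qed
    have "spread (K #> a) (U \<union> (U #> ?c))"
      unfolding spread_def
    proof (intro conjI ballI impI)
      show "K #> a \<subseteq> carrier G" by fact
      fix s t assume st: "s \<in> K #> a" "t \<in> K #> a" "s \<noteq> t"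
      have G: "s \<in> carrier G" "t \<in> carrier G" using st aG by auto
      have un: "(U \<union> (U #> ?c)) #> s = (U #> s) \<union> (U #> (?c \<otimes> s))" if "s \<in> carrier G" for s
        using Uc[OF that] unfolding r_coset_def by blast
      have "?c \<otimes> s \<noteq> ?c \<otimes> t" using st G cG by simp
      then have "(U #> (?c \<otimes> s)) \<inter> (U #> (?c \<otimes> t)) = {}"
        using spU(2) st im unfolding spread_def by blast
      moreover have "(U #> s) \<inter> (U #> t) = {}" using spU(1) st unfolding spread_def by blast
      ultimately show "((U \<union> (U #> ?c)) #> s) \<inter> ((U \<union> (U #> ?c)) #> t) = {}"
        unfolding un[OF G(1)] un[OF G(2)] using cross st by blast
    qed
    then show thesis using that[OF cG] ca by simp
  qed
qed

lemma commutator_lattices: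
  assumes l: "l \<in> lattices" and m: "m \<in> lattices"
  shows "m \<in> B.comm_mod LL LE l"
proof -
  note LLB = subgroup.mem_carrier[OF subgroup_LL]
  have normal: "\<And>x q. x \<in> LL \<Longrightarrow> q \<in> LE \<Longrightarrow> x \<star> q \<star> binv x \<in> LE"
    using conj_LE LL_subset_SA by blast
  have C: "subgroup (B.comm_mod LL LE h) B" if "h \<in> carrier B" for h
    by (rule B.subgroup_comm_mod[OF subgroup_LL subgroup_LE normal that])
  obtain N1 \<phi> H g where 1: "acts_on N1 \<phi>" "H \<in> \<I>" "g \<in> carrier G"
    "B.commuting (cj \<phi>) (H #> g)" "l = lat (H #> g) \<phi>" using latticesE[OF l] .
  obtain N2 \<psi> H' g' where 2: "acts_on N2 \<psi>" "H' \<in> \<I>" "g' \<in> carrier G"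
    "B.commuting (cj \<psi>) (H' #> g')" "m = lat (H' #> g') \<psi>" using latticesE[OF m] .
  let ?U = "N1 \<union> N2"
  have U: "finite ?U" "?U \<subseteq> carrier G" using acts_onD(1,2)[OF 1(1)] acts_onD(1,2)[OF 2(1)] by auto
  have fU: "acts_on ?U \<phi>" "acts_on ?U \<psi>"
    by (rule acts_on_mono[OF 1(1)], use U in auto) (rule acts_on_mono[OF 2(1)], use U in auto)
  let ?V = "?U \<union> (\<lambda>(u, v, w). u \<otimes> (inv v \<otimes> w)) ` (?U \<times> ?U \<times> ?U)"
  have V: "finite ?V" "?V \<subseteq> carrier G" using U by (auto simp: subset_iff)
  obtain K where K: "K \<in> \<I>" "K \<lhd> G" "\<forall>a\<in>carrier G. spread (K #> a) ?V" "K \<subseteq> H" "K \<subseteq> H'"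
    using for_smallE[OF for_small_conj[OF spread_small[OF V]
        for_small_conj[OF for_small_below[OF 1(2)] for_small_below[OF 2(2)]]]] by metis
  have core: "lat (K #> b) \<psi> \<in> B.comm_mod LL LE (lat (K #> a) \<phi>)"
    "lat (K #> a) \<phi> \<in> LL" "lat (K #> b) \<psi> \<in> LL"
    if a: "a \<in> carrier G" and b: "b \<in> carrier G" for a b
  proof -
    obtain c where c: "c \<in> carrier G" "K #> b = K #> (c \<otimes> a)" "spread (K #> a) (?U \<union> (?U #> c))"
      using common_spread[OF U K(1,2) a b] K(3) by metis
    let ?W = "?U \<union> (?U #> c)"
    have W: "finite ?W" "?W \<subseteq> carrier G"
      using acts_onD(1,2)[OF acts_on_cj[OF fU(2) c(1)]] U by auto
    have acts: "acts_on ?W \<phi>" "acts_on ?W (cj \<psi> c)"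
      by (rule acts_on_mono[OF fU(1)], use W in auto)
        (rule acts_on_mono[OF acts_on_cj[OF fU(2) c(1)]], use W in auto)
    have KaG: "K #> a \<subseteq> carrier G" using coset_subset[OF K(1) a] .
    have spU: "spread (K #> b) ?U"
      by (rule spread_mono[OF K(3)[rule_format, OF b]]) auto
    have im: "(\<lambda>s. c \<otimes> s) ` (K #> a) = K #> b" using normal_translate_coset[OF K(2) a c(1)] c(2) by simp
    have \<psi>eq: "lat (K #> b) \<psi> = lat (K #> a) (cj \<psi> c)"
      using lat_translate(1)[OF fU(2) c(1) KaG, unfolded im, OF spread_commuting[OF spU fU(2)]] .
    let ?x = "lat (K #> b) \<psi>" and ?y = "lat (K #> a) \<phi>"
    have xl: "?x \<in> lattices" by (rule latticesI[OF fU(2) K(1) b spread_commuting[OF spU fU(2)]])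
    have yl: "?y \<in> lattices" by (rule latticesI[OF acts(1) K(1) a spread_commuting[OF c(3) acts(1)]])
    show xL: "?x \<in> LL" and yL: "?y \<in> LL"
      unfolding gate_lattice_group_def by (rule generate.incl[OF xl], rule generate.incl[OF yl])
    let ?com = "cj \<psi> c \<star> \<phi> \<star> binv (cj \<psi> c) \<star> binv \<phi>"
    have com: "acts_on ?W ?com" "even_off ?W ?com"
      using acts acts_on_mult acts_on_inv commutator_even by auto
    have "?x \<star> ?y \<star> binv ?x \<star> binv ?y = lat (K #> a) ?com"
      unfolding \<psi>eq using acts
      by (simp add: lat_mult[OF c(3)] lat_inv[OF c(3)] acts_on_mult acts_on_inv)
    also have "\<dots> \<in> elattices" by (rule elatticesI[OF com(2) K(1) a spread_commuting[OF c(3) com(1)]])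
    finally have "?x \<star> ?y \<star> binv ?x \<star> binv ?y \<in> LE"
      unfolding even_gate_lattice_group_def by (rule generate.incl)
    then show "?x \<in> B.comm_mod LL LE ?y" using xL by (simp add: B.comm_mod_def)
  qed
  have lL: "l \<in> LL" and mL: "m \<in> LL" unfolding gate_lattice_group_def
    by (rule generate.incl[OF l], rule generate.incl[OF m])
  have "lat (H #> g) \<phi> \<in> B.comm_mod LL LE m"
  proof (rule lat_split[OF 1(1-4) K(1,4) C[OF LLB[OF mL]]])
    fix a assume "a \<in> H #> g"
    then have a: "a \<in> carrier G" using coset_subset[OF 1(2,3)] by auto
    have "lat (H' #> g') \<psi> \<in> B.comm_mod LL LE (lat (K #> a) \<phi>)"
    proof (rule lat_split[OF 2(1-4) K(1,5) C[OF LLB[OF core(2)[OF a one_closed]]]])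
      fix b assume "b \<in> H' #> g'"
      then have "b \<in> carrier G" using coset_subset[OF 2(2,3)] by auto
      then show "lat (K #> b) \<psi> \<in> B.comm_mod LL LE (lat (K #> a) \<phi>)" using core(1)[OF a] by blast
    qed
    then show "lat (K #> a) \<phi> \<in> B.comm_mod LL LE m"
      using B.comm_mod_sym[OF subgroup_LL subgroup_LE core(2)[OF a one_closed] mL] 2(5) by simp
  qed
  then show ?thesis using B.comm_mod_sym[OF subgroup_LL subgroup_LE mL lL] 1(5) by simp
qed

lemma derived_subset: "derived B LL \<subseteq> LE"
proof -
  note LLB = subgroup.mem_carrier[OF subgroup_LL]
  have normal: "\<And>x q. x \<in> LL \<Longrightarrow> q \<in> LE \<Longrightarrow> x \<star> q \<star> binv x \<in> LE"
    using conj_LE LL_subset_SA by blast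
  have C: "subgroup (B.comm_mod LL LE h) B" if "h \<in> LL" for h
    by (rule B.subgroup_comm_mod[OF subgroup_LL subgroup_LE normal LLB[OF that]])
  have lL: "lattices \<subseteq> LL" unfolding gate_lattice_group_def using generate.incl by auto
  have 1: "x \<in> B.comm_mod LL LE l" if "l \<in> lattices" "x \<in> LL" for x l
    using B.generate_subgroup_incl[OF _ C, of lattices l] commutator_lattices that lL
    unfolding gate_lattice_group_def by blast
  have 2: "x \<in> B.comm_mod LL LE y" if "x \<in> LL" "y \<in> LL" for x y
  proof -
    have "lattices \<subseteq> B.comm_mod LL LE y"
      using B.comm_mod_sym[OF subgroup_LL subgroup_LE _ that(2)] 1[OF _ that(2)] lL by blast
    then show ?thesis
      using B.generate_subgroup_incl[OF _ C[OF that(2)], of lattices] that(1)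
      unfolding gate_lattice_group_def by blast
  qed
  show ?thesis
    unfolding derived_def
  proof (rule B.generate_subgroup_incl[OF _ subgroup_LE])
    show "derived_set B LL \<subseteq> LE" using 2 by (auto simp: B.comm_mod_def)
  qed
qed

end

section \<open>Three-cycles\<close>

text \<open>The cycle \<open>a \<mapsto> b \<mapsto> c \<mapsto> a\<close>.\<close>

definition cyc :: "'b \<Rightarrow> 'b \<Rightarrow> 'b \<Rightarrow> 'b \<Rightarrow> 'b" where
  "cyc a b c = Transposition.transpose a b \<circ> Transposition.transpose b c"

lemma cyc_apply:
  assumes "distinct [a, b, c]"
  shows "cyc a b c w = (if w = a then b else if w = b then c else if w = c then a else w)"
  using assms by (auto simp: cyc_def Transposition.transpose_def)

lemma cyc_rotate: "distinct [a, b, c] \<Longrightarrow> cyc a b c = cyc b c a"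
  by (auto simp: fun_eq_iff cyc_apply)

lemma cyc_inverse:
  assumes "distinct [a, b, c]"
  shows "cyc a b c \<circ> cyc a c b = id"
proof
  have ne: "a \<noteq> b" "a \<noteq> c" "b \<noteq> c" using assms by auto
  fix w
  show "(cyc a b c \<circ> cyc a c b) w = id w"
    using ne ne[symmetric] by (cases "w = a"; cases "w = b"; cases "w = c") (simp_all add: cyc_apply)
qed

lemma cyc_swaps:
  assumes "distinct [a, b, c]"
  defines "s \<equiv> Transposition.transpose a c" and "t \<equiv> Transposition.transpose c b"
  shows "cyc a b c = s \<circ> t \<circ> s \<circ> t"
  using assms(1) unfolding s_def t_def
  by (auto simp: fun_eq_iff cyc_apply Transposition.transpose_def)

lemma cyc_commutator:
  assumes "distinct [a, b, c, d, e]"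
  shows "cyc a b c = cyc a b d \<circ> cyc a c e \<circ> cyc a d b \<circ> cyc a e c"
proof
  have ne: "a \<noteq> b" "a \<noteq> c" "a \<noteq> d" "a \<noteq> e" "b \<noteq> c" "b \<noteq> d" "b \<noteq> e" "c \<noteq> d" "c \<noteq> e" "d \<noteq> e"
    using assms by auto
  fix w
  show "cyc a b c w = (cyc a b d \<circ> cyc a c e \<circ> cyc a d b \<circ> cyc a e c) w"
    using ne ne[symmetric]
    by (cases "w = a"; cases "w = b"; cases "w = c"; cases "w = d"; cases "w = e") (simp_all add: cyc_apply)
qed

lemma cyc_conjugate:
  assumes "distinct [a, b, c, u, v]"
  shows "cyc a b c \<circ> cyc a u v \<circ> cyc a c b = cyc b u v"
proof
  have ne: "a \<noteq> b" "a \<noteq> c" "a \<noteq> u" "a \<noteq> v" "b \<noteq> c" "b \<noteq> u" "b \<noteq> v" "c \<noteq> u" "c \<noteq> v" "u \<noteq> v"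
    using assms by auto
  fix w
  show "(cyc a b c \<circ> cyc a u v \<circ> cyc a c b) w = cyc b u v w"
    using ne ne[symmetric]
    by (cases "w = a"; cases "w = b"; cases "w = c"; cases "w = u"; cases "w = v") (simp_all add: cyc_apply)
qed

section \<open>Gates that permute patterns\<close>

context subshift_system
begin

definition glue :: "('g \<Rightarrow> 'a) \<Rightarrow> 'g set \<Rightarrow> ('g \<Rightarrow> 'a) \<Rightarrow> ('g \<Rightarrow> 'a)" where
  "glue w N x = (\<lambda>k\<in>carrier G. if k \<in> N then w k else x k)"

text \<open>The cells of \<open>M - N\<close> screen \<open>N\<close> from the cells outside \<open>M\<close>.\<close>

definition screens :: "'g set \<Rightarrow> 'g set \<Rightarrow> bool" where
  "screens M N \<longleftrightarrow> finite M \<and> M \<subseteq> carrier G \<and> N \<subseteq> M \<and>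
     (\<forall>x\<in>X. \<forall>y\<in>X. agree (M - N) x y \<longrightarrow> glue x N y \<in> X)"

lemma screens_mono: "screens M N \<Longrightarrow> M \<subseteq> M' \<Longrightarrow> finite M' \<Longrightarrow> M' \<subseteq> carrier G \<Longrightarrow> screens M' N"
  unfolding screens_def using agree_subset[of "M' - N" _ _ "M - N"] by blast

text \<open>
  For a subshift of finite type, membership in \<open>X\<close> is decided by the translates of one finite
  window \<open>V\<close>; as \<open>M\<close> serve \<open>N\<close> and all translates of \<open>V\<close> that meet \<open>N\<close>.
\<close>

lemma SFT_screens:
  assumes sft: "SFT G \<Sigma> X" and N: "finite N" "N \<subseteq> carrier G"
  obtains M where "screens M N"
proof -
  let ?T = "config_space G \<Sigma>" and ?A = "carrier G \<rightarrow>\<^sub>E \<Sigma>"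
  obtain C where C: "openin ?T C" "closedin ?T C" "X = (\<Inter>g\<in>carrier G. shift G g ` C)"
    using sft by (auto simp: SFT_def)
  have CA: "C \<subseteq> ?A" using openin_subset[OF C(1)] topspace_config by simp
  have cA: "closedin ?T ?A" using topspace_config closedin_topspace[of ?T] by simp
  have sT: "subtopology ?T ?A = ?T" using subtopology_topspace[of ?T] topspace_config by simp
  have o1: "openin (subtopology ?T ?A) C" unfolding sT by (rule C(1))
  have o2: "openin (subtopology ?T ?A) (?A - C)" unfolding sT using C(2) topspace_config by (simp add: closedin_def)
  obtain V where V: "finite V" "V \<subseteq> carrier G"
    "\<And>x y. x \<in> ?A \<Longrightarrow> y \<in> ?A \<Longrightarrow> agree V x y \<Longrightarrow> x \<in> C \<Longrightarrow> y \<in> C"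
    using clopen_window[OF cA o1 o2] by blast
  have ext1: "shift G \<one> z = z" if "z \<in> ?A" for z
    by (rule extensionalityI[of _ "carrier G"]) (use that in \<open>auto simp: shift_def PiE_def\<close>)
  have shA: "shift G g z \<in> ?A" if "z \<in> ?A" "g \<in> carrier G" for g z
    using that by (auto simp: shift_def)
  have XC: "x \<in> C" if x: "x \<in> X" for x
  proof -
    have "x \<in> shift G \<one> ` C" using x C(3) by blast
    then show ?thesis using ext1 CA by auto
  qed
  have CX: "z \<in> X" if z: "z \<in> ?A" "\<And>g. g \<in> carrier G \<Longrightarrow> shift G g z \<in> C" for z
  proof -
    have "z \<in> shift G g ` C" if g: "g \<in> carrier G" for g
    proof -
      have "z = shift G g (shift G (inv g) z)" using g ext1[OF z(1)] by (simp add: shift_shift)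
      then show ?thesis using z(2)[of "inv g"] g by blast
    qed
    then show ?thesis using C(3) by blast
  qed
  let ?M = "N \<union> (\<lambda>(v, w, n). v \<otimes> (inv w \<otimes> n)) ` (V \<times> V \<times> N)"
  have M: "finite ?M" "?M \<subseteq> carrier G" using V N by (auto simp: subset_iff)
  have "glue x N y \<in> X" if xy: "x \<in> X" "y \<in> X" "agree (?M - N) x y" for x y
  proof (rule CX)
    let ?z = "glue x N y"
    show zA: "?z \<in> ?A" using xy X_symbol by (auto simp: glue_def)
    fix g assume g: "g \<in> carrier G"
    have C': "shift G g u \<in> C" "shift G g u \<in> ?A" if "u \<in> X" for u
      using XC[OF shift_in_X[OF g that]] CA by auto
    show "shift G g ?z \<in> C"
    proof (cases "\<exists>w\<in>V. w \<otimes> g \<in> N")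
      case True
      then obtain w where w: "w \<in> V" "w \<otimes> g \<in> N" by blast
      have "agree V (shift G g x) (shift G g ?z)"
      proof (rule agreeI)
        fix v assume v: "v \<in> V"
        have G: "v \<in> carrier G" "w \<in> carrier G" using v w V by auto
        have "g = inv w \<otimes> (w \<otimes> g)" using G g by (simp flip: m_assoc)
        then have "v \<otimes> g = (\<lambda>(v, w, n). v \<otimes> (inv w \<otimes> n)) (v, w, w \<otimes> g)" by simp
        then have "v \<otimes> g \<in> ?M" using v w by blast
        then have "?z (v \<otimes> g) = x (v \<otimes> g)"
          using agreeD[OF xy(3), of "v \<otimes> g"] G g by (auto simp: glue_def)
        then show "shift G g x v = shift G g ?z v" using G by (simp add: shift_apply)
      qed
      then show ?thesis using V(3)[OF C'(2)[OF xy(1)] shA[OF zA g]] C'(1)[OF xy(1)] by simp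
    next
      case False
      have "agree V (shift G g y) (shift G g ?z)"
      proof (rule agreeI)
        fix v assume v: "v \<in> V"
        then have G: "v \<in> carrier G" using V by auto
        have "v \<otimes> g \<notin> N" using False v by blast
        then show "shift G g y v = shift G g ?z v" using G g by (simp add: shift_apply glue_def)
      qed
      then show ?thesis using V(3)[OF C'(2)[OF xy(2)] shA[OF zA g]] C'(1)[OF xy(2)] by simp
    qed
  qed
  then have "screens ?M N" using M by (auto simp: screens_def)
  then show thesis by (rule that)
qed

definition patterns :: "'g set \<Rightarrow> ('g \<Rightarrow> 'a) set" where
  "patterns M = (\<lambda>x. restrict x M) ` X"

definition pattern_perm :: "'g set \<Rightarrow> 'g set \<Rightarrow> (('g \<Rightarrow> 'a) \<Rightarrow> ('g \<Rightarrow> 'a)) \<Rightarrow> bool" where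
  "pattern_perm M N \<pi> \<longleftrightarrow> \<pi> permutes patterns M \<and> (\<forall>w\<in>patterns M. agree (M - N) (\<pi> w) w)"

definition pgate :: "'g set \<Rightarrow> (('g \<Rightarrow> 'a) \<Rightarrow> ('g \<Rightarrow> 'a)) \<Rightarrow> ('g \<Rightarrow> 'a) \<Rightarrow> ('g \<Rightarrow> 'a)" where
  "pgate M \<pi> = (\<lambda>x\<in>X. glue (\<pi> (restrict x M)) M x)"

lemma restrict_in_patterns: "x \<in> X \<Longrightarrow> restrict x M \<in> patterns M"
  by (simp add: patterns_def)

lemma finite_patterns:
  assumes "finite M" "M \<subseteq> carrier G"
  shows "finite (patterns M)"
proof (rule finite_subset[OF _ finite_PiE[OF assms(1)]])
  show "patterns M \<subseteq> M \<rightarrow>\<^sub>E \<Sigma>"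
    using X_symbol assms(2) by (auto simp: patterns_def PiE_iff subset_iff)
qed (rule finite_alphabet)

lemma pattern_perm_comp: "pattern_perm M N \<pi> \<Longrightarrow> pattern_perm M N \<rho> \<Longrightarrow> pattern_perm M N (\<pi> \<circ> \<rho>)"
  unfolding pattern_perm_def
  using permutes_compose[of \<rho> "patterns M" \<pi>] permutes_in_image[of \<rho> "patterns M"]
    agree_trans[of "M - N"] by (metis comp_apply)

lemma pattern_perm_transpose:
  assumes "a \<in> patterns M" "b \<in> patterns M" "agree (M - N) a b"
  shows "pattern_perm M N (Transposition.transpose a b)"
  using assms permutes_swap_id[of a "patterns M" b] agree_sym[OF assms(3)]
  by (auto simp: pattern_perm_def Transposition.transpose_def)

lemma pattern_perm_cyc:
  assumes "a \<in> patterns M" "b \<in> patterns M" "c \<in> patterns M" "agree (M - N) a b" "agree (M - N) b c"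
  shows "pattern_perm M N (cyc a b c)"
  unfolding cyc_def by (intro pattern_perm_comp pattern_perm_transpose assms)

lemma glue_in_X:
  assumes sc: "screens M N" and w: "w \<in> patterns M" and x: "x \<in> X" and a: "agree (M - N) w x"
  shows "glue w M x \<in> X"
proof -
  obtain y where y: "y \<in> X" "w = restrict y M" using w by (auto simp: patterns_def)
  have NM: "N \<subseteq> M" "M \<subseteq> carrier G" using sc by (auto simp: screens_def)
  have yx: "agree (M - N) y x" using a y(2) by (simp add: agree_def)
  have "glue w M x = glue y N x"
  proof
    fix k
    show "glue w M x k = glue y N x k"
      using NM y(2) agreeD[OF yx, of k] by (auto simp: glue_def)
  qed
  moreover have "glue y N x \<in> X" using sc y x yx by (simp add: screens_def)
  ultimately show ?thesis by simp
qed

lemma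
  assumes sc: "screens M N" and \<pi>: "pattern_perm M N \<pi>" and x: "x \<in> X"
  shows pgate_in_X: "pgate M \<pi> x \<in> X"
    and pgate_restrict: "restrict (pgate M \<pi> x) M = \<pi> (restrict x M)"
    and pgate_outside: "agree (carrier G - N) (pgate M \<pi> x) x"
proof -
  have M: "N \<subseteq> M" "M \<subseteq> carrier G" using sc by (auto simp: screens_def)
  have p: "\<pi> (restrict x M) \<in> patterns M"
    using \<pi> restrict_in_patterns[OF x] by (simp add: pattern_perm_def permutes_in_image)
  have a: "agree (M - N) (\<pi> (restrict x M)) x"
  proof (rule agree_trans)
    show "agree (M - N) (\<pi> (restrict x M)) (restrict x M)"
      using \<pi> restrict_in_patterns[OF x] by (simp add: pattern_perm_def)
  qed (simp add: agree_def)
  show "pgate M \<pi> x \<in> X" using glue_in_X[OF sc p x a] x by (simp add: pgate_def)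
  have "\<pi> (restrict x M) \<in> extensional M" using p by (auto simp: patterns_def)
  then show "restrict (pgate M \<pi> x) M = \<pi> (restrict x M)"
    using M x by (auto simp: pgate_def glue_def fun_eq_iff extensional_def)
  show "agree (carrier G - N) (pgate M \<pi> x) x"
    using agreeD[OF a] x by (auto simp: pgate_def glue_def agree_def)
qed

lemma pgate_comp_apply:
  assumes sc: "screens M N" and \<pi>: "pattern_perm M N \<pi>" and \<rho>: "pattern_perm M N \<rho>" and x: "x \<in> X"
  shows "pgate M \<pi> (pgate M \<rho> x) = pgate M (\<pi> \<circ> \<rho>) x"
proof -
  note r = pgate_in_X[OF sc \<rho> x] pgate_restrict[OF sc \<rho> x]
  have "pgate M \<pi> (pgate M \<rho> x) = glue (\<pi> (\<rho> (restrict x M))) M (pgate M \<rho> x)"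
    using r by (simp add: pgate_def[of M \<pi>])
  also have "\<dots> = glue (\<pi> (\<rho> (restrict x M))) M x"
    using x by (auto simp: glue_def pgate_def)
  finally show ?thesis using x by (simp add: pgate_def)
qed

lemma pgate_id: "M \<subseteq> carrier G \<Longrightarrow> x \<in> X \<Longrightarrow> pgate M id x = x"
  using X_extensional[of x] by (auto simp: pgate_def glue_def fun_eq_iff extensional_def)

lemma
  assumes sc: "screens M N" and \<pi>: "pattern_perm M N \<pi>" and \<rho>: "pattern_perm M N \<rho>" and e: "\<pi> \<circ> \<rho> = id"
  shows pgate_inv: "binv (pgate M \<pi>) = pgate M \<rho>"
    and pgate_acts_on: "acts_on M (pgate M \<pi>)"
proof -
  have M: "finite M" "M \<subseteq> carrier G" using sc by (auto simp: screens_def)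
  have e': "\<rho> \<circ> \<pi> = id"
    using e \<pi> unfolding pattern_perm_def by (metis permutes_inv_o(2) comp_assoc comp_id id_comp)
  have g: "pgate M \<pi> \<in> extensional X" "pgate M \<rho> \<in> extensional X" by (simp_all add: pgate_def)
  have inv: "pgate M \<rho> (pgate M \<pi> x) = x" "pgate M \<pi> (pgate M \<rho> x) = x" if "x \<in> X" for x
    using pgate_comp_apply[OF sc \<pi> \<rho> that] pgate_comp_apply[OF sc \<rho> \<pi> that] e e' pgate_id[OF M(2) that]
    by auto
  note B = B_I[of "pgate M \<pi>" "pgate M \<rho>", OF g(1) pgate_in_X[OF sc \<pi>] pgate_in_X[OF sc \<rho>] inv]
  have PB: "pgate M \<pi> \<in> carrier B" by (rule B(1))
  show i: "binv (pgate M \<pi>) = pgate M \<rho>"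
    by (rule extensionalityI[of _ X]) (use B PB g B_iff B.inv_closed in blast)+
  have *: "(\<forall>x\<in>X. agree (carrier G - M) (pgate M \<sigma> x) x) \<and>
     (\<forall>x\<in>X. \<forall>y\<in>X. agree M x y \<longrightarrow> agree M (pgate M \<sigma> x) (pgate M \<sigma> y))"
    if \<sigma>: "pattern_perm M N \<sigma>" for \<sigma>
  proof (intro conjI ballI impI)
    fix x assume x: "x \<in> X"
    then show "agree (carrier G - M) (pgate M \<sigma> x) x" by (simp add: agree_def pgate_def glue_def)
    fix y assume y: "y \<in> X" "agree M x y"
    then show "agree M (pgate M \<sigma> x) (pgate M \<sigma> y)"
      using pgate_restrict[OF sc \<sigma> x] pgate_restrict[OF sc \<sigma> y(1)] by (simp flip: restrict_eq_iff)
  qed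
  show "acts_on M (pgate M \<pi>)" using *[OF \<pi>] *[OF \<rho>] M PB by (simp add: acts_on_def i)
qed

text \<open>
  Three patterns on \<open>M\<close> that may replace one another in any configuration, when \<open>M\<close> screens \<open>N\<close>.
\<close>

definition exchangeable :: "'g set \<Rightarrow> 'g set \<Rightarrow> ('g \<Rightarrow> 'a) \<Rightarrow> ('g \<Rightarrow> 'a) \<Rightarrow> ('g \<Rightarrow> 'a) \<Rightarrow> bool" where
  "exchangeable M N a b c \<longleftrightarrow> {a, b, c} \<subseteq> patterns M \<and> distinct [a, b, c] \<and>
     agree (M - N) a b \<and> agree (M - N) b c"

lemma exchangeable_swap: "exchangeable M N a b c \<Longrightarrow> exchangeable M N a c b"
  unfolding exchangeable_def by (auto intro: agree_sym agree_trans)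

lemma exchangeable_perm: "exchangeable M N a b c \<Longrightarrow> pattern_perm M N (cyc a b c)"
  unfolding exchangeable_def by (intro pattern_perm_cyc) auto

lemma
  assumes sc: "screens M N" and e: "exchangeable M N a b c"
  shows cyc_gate_inv: "binv (pgate M (cyc a b c)) = pgate M (cyc a c b)"
    and cyc_gate_acts_on: "acts_on M (pgate M (cyc a b c))"
proof -
  have i: "cyc a b c \<circ> cyc a c b = id" by (rule cyc_inverse) (use e in \<open>simp add: exchangeable_def\<close>)
  note p = exchangeable_perm[OF e] exchangeable_perm[OF exchangeable_swap[OF e]]
  show "binv (pgate M (cyc a b c)) = pgate M (cyc a c b)" by (rule pgate_inv[OF sc p i])
  show "acts_on M (pgate M (cyc a b c))" by (rule pgate_acts_on[OF sc p i])
qed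

lemma pgate_comp:
  assumes sc: "screens M N" and \<pi>: "pattern_perm M N \<pi>" and \<rho>: "pattern_perm M N \<rho>"
    and B: "pgate M \<pi> \<in> carrier B" "pgate M \<rho> \<in> carrier B"
  shows "pgate M \<pi> \<star> pgate M \<rho> = pgate M (\<pi> \<circ> \<rho>)"
proof (rule extensionalityI[of _ X])
  show "pgate M \<pi> \<star> pgate M \<rho> \<in> extensional X" using B B_iff B.m_closed by blast
  show "pgate M (\<pi> \<circ> \<rho>) \<in> extensional X" by (simp add: pgate_def)
qed (use B pgate_comp_apply[OF sc \<pi> \<rho>] in \<open>simp add: B_apply\<close>)

lemma
  assumes sc: "screens M N" and ab: "a \<in> patterns M" "b \<in> patterns M" "agree (M - N) a b"
  defines "s \<equiv> pgate M (Transposition.transpose a b)"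
  shows swap_gate_acts_on: "acts_on M s" and swap_gate_inv: "binv s = s"
    and swap_gate_outside: "x \<in> X \<Longrightarrow> agree (carrier G - N) (s x) x"
proof -
  have i: "Transposition.transpose a b \<circ> Transposition.transpose a b = id" by simp
  note p = pattern_perm_transpose[OF ab]
  show "acts_on M s" unfolding s_def by (rule pgate_acts_on[OF sc p p i])
  show "binv s = s" unfolding s_def by (rule pgate_inv[OF sc p p i])
  show "x \<in> X \<Longrightarrow> agree (carrier G - N) (s x) x" unfolding s_def by (rule pgate_outside[OF sc p])
qed

lemma cyc_gate_commutator:
  assumes sc: "screens M N" and e: "exchangeable M N a b c"
  defines "s \<equiv> pgate M (Transposition.transpose a c)" and "t \<equiv> pgate M (Transposition.transpose c b)"
  shows "pgate M (cyc a b c) = s \<star> t \<star> binv s \<star> binv t" and "acts_on M s" and "acts_on M t"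
    and "even_off N (pgate M (cyc a b c))"
proof -
  have m: "a \<in> patterns M" "b \<in> patterns M" "c \<in> patterns M" "agree (M - N) a c" "agree (M - N) c b"
    and d: "distinct [a, b, c]"
    using e agree_trans agree_sym by (auto simp: exchangeable_def)
  note S = swap_gate_acts_on[OF sc m(1,3,4), folded s_def] swap_gate_inv[OF sc m(1,3,4), folded s_def]
    swap_gate_outside[OF sc m(1,3,4), folded s_def]
  note T = swap_gate_acts_on[OF sc m(3,2,5), folded t_def] swap_gate_inv[OF sc m(3,2,5), folded t_def]
    swap_gate_outside[OF sc m(3,2,5), folded t_def]
  show "acts_on M s" "acts_on M t" by (rule S(1), rule T(1))
  have B: "s \<in> carrier B" "t \<in> carrier B" using S(1) T(1) acts_onD(3) by auto
  note p = pattern_perm_transpose[OF m(1,3,4)] pattern_perm_transpose[OF m(3,2,5)]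
  have st: "s \<star> t = pgate M (Transposition.transpose a c \<circ> Transposition.transpose c b)"
    unfolding s_def t_def by (rule pgate_comp[OF sc p]) (use B s_def t_def in auto)
  have "s \<star> t \<star> (s \<star> t) = pgate M ((Transposition.transpose a c \<circ> Transposition.transpose c b) \<circ>
      (Transposition.transpose a c \<circ> Transposition.transpose c b))"
    unfolding st by (rule pgate_comp[OF sc pattern_perm_comp[OF p] pattern_perm_comp[OF p]])
      (use B B.m_closed[OF B] st in auto)
  also have "\<dots> = pgate M (cyc a b c)" using cyc_swaps[OF d] by (simp add: comp_assoc)
  finally show eq: "pgate M (cyc a b c) = s \<star> t \<star> binv s \<star> binv t"
    using B S(2) T(2) by (simp add: B.m_assoc)
  have "finite N" "N \<subseteq> carrier G" using sc finite_subset by (auto simp: screens_def)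
  then show "even_off N (pgate M (cyc a b c))"
    unfolding eq by (rule commutator_even_off) (use S T acts_on_homeo in auto)
qed

text \<open>
  An even gate that moves a pattern \<open>a\<close> to \<open>b\<close> moves a third pattern \<open>c\<close> of the same block, for it
  would otherwise be a transposition there. Composing it with a cycle of \<open>a\<close>, \<open>b\<close> and \<open>c\<close> that returns
  \<open>b\<close> to \<open>a\<close> makes fewer patterns move.
\<close>

lemma even_gate_generated:
  assumes sc: "screens M N" and "acts_on M \<phi>" "even_off N \<phi>"
  shows "\<phi> \<in> generate B {pgate M (cyc a b c) | a b c. exchangeable M N a b c}" (is "_ \<in> generate B ?C")
  using assms(2,3)
proof (induction "card {w. \<exists>x\<in>X. restrict x M = w \<and> \<phi> x \<noteq> x}" arbitrary: \<phi> rule: less_induct)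
  case less
  let ?D = "\<lambda>\<phi>. {w. \<exists>x\<in>X. restrict x M = w \<and> \<phi> x \<noteq> x}"
  have M: "finite M" "M \<subseteq> carrier G" "N \<subseteq> M" using sc by (auto simp: screens_def)
  have N: "finite N" "N \<subseteq> carrier G" using M finite_subset by auto
  note F = acts_onD[OF less.prems(1)]
  have out: "\<And>x. x \<in> X \<Longrightarrow> agree (carrier G - N) (\<phi> x) x"
    and ev: "\<And>y. y \<in> X \<Longrightarrow> even_perm_on (variants N y) \<phi>"
    using less.prems(2) by (auto simp: even_off_def)
  have inj: "x = y" if "x \<in> X" "y \<in> X" "\<phi> x = \<phi> y" for x y
    using that B_inv_left[OF F(3)] by metis
  have eqI: "x = y" if "x \<in> X" "y \<in> X" "agree (carrier G - N) x y" "restrict x M = restrict y M" for x y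
  proof (rule X_eqI[OF that(1,2)])
    show "agree (carrier G) x y"
      using that(3,4) M unfolding restrict_eq_iff by (auto simp: agree_def)
  qed
  show ?case
  proof (cases "\<exists>x\<in>X. \<phi> x \<noteq> x")
    case False
    then have "\<phi> = \<one>\<^bsub>B\<^esub>" using F(3) by (intro B_eqI) (auto simp: B_one_apply)
    then show ?thesis using generate.one by simp
  next
    case True
    then obtain x where x: "x \<in> X" "\<phi> x \<noteq> x" by blast
    let ?Y = "variants N x"
    have YX: "?Y \<subseteq> X" by (auto simp: variants_def)
    have Yin: "\<phi> y \<in> ?Y" if "y \<in> ?Y" for y using even_perm_on_image[OF ev[OF x(1)] that] .
    have xY: "x \<in> ?Y" by (rule variants_self[OF x(1)])
    have "\<exists>z\<in>?Y. z \<noteq> x \<and> z \<noteq> \<phi> x \<and> \<phi> z \<noteq> z"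
    proof (rule ccontr)
      assume "\<not> ?thesis"
      then have fixed: "\<phi> z = z" if "z \<in> ?Y" "z \<noteq> x" "z \<noteq> \<phi> x" for z using that by blast
      have bck: "\<phi> (\<phi> x) = x"
      proof (rule ccontr)
        assume n: "\<phi> (\<phi> x) \<noteq> x"
        have X: "\<phi> x \<in> X" "\<phi> (\<phi> x) \<in> X" using B_in_X[OF F(3)] x by auto
        have "\<phi> (\<phi> x) \<noteq> \<phi> x" using inj[OF X(1) x(1)] x(2) by auto
        then have "\<phi> (\<phi> (\<phi> x)) = \<phi> (\<phi> x)" using fixed[of "\<phi> (\<phi> x)"] n Yin xY by auto
        then have "\<phi> (\<phi> x) = \<phi> x" using inj X by blast
        then show False using \<open>\<phi> (\<phi> x) \<noteq> \<phi> x\<close> by simp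
      qed
      have "(\<lambda>w. if w \<in> ?Y then \<phi> w else w) = Transposition.transpose x (\<phi> x)"
      proof (rule ext)
        fix w
        show "(if w \<in> ?Y then \<phi> w else w) = Transposition.transpose x (\<phi> x) w"
        proof (cases "w \<in> ?Y")
          case True
          consider "w = x" | "w = \<phi> x" | "w \<noteq> x" "w \<noteq> \<phi> x" by blast
          then show ?thesis
            by cases (use True bck fixed[of w] in simp_all)
        next
          case False
          then have "w \<noteq> x" "w \<noteq> \<phi> x" using xY Yin by blast+
          then show ?thesis using False by simp
        qed
      qed
      moreover have "evenperm (\<lambda>w. if w \<in> ?Y then \<phi> w else w)"
        using ev[OF x(1)] by (simp add: even_perm_on_iff)
      ultimately show False using x(2) by (simp add: evenperm_swap)
    qed
    then obtain z where z: "z \<in> ?Y" "z \<noteq> x" "z \<noteq> \<phi> x" "\<phi> z \<noteq> z" by blast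
    define a b c where "a = restrict x M" and "b = restrict (\<phi> x) M" and "c = restrict z M"
    have zX: "z \<in> X" and \<phi>X: "\<phi> x \<in> X" using z(1) YX Yin[OF xY] by auto
    have ag: "agree (carrier G - N) z x" "agree (carrier G - N) (\<phi> x) x"
      using z(1) Yin[OF xY] by (auto simp: variants_def)
    have dist: "a \<noteq> b" "a \<noteq> c" "b \<noteq> c"
      unfolding a_def b_def c_def
      using eqI[OF x(1) \<phi>X agree_sym[OF ag(2)]] eqI[OF x(1) zX agree_sym[OF ag(1)]]
        eqI[OF \<phi>X zX agree_trans[OF ag(2) agree_sym[OF ag(1)]]] x(2) z(2,3) by auto
    have agM: "agree (M - N) b a" "agree (M - N) a c"
      using ag M by (auto simp: agree_def a_def b_def c_def)
    have ex: "exchangeable M N b a c"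
      using restrict_in_patterns x zX \<phi>X dist agM by (auto simp: exchangeable_def a_def b_def c_def)
    let ?g = "pgate M (cyc b a c)"
    have gA: "acts_on M ?g" using cyc_gate_acts_on[OF sc ex] .
    then have gB: "?g \<in> carrier B" using acts_onD by blast
    define q where "q = ?g \<star> \<phi>"
    have q: "acts_on M q" "even_off N q"
      unfolding q_def using acts_on_mult[OF gA less.prems(1)]
        even_off_mult[OF cyc_gate_commutator(4)[OF sc ex] less.prems(2)] by auto
    have q_apply: "q y = ?g (\<phi> y)" if "y \<in> X" for y using that gB F(3) by (simp add: q_def B_apply)
    have sub: "?D q \<subseteq> ?D \<phi> - {a}"
    proof
      fix w assume "w \<in> ?D q"
      then obtain y where y: "y \<in> X" "w = restrict y M" "q y \<noteq> y" by blast
      have \<phi>y: "\<phi> y \<in> X" using B_in_X[OF F(3) y(1)] .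
      have "w \<noteq> a"
      proof
        assume "w = a"
        then have "agree M y x" using y(2) by (simp add: a_def restrict_eq_iff)
        then have "restrict (\<phi> y) M = b" using F(6) y(1) x(1) by (simp add: b_def restrict_eq_iff)
        then have "restrict (q y) M = a"
          using pgate_restrict[OF sc exchangeable_perm[OF ex] \<phi>y] q_apply[OF y(1)] dist
          by (simp add: cyc_apply)
        then have "q y = y"
          using eqI[of "q y" y] y \<open>w = a\<close> B_in_X acts_onD(3)[OF q(1)] q(2) by (auto simp: even_off_def)
        then show False using y by simp
      qed
      moreover have "w \<in> ?D \<phi>"
      proof (cases "\<phi> y = y")
        case True
        have "w \<in> {a, b, c}"
        proof (rule ccontr)
          assume "w \<notin> {a, b, c}"
          then have "cyc b a c w = w" using dist by (simp add: cyc_apply)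
          then have "restrict (q y) M = restrict y M"
            using pgate_restrict[OF sc exchangeable_perm[OF ex] \<phi>y] q_apply[OF y(1)] True y(2) by simp
          then show False
            using eqI[of "q y" y] y B_in_X acts_onD(3)[OF q(1)] q(2) by (auto simp: even_off_def)
        qed
        moreover have "a \<in> ?D \<phi>" using x a_def by blast
        moreover have "b \<in> ?D \<phi>" using \<phi>X inj[OF \<phi>X x(1)] x(2) b_def by blast
        moreover have "c \<in> ?D \<phi>" using zX z(4) c_def by blast
        ultimately show ?thesis by blast
      next
        case False
        then show ?thesis using y by blast
      qed
      ultimately show "w \<in> ?D \<phi> - {a}" by simp
    qed
    have "finite (?D \<phi>)"
      by (rule finite_subset[OF _ finite_patterns[OF M(1,2)]]) (auto simp: patterns_def)
    moreover have "a \<in> ?D \<phi>" using x a_def by blast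
    ultimately have "card (?D q) < card (?D \<phi>)" using sub by (intro psubset_card_mono) blast+
    then have "q \<in> generate B ?C" using less.hyps q by blast
    moreover have "binv ?g \<in> generate B ?C" using ex by (intro generate.inv) blast
    moreover have "\<phi> = binv ?g \<star> q" unfolding q_def using gB F(3) by (simp flip: B.m_assoc)
    ultimately show ?thesis using generate.eng[of "binv ?g" B ?C q] by simp
  qed
qed

end

context lattice_system
begin

section \<open>Even gate lattices are commutators\<close>

text \<open>
  The two transpositions whose commutator is a given 3-cycle act on the same cells \<open>M\<close> as the
  3-cycle, so that the lattice of the 3-cycle is the commutator of their lattices.
\<close>

lemma even_gate_lattices_derived:
  assumes sft: "SFT G \<Sigma> X"
  shows "LE \<subseteq> derived B LL"
proof -
  have Q: "subgroup (derived B LL) B"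
    by (rule B.derived_is_subgroup) (rule subgroup.subset[OF subgroup_LL])
  have "elattices \<subseteq> derived B LL"
  proof
    fix l assume "l \<in> elattices"
    then obtain N \<phi> H g where l: "even_off N \<phi>" "acts_on N \<phi>" "H \<in> \<I>" "g \<in> carrier G"
      "B.commuting (cj \<phi>) (H #> g)" "l = lat (H #> g) \<phi>" by (rule elatticesE)
    note N = acts_onD(1,2)[OF l(2)]
    obtain M where sc: "screens M N" using SFT_screens[OF sft N] .
    then have M: "finite M" "M \<subseteq> carrier G" "N \<subseteq> M" by (auto simp: screens_def)
    have aM: "acts_on M \<phi>" by (rule acts_on_mono[OF l(2) M(3,1,2)])
    obtain K where K: "K \<in> \<I>" "\<forall>a\<in>carrier G. spread (K #> a) M" "K \<subseteq> H"
      using for_smallE[OF for_small_conj[OF spread_small[OF M(1,2)] for_small_below[OF l(3)]]] by metis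
    have "lat (H #> g) \<phi> \<in> derived B LL"
    proof (rule lat_split[OF l(2-5) K(1,3) Q])
      fix a assume "a \<in> H #> g"
      then have a: "a \<in> carrier G" using coset_subset[OF l(3,4)] by auto
      have sp: "spread (K #> a) M" using K(2) a by blast
      let ?P = "{\<psi>. acts_on M \<psi> \<and> lat (K #> a) \<psi> \<in> derived B LL}"
      have "{pgate M (cyc u v w) | u v w. exchangeable M N u v w} \<subseteq> ?P"
      proof clarify
        fix u v w assume e: "exchangeable M N u v w"
        let ?s = "pgate M (Transposition.transpose u w)" and ?t = "pgate M (Transposition.transpose w v)"
        note c = cyc_gate_commutator(1-3)[OF sc e]
        have L: "lat (K #> a) \<psi> \<in> LL" if "acts_on M \<psi>" for \<psi>
          unfolding gate_lattice_group_def
          by (rule generate.incl[OF latticesI[OF that K(1) a spread_commuting[OF sp that]]])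
        have "lat (K #> a) (pgate M (cyc u v w)) =
          lat (K #> a) ?s \<star> lat (K #> a) ?t \<star> binv (lat (K #> a) ?s) \<star> binv (lat (K #> a) ?t)"
          unfolding c(1) using c(2,3)
          by (simp add: lat_mult[OF sp] lat_inv[OF sp] acts_on_mult acts_on_inv)
        also have "\<dots> \<in> derived B LL"
          unfolding derived_def using L c(2,3) by (intro generate.incl) blast
        finally show "acts_on M (pgate M (cyc u v w)) \<and> lat (K #> a) (pgate M (cyc u v w)) \<in> derived B LL"
          using cyc_gate_acts_on[OF sc e] by simp
      qed
      then show "lat (K #> a) \<phi> \<in> derived B LL"
        using B.generate_subgroup_incl[OF _ subgroup_lat_vimage[OF sp M(1,2) Q]]
          even_gate_generated[OF sc aM l(1)] by blast
    qed
    then show "l \<in> derived B LL" using l(6) by simp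
  qed
  then show ?thesis
    unfolding even_gate_lattice_group_def[of G \<Sigma> X \<I>] by (rule B.generate_subgroup_incl[OF _ Q])
qed

end

section \<open>Eventual filling\<close>

locale efp_system = lattice_system G \<Sigma> X \<I> for G :: "('g, 'm) monoid_scheme" (structure)
    and \<Sigma> :: "'a set" and X :: "('g \<Rightarrow> 'a) set" and \<I> :: "'g set set" +
  assumes sft: "SFT G \<Sigma> X" and efp: "EFP G X" and infinite_G: "infinite (carrier G)"
    and nontrivial: "\<not> is_singleton X"
begin

lemma fill:
  assumes "finite F" "F \<subseteq> carrier G"
  obtains N where "finite N" "N \<subseteq> carrier G"
    "\<And>x y. x \<in> X \<Longrightarrow> y \<in> X \<Longrightarrow> \<exists>z\<in>X. agree F z x \<and> agree (carrier G - N) z y"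
proof -
  obtain N where "finite N \<and> N \<subseteq> carrier G \<and> (\<forall>x\<in>X. \<forall>y\<in>X. \<exists>z\<in>X.
              restrict z F = restrict x F \<and>
              restrict z (carrier G - N) = restrict y (carrier G - N))"
    using efp[unfolded EFP_def, THEN spec, THEN mp, OF conjI[OF assms]] ..
  then show thesis using that unfolding restrict_eq_iff by (elim conjE) simp
qed

lemma distinguishing_cells:
  assumes "finite T" "T \<subseteq> X"
  obtains F where "finite F" "F \<subseteq> carrier G" "\<And>x y. x \<in> T \<Longrightarrow> y \<in> T \<Longrightarrow> agree F x y \<Longrightarrow> x = y"
proof -
  have "\<exists>k. k \<in> carrier G \<and> (x \<noteq> y \<longrightarrow> x k \<noteq> y k)" if "x \<in> T" "y \<in> T" for x y
    using X_eqI[of x y] that assms(2) one_closed unfolding agree_def by blast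
  then have "\<forall>x y. \<exists>k. x \<in> T \<longrightarrow> y \<in> T \<longrightarrow> k \<in> carrier G \<and> (x \<noteq> y \<longrightarrow> x k \<noteq> y k)" by meson
  then obtain k where k: "\<forall>x y. x \<in> T \<longrightarrow> y \<in> T \<longrightarrow> k x y \<in> carrier G \<and> (x \<noteq> y \<longrightarrow> x (k x y) \<noteq> y (k x y))"
    unfolding choice_iff by blast
  show thesis
  proof (rule that[of "(\<lambda>(x, y). k x y) ` (T \<times> T)"])
    show "finite ((\<lambda>(x, y). k x y) ` (T \<times> T))" using assms by simp
    show "(\<lambda>(x, y). k x y) ` (T \<times> T) \<subseteq> carrier G" using k by auto
    fix x y assume xy: "x \<in> T" "y \<in> T" and a: "agree ((\<lambda>(x, y). k x y) ` (T \<times> T)) x y"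
    have "k x y \<in> (\<lambda>(x, y). k x y) ` (T \<times> T)" using xy by force
    then have "x (k x y) = y (k x y)" using agreeD[OF a] by blast
    then show "x = y" using k xy by blast
  qed
qed

text \<open>
  If \<open>X\<close> were finite, a finite set \<open>F\<close> of cells would determine its elements, and so would a translate
  of \<open>F\<close> that avoids the filling neighborhood \<open>N\<close> of \<open>F\<close>. For any \<open>x\<close> and \<open>y\<close>, an element that
  agrees with \<open>x\<close> on \<open>F\<close> and with \<open>y\<close> outside \<open>N\<close> would then be equal to both.
\<close>

lemma infinite_X: "infinite X"
proof
  assume fin: "finite X"
  obtain F where F: "finite F" "F \<subseteq> carrier G" "\<And>x y. x \<in> X \<Longrightarrow> y \<in> X \<Longrightarrow> agree F x y \<Longrightarrow> x = y"
    using distinguishing_cells[OF fin order_refl] by blast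
  obtain N where N: "finite N" "N \<subseteq> carrier G"
    "\<And>x y. x \<in> X \<Longrightarrow> y \<in> X \<Longrightarrow> \<exists>z\<in>X. agree F z x \<and> agree (carrier G - N) z y"
    using fill[OF F(1,2)] by blast
  have "finite ((\<lambda>(u, n). inv u \<otimes> n) ` (F \<times> N))" using F N by simp
  then have "\<exists>h. h \<in> carrier G - (\<lambda>(u, n). inv u \<otimes> n) ` (F \<times> N)"
    using infinite_G by (metis Diff_infinite_finite finite.emptyI ex_in_conv)
  then obtain h where h: "h \<in> carrier G" "h \<notin> (\<lambda>(u, n). inv u \<otimes> n) ` (F \<times> N)" by blast
  have "x = y" if xy: "x \<in> X" "y \<in> X" for x y
  proof -
    obtain z where z: "z \<in> X" "agree F z x" "agree (carrier G - N) z y" using N(3)[OF xy] by blast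
    have "agree F (shift G h z) (shift G h y)"
    proof (rule agreeI)
      fix u assume u: "u \<in> F"
      then have uG: "u \<in> carrier G" using F by auto
      have "u \<otimes> h \<notin> N"
      proof
        assume "u \<otimes> h \<in> N"
        moreover have "h = (\<lambda>(u, n). inv u \<otimes> n) (u, u \<otimes> h)" using uG h by (simp flip: m_assoc)
        ultimately show False using h(2) u by blast
      qed
      then show "shift G h z u = shift G h y u"
        using agreeD[OF z(3), of "u \<otimes> h"] uG h by (simp add: shift_apply)
    qed
    then have e: "shift G h z = shift G h y" using F(3) shift_in_X[OF h(1)] z xy by blast
    have i: "shift G (inv h) (shift G h z) = z" "shift G (inv h) (shift G h y) = y"
      by (simp_all only: shift_shift[OF inv_closed[OF h(1)] h(1)] l_inv[OF h(1)] shift_one[OF z(1)]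
          shift_one[OF xy(2)])
    have "z = y" using i(1) unfolding e i(2) by simp
    moreover have "z = x" using F(3) z xy by blast
    ultimately show ?thesis by simp
  qed
  then have "is_singleton X" using X_nonempty unfolding is_singleton_def by blast
  then show False using nontrivial by simp
qed

text \<open>
  By filling, every configuration differs at finitely many fixed cells from one that looks like \<open>p\<close> on
  \<open>D\<close>, so there are infinitely many of the latter. Finitely many cells \<open>F\<close> tell \<open>n\<close> of them apart, and
  filling their contents on \<open>F\<close> into the configuration of \<open>a\<close> gives \<open>n\<close> patterns.
\<close>

lemma many_patterns:
  assumes D: "finite D" "D \<subseteq> carrier G" and p: "p \<in> X"
  obtains F N where "finite F" "F \<subseteq> carrier G" "finite N" "N \<subseteq> carrier G" "D \<subseteq> F"
    "\<And>M N' a. finite M \<Longrightarrow> F \<subseteq> M \<Longrightarrow> M \<subseteq> carrier G \<Longrightarrow> N \<subseteq> N' \<Longrightarrow> a \<in> patterns M \<Longrightarrow>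
       \<exists>W \<subseteq> patterns M. card W = n \<and> finite W \<and> (\<forall>w\<in>W. agree (M - N') w a \<and> agree D w p)"
proof -
  let ?A = "{x \<in> X. agree D x p}"
  obtain N0 where N0: "finite N0" "N0 \<subseteq> carrier G"
    "\<And>x y. x \<in> X \<Longrightarrow> y \<in> X \<Longrightarrow> \<exists>z\<in>X. agree D z x \<and> agree (carrier G - N0) z y"
    using fill[OF D] by blast
  have "X \<subseteq> (\<Union>z\<in>?A. variants N0 z)"
  proof
    fix y assume y: "y \<in> X"
    obtain z where "z \<in> X" "agree D z p" "agree (carrier G - N0) z y" using N0(3)[OF p y] by blast
    then show "y \<in> (\<Union>z\<in>?A. variants N0 z)" using y agree_sym by (auto simp: variants_def)
  qed
  then have "infinite ?A" using infinite_X finite_variants[OF N0(1,2)] by (metis (no_types, lifting) finite_UN finite_subset)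
  then obtain T where T: "finite T" "card T = n" "T \<subseteq> ?A" using infinite_arbitrarily_large by blast
  obtain F0 where F0: "finite F0" "F0 \<subseteq> carrier G" "\<And>x y. x \<in> T \<Longrightarrow> y \<in> T \<Longrightarrow> agree F0 x y \<Longrightarrow> x = y"
    using distinguishing_cells[of T] T by blast
  let ?F = "D \<union> F0"
  have F: "finite ?F" "?F \<subseteq> carrier G" using D F0 by auto
  obtain N where N: "finite N" "N \<subseteq> carrier G"
    "\<And>x y. x \<in> X \<Longrightarrow> y \<in> X \<Longrightarrow> \<exists>z\<in>X. agree ?F z x \<and> agree (carrier G - N) z y"
    using fill[OF F] by blast
  show thesis
  proof (rule that[OF F N(1,2)])
    show "D \<subseteq> ?F" by simp
    fix M N' a assume M: "finite M" "?F \<subseteq> M" "M \<subseteq> carrier G" and N': "N \<subseteq> N'" and a: "a \<in> patterns M"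
    obtain y where y: "y \<in> X" "a = restrict y M" using a by (auto simp: patterns_def)
    have "\<forall>t\<in>T. \<exists>z. z \<in> X \<and> agree ?F z t \<and> agree (carrier G - N) z y"
      using N(3)[OF _ y(1)] T(3) by blast
    then obtain z where z: "\<And>t. t \<in> T \<Longrightarrow> z t \<in> X" "\<And>t. t \<in> T \<Longrightarrow> agree ?F (z t) t"
      "\<And>t. t \<in> T \<Longrightarrow> agree (carrier G - N) (z t) y"
      by metis
    let ?w = "\<lambda>t. restrict (z t) M"
    have inj: "inj_on ?w T"
    proof (rule inj_onI)
      fix s t assume st: "s \<in> T" "t \<in> T" "?w s = ?w t"
      then have "agree F0 (z s) (z t)" using M(2) agree_subset[of M _ _ F0] by (simp add: restrict_eq_iff)
      then have "agree F0 s t"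
        using z(2)[OF st(1)] z(2)[OF st(2)] by (auto simp: agree_def)
      then show "s = t" using F0(3) st by blast
    qed
    have "agree (M - N') (?w t) a \<and> agree D (?w t) p" if t: "t \<in> T" for t
    proof
      show "agree (M - N') (?w t) a"
        using z(3)[OF t] M(3) N' y(2) by (auto simp: agree_def)
      show "agree D (?w t) p"
        using z(2)[OF t] M(2) T(3) t by (auto simp: agree_def)
    qed
    moreover have "?w ` T \<subseteq> patterns M" using z(1) restrict_in_patterns by auto
    ultimately show "\<exists>W \<subseteq> patterns M. card W = n \<and> finite W \<and> (\<forall>w\<in>W. agree (M - N') w a \<and> agree D w p)"
      using card_image[OF inj] T(1,2) by (intro exI[of _ "?w ` T"]) auto
  qed
qed

section \<open>Normal generation of the even gates\<close>

text \<open>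
  Every 3-cycle of patterns is a conjugate of one that permutes patterns looking like \<open>p\<close> on \<open>D\<close>,
  since the block of patterns it acts on contains many of these; and five of them suffice to make
  such a 3-cycle a commutator.
\<close>

lemma even_gates_normally_generated:
  assumes D: "finite D" "D \<subseteq> carrier G" and p: "p \<in> X"
    and GG: "subgroup GG B"
    and comm: "\<And>N \<alpha> M \<beta>. acts_on M \<alpha> \<Longrightarrow> even_off N \<alpha> \<Longrightarrow> acts_on M \<beta> \<Longrightarrow> even_off N \<beta> \<Longrightarrow>
      (\<And>x. x \<in> X \<Longrightarrow> \<not> agree D x p \<Longrightarrow> \<alpha> x = x) \<Longrightarrow> (\<And>x. x \<in> X \<Longrightarrow> \<not> agree D x p \<Longrightarrow> \<beta> x = x) \<Longrightarrow>
      binv \<alpha> \<star> \<beta> \<star> \<alpha> \<star> binv \<beta> \<in> GG"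
    and conj: "\<And>N M \<alpha> \<gamma>. acts_on M \<alpha> \<Longrightarrow> even_off N \<alpha> \<Longrightarrow> \<gamma> \<in> GG \<Longrightarrow> \<alpha> \<star> \<gamma> \<star> binv \<alpha> \<in> GG"
    and \<phi>: "even_off N0 \<phi>"
  shows "\<phi> \<in> GG"
proof -
  obtain F N1 where F: "finite F" "F \<subseteq> carrier G" and N1: "finite N1" "N1 \<subseteq> carrier G" and DF: "D \<subseteq> F"
    and many: "\<And>M N' a. finite M \<Longrightarrow> F \<subseteq> M \<Longrightarrow> M \<subseteq> carrier G \<Longrightarrow> N1 \<subseteq> N' \<Longrightarrow> a \<in> patterns M \<Longrightarrow>
       \<exists>W \<subseteq> patterns M. card W = 8 \<and> finite W \<and> (\<forall>w\<in>W. agree (M - N') w a \<and> agree D w p)"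
    by (rule many_patterns[OF D p, where n = 8], rule that)
  obtain N2 where N2: "acts_on N2 \<phi>" using even_off_acts_on[OF \<phi>] by metis
  let ?N = "N0 \<union> N1"
  have N0: "finite N0" "N0 \<subseteq> carrier G" using \<phi> by (auto simp: even_off_def)
  have N: "finite ?N" "?N \<subseteq> carrier G" using N0 N1 by auto
  have ev: "even_off ?N \<phi>" by (rule even_off_mono[OF \<phi> _ N]) simp
  obtain M0 where M0: "screens M0 ?N" using SFT_screens[OF sft N] .
  define M where "M = M0 \<union> N2 \<union> F"
  have M: "finite M" "M \<subseteq> carrier G" using M0 acts_onD(1,2)[OF N2] F by (auto simp: screens_def M_def)
  have sc: "screens M ?N" by (rule screens_mono[OF M0 _ M]) (auto simp: M_def)
  have aM: "acts_on M \<phi>" by (rule acts_on_mono[OF N2 _ M]) (auto simp: M_def)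
  have FM: "F \<subseteq> M" by (auto simp: M_def)
  let ?g = "\<lambda>a b c. pgate M (cyc a b c)"
  let ?E = "exchangeable M ?N"
  note acts = cyc_gate_acts_on[OF sc] and even = cyc_gate_commutator(4)[OF sc] and ginv = cyc_gate_inv[OF sc]
  have gB: "?g a b c \<in> carrier B" if "?E a b c" for a b c using acts_onD(3)[OF acts[OF that]] .
  have gprod: "pgate M \<pi> \<star> pgate M \<rho> = pgate M (\<pi> \<circ> \<rho>)"
    if "pattern_perm M ?N \<pi>" "pattern_perm M ?N \<rho>" "pgate M \<pi> \<in> carrier B" "pgate M \<rho> \<in> carrier B" for \<pi> \<rho>
    by (rule pgate_comp[OF sc that])
  have conj_step: "?g b u v \<in> GG"
    if g: "?g a u v \<in> GG" and e: "?E a b c" "?E a u v" and d: "distinct [a, b, c, u, v]" for a b c u v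
  proof -
    have "?g a b c \<star> ?g a u v \<star> binv (?g a b c) \<in> GG" by (rule conj[OF acts[OF e(1)] even[OF e(1)] g])
    also have "?g a b c \<star> ?g a u v \<star> binv (?g a b c) = pgate M (cyc a b c \<circ> cyc a u v \<circ> cyc a c b)"
    proof -
      note e' = exchangeable_swap[OF e(1)]
      have 1: "?g a b c \<star> ?g a u v = pgate M (cyc a b c \<circ> cyc a u v)"
        by (rule gprod) (use exchangeable_perm e gB in auto)
      moreover have "pgate M (cyc a b c \<circ> cyc a u v) \<star> ?g a c b = pgate M (cyc a b c \<circ> cyc a u v \<circ> cyc a c b)"
        by (rule gprod) (use exchangeable_perm pattern_perm_comp e e' gB B.m_closed[OF gB[OF e(1)] gB[OF e(2)]] 1 in auto)
      ultimately show ?thesis using ginv[OF e(1)] by simp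
    qed
    also have "\<dots> = ?g b u v" unfolding cyc_conjugate[OF d] ..
    finally show ?thesis .
  qed
  have "?g a b c \<in> GG" if e: "?E a b c" for a b c
  proof -
    have aP: "a \<in> patterns M" and bP: "b \<in> patterns M" and cP: "c \<in> patterns M"
      and abc: "distinct [a, b, c]" "agree (M - ?N) b a" "agree (M - ?N) c a"
      using e by (auto simp: exchangeable_def agree_def)
    obtain W where W: "W \<subseteq> patterns M" "card W = 8" "finite W"
      "\<forall>w\<in>W. agree (M - ?N) w a \<and> agree D w p"
      using many[OF M(1) FM M(2) _ aP, of ?N] by auto
    \<comment> \<open>the eight patterns of \<open>W\<close> leave five that differ from \<open>a\<close>, \<open>b\<close> and \<open>c\<close>\<close>
    have "card (W - {a, b, c}) \<ge> 8 - card {a, b, c}" using diff_card_le_card_Diff[of "{a,b,c}" W] W(2) by simp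
    then have "card (W - {a, b, c}) \<ge> 5" using abc(1) by simp
    then obtain U where U: "U \<subseteq> W - {a, b, c}" "card U = 5" by (meson obtain_subset_with_card_n)
    have "finite U" using U W finite_subset by blast
    then obtain us where us: "set us = U" "distinct us" using finite_distinct_list by blast
    then have "length us = 5" using U(2) distinct_card by metis
    then obtain d1 d2 d3 d4 d5 where "us = [d1, d2, d3, d4, d5]"
      by (auto simp: numeral_eq_Suc length_Suc_conv)
    then have dist: "distinct [d1, d2, d3, d4, d5]" and dU: "{d1, d2, d3, d4, d5} \<subseteq> W - {a, b, c}"
      using us U by auto
    let ?S = "{a, b, c, d1, d2, d3, d4, d5}"
    have S: "u \<in> patterns M" "agree (M - ?N) u a" if "u \<in> ?S" for u
      using that dU W abc aP bP cP by auto
    have E: "?E u v w" if "u \<in> ?S" "v \<in> ?S" "w \<in> ?S" "distinct [u, v, w]" for u v w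
      using S[OF that(1)] S[OF that(2)] S[OF that(3)] that(4) agree_sym agree_trans
      unfolding exchangeable_def by blast
    have dist8: "distinct [a, b, c, d1, d2, d3, d4, d5]" using dist dU abc(1) by auto
    have unmoved: "?g u v w x = x" if "u \<in> W" "v \<in> W" "w \<in> W" "?E u v w" "x \<in> X" "\<not> agree D x p" for u v w x
    proof -
      have "restrict x M \<notin> {u, v, w}"
      proof
        assume "restrict x M \<in> {u, v, w}"
        then have "agree D (restrict x M) p" using W(4) that by blast
        moreover have "D \<subseteq> M" using DF FM by simp
        ultimately have "agree D x p" by (simp add: agree_def subset_iff)
        then show False using that(6) by simp
      qed
      then have "cyc u v w (restrict x M) = restrict x M"
        using that(4) by (simp add: exchangeable_def cyc_apply)
      then have "restrict (?g u v w x) M = restrict x M"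
        using pgate_restrict[OF sc exchangeable_perm[OF that(4)] that(5)] by simp
      then have "agree M (?g u v w x) x" by (simp add: restrict_eq_iff)
      then show ?thesis
        using X_eqI[OF B_in_X[OF gB[OF that(4)] that(5)] that(5)]
          acts_onD(4)[OF acts[OF that(4)] that(5)] unfolding agree_def by blast
    qed
    have dW: "d1 \<in> W" "d2 \<in> W" "d3 \<in> W" "d4 \<in> W" "d5 \<in> W" using dU by auto
    \<comment> \<open>the cycle on \<open>d1, d2, d3\<close> is the commutator of the cycles on \<open>d1, d2, d4\<close> and \<open>d1, d3, d5\<close>\<close>
    have e1: "?E d1 d4 d2" "?E d1 d2 d4" "?E d1 d3 d5" "?E d1 d5 d3"
      by (rule E; use dist in auto)+
    let ?\<alpha> = "?g d1 d4 d2" and ?\<beta> = "?g d1 d3 d5"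
    have "binv ?\<alpha> \<star> ?\<beta> \<star> ?\<alpha> \<star> binv ?\<beta> \<in> GG"
      by (rule comm[OF acts[OF e1(1)] even[OF e1(1)] acts[OF e1(3)] even[OF e1(3)]])
        (use unmoved dW e1 in auto)
    also have "binv ?\<alpha> \<star> ?\<beta> \<star> ?\<alpha> \<star> binv ?\<beta>
      = pgate M (cyc d1 d2 d4 \<circ> cyc d1 d3 d5 \<circ> cyc d1 d4 d2 \<circ> cyc d1 d5 d3)"
    proof -
      have pp: "pattern_perm M ?N (cyc d1 d2 d4)" "pattern_perm M ?N (cyc d1 d3 d5)"
        "pattern_perm M ?N (cyc d1 d4 d2)" "pattern_perm M ?N (cyc d1 d5 d3)"
        using exchangeable_perm e1 by auto
      have 1: "?g d1 d2 d4 \<star> ?\<beta> = pgate M (cyc d1 d2 d4 \<circ> cyc d1 d3 d5)"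
        by (rule gprod) (use pp gB e1 in auto)
      have 2: "pgate M (cyc d1 d2 d4 \<circ> cyc d1 d3 d5) \<star> ?\<alpha>
        = pgate M (cyc d1 d2 d4 \<circ> cyc d1 d3 d5 \<circ> cyc d1 d4 d2)"
        by (rule gprod) (use pp pattern_perm_comp gB e1 B.m_closed 1[symmetric] in auto)
      have 3: "pgate M (cyc d1 d2 d4 \<circ> cyc d1 d3 d5 \<circ> cyc d1 d4 d2) \<star> ?g d1 d5 d3
        = pgate M (cyc d1 d2 d4 \<circ> cyc d1 d3 d5 \<circ> cyc d1 d4 d2 \<circ> cyc d1 d5 d3)"
        by (rule gprod) (use pp pattern_perm_comp gB e1 B.m_closed 1[symmetric] 2[symmetric] in auto)
      show ?thesis unfolding ginv[OF e1(1)] ginv[OF e1(3)] 1 2 3 ..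
    qed
    also have "\<dots> = ?g d1 d2 d3" using cyc_commutator[OF dist] by simp
    finally have s0: "?g d1 d2 d3 \<in> GG" .
    \<comment> \<open>replacing \<open>d1\<close>, \<open>d2\<close>, \<open>d3\<close> one at a time by \<open>a\<close>, \<open>b\<close>, \<open>c\<close>, conjugating by cycles through \<open>d4\<close>\<close>
    have s1: "?g a d2 d3 \<in> GG"
      by (intro conj_step[OF s0, of a d4] E) (use dist8 in auto)
    have "distinct [a, d2, d3]" "distinct [b, d3, a]" "distinct [c, a, b]" using dist8 by auto
    note rot = this[THEN cyc_rotate]
    have "?g a d2 d3 = ?g d2 d3 a" by (simp only: rot(1))
    then have s2: "?g b d3 a \<in> GG"
      using s1 by (intro conj_step[of d2 d3 a b d4] E) (use dist8 in auto)
    have "?g b d3 a = ?g d3 a b" by (simp only: rot(2))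
    then have s3: "?g c a b \<in> GG"
      using s2 by (intro conj_step[of d3 a b c d4] E) (use dist8 in auto)
    have "?g c a b = ?g a b c" by (simp only: rot(3))
    then show ?thesis using s3 by simp
  qed
  then have "{?g a b c | a b c. ?E a b c} \<subseteq> GG" by blast
  then show ?thesis
    using B.generate_subgroup_incl[OF _ GG] even_gate_generated[OF sc aM ev] by blast
qed

text \<open>
  A 3-cycle of exchangeable patterns moves some configuration at a cell \<open>k\<close> of \<open>M\<close>, and so does its
  lattice along a small \<open>K\<close>, because the conjugates by the other elements of \<open>K\<close> do not reach \<open>k\<close>.
\<close>

lemma LE_nontrivial: "LE \<noteq> {\<one>\<^bsub>B\<^esub>}"
proof
  assume triv: "LE = {\<one>\<^bsub>B\<^esub>}"
  obtain p where p: "p \<in> X" using X_nonempty by blast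
  obtain F N where F: "finite F" "F \<subseteq> carrier G" and N: "finite N" "N \<subseteq> carrier G"
    and "{} \<subseteq> F"
    and many: "\<And>M N' a. finite M \<Longrightarrow> F \<subseteq> M \<Longrightarrow> M \<subseteq> carrier G \<Longrightarrow> N \<subseteq> N' \<Longrightarrow> a \<in> patterns M \<Longrightarrow>
       \<exists>W \<subseteq> patterns M. card W = 3 \<and> finite W \<and> (\<forall>w\<in>W. agree (M - N') w a \<and> agree {} w p)"
    by (rule many_patterns[OF finite.emptyI empty_subsetI p, where n = 3], rule that)
  obtain M0 where M0: "screens M0 N" using SFT_screens[OF sft N] .
  let ?M = "M0 \<union> F"
  have M: "finite ?M" "?M \<subseteq> carrier G" using M0 F by (auto simp: screens_def)
  have sc: "screens ?M N" by (rule screens_mono[OF M0 _ M]) simp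
  obtain W where W: "W \<subseteq> patterns ?M" "card W = 3" "\<forall>w\<in>W. agree (?M - N) w (restrict p ?M)"
    using many[OF M(1) _ M(2) order_refl restrict_in_patterns[OF p]] by blast
  then obtain a b c where abc: "W = {a, b, c}" "distinct [a, b, c]" by (auto simp: card_3_iff)
  have ball: "agree (?M - N) w (restrict p ?M)" if "w \<in> {a, b, c}" for w using W(3) that abc(1) by blast
  have e: "exchangeable ?M N a b c"
    using W(1) abc(2) ball[of a] ball[of b] ball[of c] unfolding exchangeable_def agree_def abc(1) by auto
  let ?\<phi> = "pgate ?M (cyc a b c)"
  have A: "acts_on ?M ?\<phi>" using cyc_gate_acts_on[OF sc e] .
  have \<phi>B: "?\<phi> \<in> carrier B" using acts_onD(3)[OF A] .
  obtain x where x: "x \<in> X" "a = restrict x ?M" using W(1) abc by (auto simp: patterns_def)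
  have "restrict (?\<phi> x) ?M = b"
    using pgate_restrict[OF sc exchangeable_perm[OF e] x(1)] x(2) abc(2) by (simp add: cyc_apply)
  then have "\<not> agree ?M (?\<phi> x) x" using x(2) abc(2) by (auto simp flip: restrict_eq_iff)
  then obtain k where k: "k \<in> ?M" "?\<phi> x k \<noteq> x k" by (auto simp: agree_def)
  obtain K where K: "K \<in> \<I>" "\<forall>a\<in>carrier G. spread (K #> a) ?M"
    using for_smallE[OF spread_small[OF M]] by metis
  have K1: "K #> \<one> = K" using net_subset[OF K(1)] by simp
  have sp: "spread K ?M" using K(2) K1 one_closed by metis
  have oneK: "\<one> \<in> K" using subgroup.one_closed[OF net_subgroup[OF K(1)]] .
  note c = spread_commuting[OF sp A] and KG = net_subset[OF K(1)]
  have cK': "B.commuting (cj ?\<phi>) (K - {\<one>})" by (rule B.commuting_subset[OF c]) auto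
  have KU: "(K - {\<one>}) \<union> {\<one>} = K" using oneK by auto
  have "lat ((K - {\<one>}) \<union> {\<one>}) ?\<phi> = lat (K - {\<one>}) ?\<phi> \<star> lat {\<one>} ?\<phi>"
    by (rule lat_Un[OF A]) (use KU KG c in auto)
  then have latK: "lat K ?\<phi> = lat (K - {\<one>}) ?\<phi> \<star> ?\<phi>"
    unfolding KU using \<phi>B by (simp add: lat_singleton)
  have lB: "lat (K - {\<one>}) ?\<phi> \<in> carrier B" by (rule lat_in_B(1)[OF A _ cK']) (use KG in auto)
  have "lat (K - {\<one>}) ?\<phi> (?\<phi> x) k = ?\<phi> x k"
  proof (rule lat_outside[OF A _ cK'])
    show "k \<notin> ?M #> s" if "s \<in> K - {\<one>}" for s
    proof -
      have "(?M #> s) \<inter> (?M #> \<one>) = {}" using sp that oneK unfolding spread_def by blast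
      moreover have "k \<in> ?M #> \<one>" using k(1) M(2) coset_mult_one by blast
      ultimately show ?thesis by blast
    qed
  qed (use KG k M B_in_X[OF \<phi>B x(1)] in auto)
  then have "lat K ?\<phi> x k \<noteq> x k" using latK lB \<phi>B x(1) k(2) by (simp add: B_apply)
  moreover have "lat (K #> \<one>) ?\<phi> \<in> LE"
    unfolding even_gate_lattice_group_def
    by (rule generate.incl, rule elatticesI[OF cyc_gate_commutator(4)[OF sc e] K(1) one_closed])
      (use c K1 in simp)
  ultimately show False using triv K1 x(1) by (simp add: B_one_apply)
qed

section \<open>The monolith\<close>

text \<open>
  As \<open>\<alpha>\<close> moves nothing outside \<open>A\<close> and \<open>f\<close> maps \<open>A\<close> off itself, \<open>f \<star> \<alpha> \<star> binv f\<close> moves nothing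
  inside \<open>A\<close>. Hence \<open>\<gamma>\<close> acts on \<open>A\<close> as \<open>binv \<alpha>\<close> and preserves the complement, where \<open>\<beta>\<close> is trivial.
\<close>

lemma double_commutator:
  assumes f: "f \<in> carrier B" and \<alpha>: "\<alpha> \<in> carrier B" and \<beta>: "\<beta> \<in> carrier B"
    and A: "A \<subseteq> X" and fA: "\<And>x. x \<in> A \<Longrightarrow> f x \<notin> A"
    and \<alpha>A: "\<And>x. x \<in> X \<Longrightarrow> x \<notin> A \<Longrightarrow> \<alpha> x = x" and \<beta>A: "\<And>x. x \<in> X \<Longrightarrow> x \<notin> A \<Longrightarrow> \<beta> x = x"
  defines "\<gamma> \<equiv> f \<star> \<alpha> \<star> binv f \<star> binv \<alpha>"
  shows "\<gamma> \<star> \<beta> \<star> binv \<gamma> \<star> binv \<beta> = binv \<alpha> \<star> \<beta> \<star> \<alpha> \<star> binv \<beta>"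
proof -
  have \<gamma>: "\<gamma> \<in> carrier B" using f \<alpha> by (simp add: \<gamma>_def)
  have stay: "\<delta> x \<in> A \<and> binv \<delta> x \<in> A"
    if \<delta>: "\<delta> \<in> carrier B" and out: "\<And>x. x \<in> X \<Longrightarrow> x \<notin> A \<Longrightarrow> \<delta> x = x" and x: "x \<in> A" for \<delta> x
  proof -
    have xX: "x \<in> X" using x A by auto
    have 1: "\<delta> x \<in> X" "binv \<delta> x \<in> X" using B_in_X \<delta> xX by auto
    have "\<delta> x \<in> A"
    proof (rule ccontr)
      assume n: "\<delta> x \<notin> A"
      then have "\<delta> (\<delta> x) = \<delta> x" using out 1 by simp
      then have "\<delta> x = x" using B_inv_left[OF \<delta>] 1 xX by metis
      then show False using n x by simp
    qed
    moreover have "binv \<delta> x \<in> A"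
    proof (rule ccontr)
      assume n: "binv \<delta> x \<notin> A"
      then have "\<delta> (binv \<delta> x) = binv \<delta> x" using out 1 by simp
      then show False using n x B_inv_right[OF \<delta> xX] by simp
    qed
    ultimately show "\<delta> x \<in> A \<and> binv \<delta> x \<in> A" by simp
  qed
  have fix_inv: "binv \<delta> y = y"
    if \<delta>: "\<delta> \<in> carrier B" and out: "\<And>x. x \<in> X \<Longrightarrow> x \<notin> A \<Longrightarrow> \<delta> x = x" and y: "y \<in> X" "y \<notin> A" for \<delta> y
    using out[OF y] B_inv_left[OF \<delta> y(1)] by simp
  have \<gamma>_in: "\<gamma> y = binv \<alpha> y" if y: "y \<in> A" for y
  proof -
    let ?u = "binv \<alpha> y"
    have yX: "y \<in> X" using y A by auto
    have u: "?u \<in> A" "?u \<in> X" using stay[OF \<alpha> \<alpha>A y] A by auto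
    have iu: "binv f ?u \<in> X" using f u B_in_X by auto
    have "binv f ?u \<notin> A" using fA[of "binv f ?u"] B_inv_right[OF f u(2)] u(1) by auto
    then have "\<alpha> (binv f ?u) = binv f ?u" using \<alpha>A iu by blast
    then have "f (\<alpha> (binv f ?u)) = ?u" using B_inv_right[OF f u(2)] by simp
    then show ?thesis using f \<alpha> yX u iu by (simp add: \<gamma>_def B_apply B_in_X)
  qed
  have \<gamma>_out: "\<gamma> y \<notin> A" if y: "y \<in> X" "y \<notin> A" for y
  proof -
    have iy: "binv f y \<in> X" using f y B_in_X by auto
    have "\<gamma> y = f (\<alpha> (binv f y))"
      using fix_inv[OF \<alpha> \<alpha>A y] f \<alpha> y iy by (simp add: \<gamma>_def B_apply B_in_X)
    then show ?thesis
      using stay[OF \<alpha> \<alpha>A, of "binv f y"] fA \<alpha>A[OF iy] B_inv_right[OF f y(1)] y(2)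
      by (cases "binv f y \<in> A") auto
  qed
  have \<gamma>i_in: "binv \<gamma> y = \<alpha> y" if y: "y \<in> A" for y
  proof -
    have ay: "\<alpha> y \<in> A" "\<alpha> y \<in> X" "y \<in> X" using stay[OF \<alpha> \<alpha>A y] y A by auto
    then have "\<gamma> (\<alpha> y) = y" using \<gamma>_in[OF ay(1)] B_inv_left[OF \<alpha> ay(3)] by simp
    then show ?thesis using B_inv_left[OF \<gamma> ay(2)] by simp
  qed
  have \<gamma>i_out: "binv \<gamma> y \<notin> A" if y: "y \<in> X" "y \<notin> A" for y
  proof
    assume a: "binv \<gamma> y \<in> A"
    then have "\<gamma> (binv \<gamma> y) \<in> A" using \<gamma>_in[OF a] stay[OF \<alpha> \<alpha>A a] by simp
    then show False using B_inv_right[OF \<gamma> y(1)] y(2) by simp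
  qed
  show ?thesis
  proof (rule B_eqI)
    show "\<gamma> \<star> \<beta> \<star> binv \<gamma> \<star> binv \<beta> \<in> carrier B" "binv \<alpha> \<star> \<beta> \<star> \<alpha> \<star> binv \<beta> \<in> carrier B"
      using \<alpha> \<beta> \<gamma> by auto
    fix x assume x: "x \<in> X"
    have L: "(\<gamma> \<star> \<beta> \<star> binv \<gamma> \<star> binv \<beta>) x = \<gamma> (\<beta> (binv \<gamma> (binv \<beta> x)))"
      and R: "(binv \<alpha> \<star> \<beta> \<star> \<alpha> \<star> binv \<beta>) x = binv \<alpha> (\<beta> (\<alpha> (binv \<beta> x)))"
      using \<alpha> \<beta> \<gamma> x by (simp_all add: B_apply B_in_X)
    show "(\<gamma> \<star> \<beta> \<star> binv \<gamma> \<star> binv \<beta>) x = (binv \<alpha> \<star> \<beta> \<star> \<alpha> \<star> binv \<beta>) x"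
    proof (cases "x \<in> A")
      case True
      have 1: "binv \<beta> x \<in> A" using stay[OF \<beta> \<beta>A True] by simp
      have 2: "\<alpha> (binv \<beta> x) \<in> A" using stay[OF \<alpha> \<alpha>A 1] by simp
      have 3: "\<beta> (\<alpha> (binv \<beta> x)) \<in> A" using stay[OF \<beta> \<beta>A 2] by simp
      show ?thesis unfolding L R \<gamma>i_in[OF 1] \<gamma>_in[OF 3] ..
    next
      case False
      have 1: "binv \<beta> x = x" using fix_inv[OF \<beta> \<beta>A x False] .
      have 2: "binv \<gamma> x \<in> X" "binv \<gamma> x \<notin> A" using \<gamma>i_out[OF x False] \<gamma> x B_in_X by auto
      have "\<beta> (binv \<gamma> x) = binv \<gamma> x" using \<beta>A[OF 2] .
      then show ?thesis
        unfolding L R 1 using B_inv_right[OF \<gamma> x] \<alpha>A[OF x False] \<beta>A[OF x False] fix_inv[OF \<alpha> \<alpha>A x False]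
        by simp
    qed
  qed
qed

text \<open>
  The set \<open>D\<close> consists of a cell at which \<open>f p\<close> differs from \<open>p\<close> and of a window for that cell of \<open>f p\<close>.
\<close>

lemma displaced_cylinder:
  assumes f: "f \<in> homeos" "f \<noteq> \<one>\<^bsub>B\<^esub>"
  obtains D p where "finite D" "D \<subseteq> carrier G" "p \<in> X" "\<And>x. x \<in> X \<Longrightarrow> agree D x p \<Longrightarrow> \<not> agree D (f x) p"
proof -
  have fB: "f \<in> carrier B" and w: "windowed f" using f by (auto simp: homeos_def)
  obtain p where p: "p \<in> X" "f p \<noteq> p"
  proof (rule ccontr)
    assume "\<not> thesis"
    then have "f p = p" if "p \<in> X" for p using that \<open>\<And>p. p \<in> X \<Longrightarrow> f p \<noteq> p \<Longrightarrow> thesis\<close> by blast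
    then have "f = \<one>\<^bsub>B\<^esub>" using fB by (intro B_eqI) (auto simp: B_one_apply)
    then show False using f(2) by simp
  qed
  have "\<not> agree (carrier G) (f p) p" using p X_eqI[OF B_in_X[OF fB p(1)] p(1)] by blast
  then obtain k where k: "k \<in> carrier G" "f p k \<noteq> p k" by (auto simp: agree_def)
  obtain V where V: "finite V" "V \<subseteq> carrier G"
    "\<And>x y. x \<in> X \<Longrightarrow> y \<in> X \<Longrightarrow> agree V x y \<Longrightarrow> agree {k} (f x) (f y)"
    using windowedE[OF w, of "{k}"] k(1) by auto
  show thesis
  proof (rule that[of "insert k V" p])
    fix x assume x: "x \<in> X" "agree (insert k V) x p"
    have "f x k = f p k" using V(3)[OF x(1) p(1)] x(2) by (auto simp: agree_def)
    then show "\<not> agree (insert k V) (f x) p" using k(2) by (auto simp: agree_def)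
  qed (use V k p in auto)
qed

text \<open>
  Let \<open>f \<in> N\<close> be nontrivial and commute with the shifts by \<open>H\<close>. The gates whose lattices along the
  cosets \<open>K #> h\<close>, \<open>h \<in> H\<close>, lie in \<open>N\<close> for all small \<open>K\<close> form a group to which
  \<open>even_gates_normally_generated\<close> applies: it contains the double commutators of \<open>f\<close>. How small \<open>K\<close>
  has to be does not depend on \<open>h\<close>, and as \<open>H\<close> has finite index, one bound serves for all cosets.
\<close>

lemma even_lattices_in_normalized_subgroups:
  assumes N: "subgroup N B" "N \<subseteq> SA" and nontriv: "N \<noteq> {\<one>\<^bsub>B\<^esub>}"
    and norm: "\<And>q n. q \<in> LE \<Longrightarrow> n \<in> N \<Longrightarrow> q \<star> n \<star> binv q \<in> N"
  shows "LE \<subseteq> N"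
proof -
  obtain f where f: "f \<in> N" "f \<noteq> \<one>\<^bsub>B\<^esub>" using nontriv subgroup.one_closed[OF N(1)] by blast
  obtain H where H: "H \<in> \<I>" "H \<lhd> G" and fH: "f \<in> Aut_subshift G \<Sigma> X H" using SA_E f N(2) by blast
  note HG = net_subset[OF H(1)] and NB = subgroup.mem_carrier[OF N(1)]
  have fh: "f \<in> homeos" and fc: "\<And>h. h \<in> H \<Longrightarrow> f \<star> sh h = sh h \<star> f" using fH Aut_iff[OF HG] by auto
  have fB: "f \<in> carrier B" using NB f by blast
  have fe: "finite_effect f" by (rule Aut_finite_effect[OF net_index[OF H(1)] fH])
  obtain D p where D: "finite D" "D \<subseteq> carrier G" "p \<in> X"
    "\<And>x. x \<in> X \<Longrightarrow> agree D x p \<Longrightarrow> \<not> agree D (f x) p"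
    using displaced_cylinder[OF fh f(2)] by blast
  let ?ok = "\<lambda>\<phi> K. \<forall>h\<in>H. lat (K #> h) \<phi> \<in> N"
  define GG where "GG = {\<phi>. (\<exists>M. acts_on M \<phi>) \<and> for_small (?ok \<phi>)}"
  have GGI: "\<phi> \<in> GG" if M: "acts_on M \<phi>" and P: "for_small P"
    and ok: "\<And>K h. K \<in> \<I> \<Longrightarrow> K \<lhd> G \<Longrightarrow> K \<subseteq> H \<Longrightarrow> h \<in> H \<Longrightarrow> h \<in> carrier G \<Longrightarrow> P K \<Longrightarrow>
      spread (K #> h) M \<Longrightarrow> lat (K #> h) \<phi> \<in> N" for \<phi> M P
  proof -
    have "for_small (\<lambda>K. P K \<and> (\<forall>a\<in>carrier G. spread (K #> a) M) \<and> K \<subseteq> H)"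
      by (intro for_small_conj P spread_small[OF acts_onD(1,2)[OF M]] for_small_below[OF H(1)])
    then have "for_small (?ok \<phi>)" by (rule for_small_mono) (use ok HG in blast)
    then show ?thesis using M GG_def by blast
  qed
  have evenLE: "lat (K #> h) \<alpha> \<in> LE"
    if "K \<in> \<I>" "h \<in> carrier G" "spread (K #> h) M" "acts_on M \<alpha>" "even_off N' \<alpha>" for K h M \<alpha> N'
    unfolding even_gate_lattice_group_def
    by (rule generate.incl, rule elatticesI[OF that(5,1,2) spread_commuting[OF that(3,4)]])
  have common: "\<exists>M. acts_on M \<phi> \<and> acts_on M \<psi> \<and> acts_on M \<eta>"
    if "acts_on M1 \<phi>" "acts_on M2 \<psi>" "acts_on M3 \<eta>" for M1 M2 M3 \<phi> \<psi> \<eta>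
  proof -
    have M: "finite (M1 \<union> M2 \<union> M3)" "M1 \<union> M2 \<union> M3 \<subseteq> carrier G"
      using acts_onD(1,2)[OF that(1)] acts_onD(1,2)[OF that(2)] acts_onD(1,2)[OF that(3)] by auto
    have "acts_on (M1 \<union> M2 \<union> M3) \<phi>" by (rule acts_on_mono[OF that(1) _ M]) blast
    moreover have "acts_on (M1 \<union> M2 \<union> M3) \<psi>" by (rule acts_on_mono[OF that(2) _ M]) blast
    moreover have "acts_on (M1 \<union> M2 \<union> M3) \<eta>" by (rule acts_on_mono[OF that(3) _ M]) blast
    ultimately show ?thesis by blast
  qed
  have GGsub: "subgroup GG B"
  proof (rule B.subgroupI)
    show "GG \<subseteq> carrier B" using acts_onD(3) by (auto simp: GG_def)
    have "\<one>\<^bsub>B\<^esub> \<in> GG"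
      by (rule GGI[OF acts_on_one[of "{}"] for_small_True])
        (use lat_one spreadD subgroup.one_closed[OF N(1)] in auto)
    then show "GG \<noteq> {}" by blast
    fix \<phi> assume "\<phi> \<in> GG"
    then obtain M1 where 1: "acts_on M1 \<phi>" "for_small (?ok \<phi>)" by (auto simp: GG_def)
    show "binv \<phi> \<in> GG"
      by (rule GGI[OF acts_on_inv[OF 1(1)] 1(2)])
        (use lat_inv[OF _ 1(1)] subgroup.m_inv_closed[OF N(1)] in auto)
    fix \<psi> assume "\<psi> \<in> GG"
    then obtain M2 where 2: "acts_on M2 \<psi>" "for_small (?ok \<psi>)" by (auto simp: GG_def)
    obtain M where M: "acts_on M \<phi>" "acts_on M \<psi>" using common[OF 1(1) 2(1) 2(1)] by blast
    show "\<phi> \<star> \<psi> \<in> GG"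
      by (rule GGI[OF acts_on_mult[OF M] for_small_conj[OF 1(2) 2(2)]])
        (use lat_mult[OF _ M] subgroup.m_closed[OF N(1)] in auto)
  qed
  have GGeven: "\<phi> \<in> GG" if \<phi>: "even_off N0 \<phi>" for \<phi> N0
  proof (rule even_gates_normally_generated[OF D(1-3) GGsub _ _ \<phi>])
    fix M N' \<alpha> \<gamma> assume \<alpha>: "acts_on M \<alpha>" "even_off N' \<alpha>" and "\<gamma> \<in> GG"
    then obtain M1 where \<gamma>: "acts_on M1 \<gamma>" "for_small (?ok \<gamma>)" by (auto simp: GG_def)
    obtain L where L: "acts_on L \<alpha>" "acts_on L \<gamma>" using common[OF \<alpha>(1) \<gamma>(1) \<gamma>(1)] by blast
    show "\<alpha> \<star> \<gamma> \<star> binv \<alpha> \<in> GG"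
    proof (rule GGI[OF acts_on_mult[OF acts_on_mult[OF L] acts_on_inv[OF L(1)]] \<gamma>(2)])
      fix K h assume K: "K \<in> \<I>" "h \<in> H" "h \<in> carrier G" "?ok \<gamma> K" and sp: "spread (K #> h) L"
      have "lat (K #> h) (\<alpha> \<star> \<gamma> \<star> binv \<alpha>)
        = lat (K #> h) \<alpha> \<star> lat (K #> h) \<gamma> \<star> binv (lat (K #> h) \<alpha>)"
        using L by (simp add: lat_mult[OF sp] lat_inv[OF sp] acts_on_mult acts_on_inv)
      then show "lat (K #> h) (\<alpha> \<star> \<gamma> \<star> binv \<alpha>) \<in> N"
        using norm[OF evenLE[OF K(1,3) sp L(1) \<alpha>(2)]] K by auto
    qed
  next
    fix M N' \<alpha> \<beta>
    assume \<alpha>: "acts_on M \<alpha>" "even_off N' \<alpha>" and \<beta>: "acts_on M \<beta>" "even_off N' \<beta>"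
      and out: "\<And>x. x \<in> X \<Longrightarrow> \<not> agree D x p \<Longrightarrow> \<alpha> x = x" "\<And>x. x \<in> X \<Longrightarrow> \<not> agree D x p \<Longrightarrow> \<beta> x = x"
    let ?f\<alpha> = "f \<star> \<alpha> \<star> binv f"
    obtain M1 where M1: "acts_on M1 ?f\<alpha>" using gate_conjugate[OF fh fe \<alpha>(1)] by blast
    obtain L where L: "acts_on L \<alpha>" "acts_on L \<beta>" "acts_on L ?f\<alpha>" using common[OF \<alpha>(1) \<beta>(1) M1] by blast
    let ?\<gamma> = "?f\<alpha> \<star> binv \<alpha>"
    have \<gamma>: "acts_on L ?\<gamma>" by (intro acts_on_mult acts_on_inv L)
    have "?\<gamma> \<star> \<beta> \<star> binv ?\<gamma> \<star> binv \<beta> \<in> GG"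
    proof (rule GGI[OF _ for_small_True])
      show "acts_on L (?\<gamma> \<star> \<beta> \<star> binv ?\<gamma> \<star> binv \<beta>)" by (intro acts_on_mult acts_on_inv L)
      fix K h assume K: "K \<in> \<I>" "K \<subseteq> H" "h \<in> H" "h \<in> carrier G" and sp: "spread (K #> h) L"
      let ?l = "lat (K #> h)"
      have lB: "?l \<alpha> \<in> carrier B" "?l \<beta> \<in> carrier B" using lat_spread(2)[OF sp] L by auto
      have lE: "?l \<alpha> \<in> LE" "?l \<beta> \<in> LE" using evenLE[OF K(1,4) sp] L \<alpha> \<beta> by auto
      have KhH: "K #> h \<subseteq> H"
        using K subgroup.m_closed[OF net_subgroup[OF H(1)]] by (auto simp: r_coset_def)
      have "?l ?f\<alpha> = f \<star> ?l \<alpha> \<star> binv f"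
        by (rule lat_conj(1)[OF fh _ L(1) spreadD[OF sp] spread_commuting[OF sp L(1)]]) (use fc KhH in blast)
      then have "?l ?\<gamma> = f \<star> (?l \<alpha> \<star> binv f \<star> binv (?l \<alpha>))"
        using L lB fB by (simp add: lat_mult[OF sp] lat_inv[OF sp] acts_on_inv B.m_assoc)
      moreover have "?l \<alpha> \<star> binv f \<star> binv (?l \<alpha>) \<in> N"
        using norm[OF lE(1) subgroup.m_inv_closed[OF N(1) f(1)]] .
      ultimately have \<gamma>N: "?l ?\<gamma> \<in> N" using subgroup.m_closed[OF N(1) f(1)] by simp
      have "?l (?\<gamma> \<star> \<beta> \<star> binv ?\<gamma> \<star> binv \<beta>) = ?l ?\<gamma> \<star> ?l \<beta> \<star> binv (?l ?\<gamma>) \<star> binv (?l \<beta>)"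
        using L \<gamma> by (simp only: lat_mult[OF sp] lat_inv[OF sp] acts_on_mult acts_on_inv)
      also have "\<dots> = ?l ?\<gamma> \<star> (?l \<beta> \<star> binv (?l ?\<gamma>) \<star> binv (?l \<beta>))"
        using lB NB[OF \<gamma>N] by (simp add: B.m_assoc)
      also have "\<dots> \<in> N"
        by (rule subgroup.m_closed[OF N(1) \<gamma>N norm[OF lE(2) subgroup.m_inv_closed[OF N(1) \<gamma>N]]])
      finally show "?l (?\<gamma> \<star> \<beta> \<star> binv ?\<gamma> \<star> binv \<beta>) \<in> N" .
    qed
    also have "?\<gamma> \<star> \<beta> \<star> binv ?\<gamma> \<star> binv \<beta> = binv \<alpha> \<star> \<beta> \<star> \<alpha> \<star> binv \<beta>"
      by (rule double_commutator[OF fB acts_onD(3)[OF \<alpha>(1)] acts_onD(3)[OF \<beta>(1)],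
            of "{x \<in> X. agree D x p}"]) (use D(4) out in auto)
    finally show "binv \<alpha> \<star> \<beta> \<star> \<alpha> \<star> binv \<beta> \<in> GG" .
  qed
  obtain R where R: "finite R" "R \<subseteq> carrier G" "\<And>g. g \<in> carrier G \<Longrightarrow> \<exists>r\<in>R. \<exists>h\<in>H. g = r \<otimes> h"
    using finite_index_representatives[OF net_index[OF H(1)]] by metis
  have "elattices \<subseteq> N"
  proof
    fix l assume "l \<in> elattices"
    then obtain N' \<phi> H' g where l: "even_off N' \<phi>" "acts_on N' \<phi>" "H' \<in> \<I>" "g \<in> carrier G"
      "B.commuting (cj \<phi>) (H' #> g)" "l = lat (H' #> g) \<phi>" by (rule elatticesE)
    have "for_small (?ok (cj \<phi> r))" if "r \<in> R" for r
    proof -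
      have "r \<in> carrier G" using that R(2) by blast
      then obtain M where "even_off M (cj \<phi> r)" using even_cj[OF l(1)] by blast
      then have "cj \<phi> r \<in> GG" by (rule GGeven)
      then show ?thesis by (simp add: GG_def)
    qed
    then have fs: "for_small (\<lambda>K. \<forall>r\<in>R. ?ok (cj \<phi> r) K)" by (rule for_small_ball[OF R(1)])
    obtain K where "K \<in> \<I>" "K \<lhd> G" "(\<forall>r\<in>R. ?ok (cj \<phi> r) K) \<and> K \<subseteq> H'"
      by (rule for_smallE[OF for_small_conj[OF fs for_small_below[OF l(3)]]])
    then have K: "K \<in> \<I>" "K \<lhd> G" "\<forall>r\<in>R. ?ok (cj \<phi> r) K" "K \<subseteq> H'" by auto
    have "lat (H' #> g) \<phi> \<in> N"
    proof (rule lat_split[OF l(2-5) K(1,4) N(1)])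
      fix a assume a: "a \<in> H' #> g"
      then have aG: "a \<in> carrier G" using coset_subset[OF l(3,4)] by auto
      obtain r h where rh: "r \<in> R" "h \<in> H" "a = r \<otimes> h" using R(3)[OF aG] by blast
      have G: "r \<in> carrier G" "h \<in> carrier G" using rh R(2) HG by auto
      have im: "(\<lambda>s. r \<otimes> s) ` (K #> h) = K #> a"
        using normal_translate_coset[OF K(2) G(2,1)] rh(3) by simp
      have c: "B.commuting (cj \<phi>) (K #> a)"
        by (rule B.commuting_subset[OF l(5) subcoset[OF l(3) K(1,4) l(4) a]])
      have "lat (K #> a) \<phi> = lat (K #> h) (cj \<phi> r)"
        using lat_translate(1)[OF l(2) G(1) coset_subset[OF K(1) G(2)], unfolded im, OF c] .
      then show "lat (K #> a) \<phi> \<in> N" using K(3) rh by simp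
    qed
    then show "l \<in> N" using l(6) by simp
  qed
  then show ?thesis
    unfolding even_gate_lattice_group_def by (rule B.generate_subgroup_incl[OF _ N(1)])
qed

lemma is_monolith_LE:
  assumes S: "subgroup S B" "LE \<subseteq> S" "S \<subseteq> SA"
  shows "is_monolith LE (B\<lparr>carrier := S\<rparr>)"
  unfolding is_monolith_def
proof (intro conjI allI impI)
  show "LE \<lhd> B\<lparr>carrier := S\<rparr>"
    by (rule B.normal_in_subgroupI[OF S(1) subgroup_LE S(2)]) (use conj_LE S(3) in blast)
  show "LE \<noteq> {\<one>\<^bsub>B\<lparr>carrier := S\<rparr>\<^esub>}" using LE_nontrivial by simp
  fix N assume N: "N \<lhd> B\<lparr>carrier := S\<rparr> \<and> N \<noteq> {\<one>\<^bsub>B\<lparr>carrier := S\<rparr>\<^esub>}"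
  note n = B.normal_in_subgroupD[OF S(1) conjunct1[OF N]]
  show "LE \<subseteq> N"
    by (rule even_lattices_in_normalized_subgroups) (use n N S in auto)
qed

end

section \<open>Simplicity, commutators, normality and the monolith\<close>

theorem theorem6:
  fixes G :: "('g, 'm) monoid_scheme"
    and \<Sigma> :: "'a set"
    and X :: "('g \<Rightarrow> 'a) set"
    and \<I> :: "'g set set"
  assumes "group G"
    and "countable (carrier G)" and "infinite (carrier G)"
    and "residually_finite G"
    and "finite \<Sigma>"
    and "SFT G \<Sigma> X"
    and "EFP G X"
    and "lattice_net G \<I>"
  defines "L \<equiv> gate_lattice_group G \<Sigma> X \<I>"
    and "Le \<equiv> even_gate_lattice_group G \<Sigma> X \<I>"
    and "SA \<equiv> SAut G \<Sigma> X \<I>"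
  shows "(\<not> is_singleton X \<longrightarrow> is_simple (BijGroup X\<lparr>carrier := Le\<rparr>)) \<and>
    Le = derived (BijGroup X) L \<and>
    (Le \<lhd> BijGroup X\<lparr>carrier := SA\<rparr> \<and> L \<lhd> BijGroup X\<lparr>carrier := SA\<rparr>) \<and>
    (\<not> is_singleton X \<longrightarrow>
       is_monolith Le (BijGroup X\<lparr>carrier := L\<rparr>) \<and>
       is_monolith Le (BijGroup X\<lparr>carrier := SA\<rparr>))"
proof -
  have "subshift G \<Sigma> X" using assms(6) by (simp add: SFT_def)
  then interpret lattice_system G \<Sigma> X \<I>
    using assms by (simp add: lattice_system_def lattice_system_axioms_def subshift_system_def subshift_system_axioms_def)
  have eq: "L = LL" "Le = LE" by (simp_all add: L_def Le_def)
  have "Le = derived (BijGroup X) L"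
    unfolding eq using derived_subset even_gate_lattices_derived[OF assms(6)] by blast
  moreover have "Le \<lhd> BijGroup X\<lparr>carrier := SA\<rparr>" "L \<lhd> BijGroup X\<lparr>carrier := SA\<rparr>"
    unfolding eq SA_def
    using B.normal_in_subgroupI[OF subgroup_SA subgroup_LE] B.normal_in_subgroupI[OF subgroup_SA subgroup_LL]
      conj_LE conj_LL LE_subset_LL LL_subset_SA by blast+
  moreover have "is_simple (BijGroup X\<lparr>carrier := Le\<rparr>) \<and>
       is_monolith Le (BijGroup X\<lparr>carrier := L\<rparr>) \<and> is_monolith Le (BijGroup X\<lparr>carrier := SA\<rparr>)"
    if "\<not> is_singleton X"
  proof -
    interpret efp_system G \<Sigma> X \<I> by unfold_locales (use assms that in auto)
    have m: "is_monolith LE (BijGroup X\<lparr>carrier := LE\<rparr>)" "is_monolith LE (BijGroup X\<lparr>carrier := LL\<rparr>)"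
      "is_monolith LE (BijGroup X\<lparr>carrier := SAut G \<Sigma> X \<I>\<rparr>)"
      using is_monolith_LE subgroup_LE subgroup_LL subgroup_SA LE_subset_LL LL_subset_SA by auto
    \<comment> \<open>a group that is its own monolith is simple\<close>
    have "N = {\<one>\<^bsub>BijGroup X\<lparr>carrier := LE\<rparr>\<^esub>} \<or> N = LE" if N: "N \<lhd> BijGroup X\<lparr>carrier := LE\<rparr>" for N
      using m(1) N B.normal_in_subgroupD(2)[OF subgroup_LE N] unfolding is_monolith_def by blast
    then have "is_simple (BijGroup X\<lparr>carrier := LE\<rparr>)"
      unfolding is_simple_def
      using B.subgroup_imp_group[OF subgroup_LE] LE_nontrivial by simp
    then show ?thesis unfolding eq SA_def using m by simp
  qed
  ultimately show ?thesis by blast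
qed

end
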